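(* Let $(R,m_R)$ be a Noetherian local ring of dimension $d$ and let $I_1,\dots,I_r,J_1,\dots,J_r$ be ideals of $R$ such that $I_i\subseteq J_i$ and $l_R(J_i/I_i)<\infty$ for all $i=1,\dots,r$. Then there exists a numerical polynomial $F\in\mathbb{Q}[n_1,\dots,n_r]$ of total degree at most $d$ such that $$l_R\left(\frac{J_1^{n_1}\cdots J_r^{n_r}}{I_1^{n_1}\cdots I_r^{n_r}}\right)=F(n_1,\dots,n_r)$$ for all $n_1,\dots,n_r\gg0$.
   Context: A numerical polynomial is a polynomial with rational coefficients taking integer values at integer points; $l_R$ denotes length. *)

theory Defs
  imports "HOL-Algebra.Ideal_Product" "HOL-Algebra.Ring_Divisibility"
begin

definition prime_chain :: "('a, 'b) ring_scheme \<Rightarrow> (nat \<Rightarrow> 'a set) \<Rightarrow> nat \<Rightarrow> bool" where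
  "prime_chain R P n \<longleftrightarrow> (\<forall>i\<le>n. primeideal (P i) R) \<and> (\<forall>i<n. P i \<subset> P (Suc i))"

definition has_krull_dim :: "('a, 'b) ring_scheme \<Rightarrow> nat \<Rightarrow> bool" where
  "has_krull_dim R d \<longleftrightarrow> (\<exists>P. prime_chain R P d) \<and> (\<forall>P n. prime_chain R P n \<longrightarrow> n \<le> d)"

definition local_ring :: "('a, 'b) ring_scheme \<Rightarrow> bool" where
  "local_ring R \<longleftrightarrow> cring R \<and> (\<exists>!m. maximalideal m R)"

(* Length of the R-module M/N for ideals N \<subseteq> M of R.  R-submodules of M/N correspond
   to R-submodules of R (= ideals) lying between N and M, so a strict chain of
   submodules of M/N of length n is a strict chain of ideals N = K_0 < ... < K_n = M. *)
definition ideal_chain :: "('a, 'b) ring_scheme \<Rightarrow> 'a set \<Rightarrow> 'a set \<Rightarrow> (nat \<Rightarrow> 'a set) \<Rightarrow> nat \<Rightarrow> bool" where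
  "ideal_chain R N M K n \<longleftrightarrow> K 0 = N \<and> K n = M \<and> (\<forall>i\<le>n. ideal (K i) R) \<and> (\<forall>i<n. K i \<subset> K (Suc i))"

definition finite_length :: "('a, 'b) ring_scheme \<Rightarrow> 'a set \<Rightarrow> 'a set \<Rightarrow> bool" where
  "finite_length R N M \<longleftrightarrow> (\<exists>b. \<forall>K n. ideal_chain R N M K n \<longrightarrow> n \<le> b)"

definition quot_length :: "('a, 'b) ring_scheme \<Rightarrow> 'a set \<Rightarrow> 'a set \<Rightarrow> nat" where
  "quot_length R N M = (GREATEST n. \<exists>K. ideal_chain R N M K n)"

definition ideal_pow :: "('a, 'b) ring_scheme \<Rightarrow> 'a set \<Rightarrow> nat \<Rightarrow> 'a set" where
  "ideal_pow R I n = ((\<lambda>A. ideal_prod R I A) ^^ n) (carrier R)"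

definition ideal_multi_pow :: "('a, 'b) ring_scheme \<Rightarrow> nat \<Rightarrow> (nat \<Rightarrow> 'a set) \<Rightarrow> (nat \<Rightarrow> nat) \<Rightarrow> 'a set" where
  "ideal_multi_pow R r I n = foldr (\<lambda>i A. ideal_prod R (ideal_pow R (I i) (n i)) A) [0..<r] (carrier R)"

(* A polynomial in Q[n_0,...,n_{r-1}] given by a finite set A of exponent vectors
   (supported on {..<r}) and coefficients c; its value at an integer point x. *)
definition mpoly_eval :: "nat \<Rightarrow> (nat \<Rightarrow> nat) set \<Rightarrow> ((nat \<Rightarrow> nat) \<Rightarrow> rat) \<Rightarrow> (nat \<Rightarrow> int) \<Rightarrow> rat" where
  "mpoly_eval r A c x = (\<Sum>\<alpha>\<in>A. c \<alpha> * (\<Prod>i<r. of_int (x i) ^ \<alpha> i))"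

definition mpoly_repr :: "nat \<Rightarrow> nat \<Rightarrow> (nat \<Rightarrow> nat) set \<Rightarrow> bool" where
  "mpoly_repr r d A \<longleftrightarrow> finite A \<and> (\<forall>\<alpha>\<in>A. (\<forall>i\<ge>r. \<alpha> i = 0) \<and> (\<Sum>i<r. \<alpha> i) \<le> d)"

definition numerical :: "nat \<Rightarrow> (nat \<Rightarrow> nat) set \<Rightarrow> ((nat \<Rightarrow> nat) \<Rightarrow> rat) \<Rightarrow> bool" where
  "numerical r A c \<longleftrightarrow> (\<forall>x. mpoly_eval r A c x \<in> \<int>)"

end

(*
  Choose generators of the ideals J_i, listing generators of J_i before generators of I_i,
  and order exponent vectors of fixed multidegree n lexicographically, the smaller exponent at the
  first difference being the smaller vector.  The monomials in the generators then filter J^n by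
  ideals K_u with cyclic quotients R/L_u, where L_u = (K_{<u} : u), and the monomials in the
  generators of the I_i alone form an initial segment, which generates I^n.  So the length of
  J^n/I^n is the sum of the lengths of R/L_u over the remaining u of multidegree n.  Since L_u grows
  with u and R is Noetherian, L_u only depends on u truncated at some height c.  Grouping the u by
  their truncation turns the sum into a combination, with coefficients >= 0, of products of
  binomial coefficients, which is a numerical polynomial.

  The same truncation argument gives an Artin-Rees lemma for the ideals J_i together with a
  parameter ideal q.  It yields a constant N such that, with G = (N,...,N) and n >= G,
  J^n meets q^(k + N|n - G|) J^G inside q^k J^n.  As q^(c|n|) J^n is contained in I^n for
  some c, the length of J^n/I^n is at most that of J^G/q^K J^G with K = O(|n|), hence
  O(|n|^d).  No cancellation can occur in the combination above, so this bounds the total degree.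
*)

theory Submission
  imports Defs
begin

section \<open>Counting monomials\<close>

text \<open>The ideals need not be m-primary, so R/I^n and R/J^n may have infinite length and only
  the relative quotient can be measured. That each R/L_u in the sum has finite length is where the
  order of the generators enters. Some power a of the parameter ideal satisfies a J_i \<subseteq>
  I_i for all i. If u involves a generator g of J_i and z \<in> a, then z g is a combination of
  generators of I_i. These come later in the list, so trading g for one of them gives a smaller
  vector of the same multidegree, whence a \<subseteq> L_u. Redundant generators are harmless: a
  monomial already in K_{<u} has L_u = R and contributes 0. The number of generators alone would
  give a far too large degree. To reach d, J^n is compared with the fixed ideal J^G, because the
  number of generators of J^n may grow with n; an Artin-Rees loss linear in |n| then costs only a
  constant factor in the bound. As the terms of the sum are nonnegative, growth along the diagonal n
  = (t,...,t) controls the degree of each of them.\<close>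

definition expo :: "nat set \<Rightarrow> (nat \<Rightarrow> nat) set" where
  "expo V = {u. \<forall>j. j \<notin> V \<longrightarrow> u j = 0}"

text \<open>The index \<open>h j\<close> names the ideal to which the generator with index
  \<open>j\<close> belongs, so \<open>gdeg\<close> is the multidegree of a monomial in the
  generators.\<close>

definition gdeg :: "nat set \<Rightarrow> (nat \<Rightarrow> nat) \<Rightarrow> (nat \<Rightarrow> nat) \<Rightarrow> nat \<Rightarrow> nat" where
  "gdeg V h u i = (\<Sum>j | j \<in> V \<and> h j = i. u j)"

definition mons :: "nat set \<Rightarrow> (nat \<Rightarrow> nat) \<Rightarrow> (nat \<Rightarrow> nat) \<Rightarrow> (nat \<Rightarrow> nat) set" where
  "mons V h n = {u \<in> expo V. gdeg V h u = n}"

definition cap :: "nat \<Rightarrow> (nat \<Rightarrow> nat) \<Rightarrow> nat \<Rightarrow> nat" where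
  "cap c u = (\<lambda>j. min (u j) c)"

lemma finite_expo_le:
  assumes "finite V" shows "finite {u \<in> expo V. \<forall>j\<in>V. u j \<le> b j}"
proof -
  have "{u \<in> expo V. \<forall>j\<in>V. u j \<le> b j} \<subseteq> {u. (\<forall>j\<in>V. u j \<in> {..Max (b ` V)}) \<and> (\<forall>j. j \<notin> V \<longrightarrow> u j = 0)}"
    using assms by (auto simp: expo_def) (meson Max_ge finite_imageI imageI le_trans)
  then show ?thesis
    by (rule finite_subset)
      (use finite_set_of_finite_funs[OF assms finite_atMost[of "Max (b ` V)"], of 0] in \<open>simp add: conj_commute all_conj_distrib Ball_def\<close>)
qed

lemma expo_cap: "u \<in> expo V \<Longrightarrow> cap c u \<in> expo V"
  by (simp add: expo_def cap_def)

section \<open>Stabilization of monotone maps on exponent vectors\<close>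

text \<open>A form of Dickson's lemma for values with the ascending chain condition. The constant
  has to work for every \<open>c' \<ge> c\<close>, because the induction merges the constants of
  finitely many sections by taking their maximum.\<close>

lemma monotone_map_determined_by_cap:
  fixes L :: "(nat \<Rightarrow> nat) \<Rightarrow> 'a set"
  assumes "finite V"
    and acc: "\<And>f. (\<And>k::nat. f k \<in> S) \<Longrightarrow> (\<And>k. f k \<subseteq> f (Suc k)) \<Longrightarrow> \<exists>K. \<forall>k\<ge>K. f k = f K"
    and "\<And>u. u \<in> expo V \<Longrightarrow> L u \<in> S"
    and "\<And>u v. u \<in> expo V \<Longrightarrow> v \<in> expo V \<Longrightarrow> u \<le> v \<Longrightarrow> L u \<subseteq> L v"
  shows "\<exists>c. \<forall>c'\<ge>c. \<forall>u\<in>expo V. L u = L (cap c' u)"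
  using assms(1,3,4)
proof (induction V arbitrary: L)
  case empty
  have "cap c u = u" if "u \<in> expo {}" for u c using that by (auto simp: expo_def cap_def)
  then show ?case by metis
next
  case (insert x V)
  have ex: "u(x := k) \<in> expo (insert x V)" if "u \<in> expo V" for u k
    using that by (auto simp: expo_def)
  \<comment> \<open>One variable is split off: the sections \<open>M k\<close> increase with \<open>k\<close> to \<open>M'\<close>, and it is enough
    that they reach \<open>M'\<close> on the finitely many truncated exponents.\<close>
  define M where "M k u = L (u(x := k))" for k :: nat and u
  have MS: "M k u \<in> S" if "u \<in> expo V" for k u
    unfolding M_def by (rule insert.prems(1)[OF ex[OF that]])
  have Mmono: "M k u \<subseteq> M k' v" if "u \<in> expo V" "v \<in> expo V" "u \<le> v" "k \<le> k'" for u v k k'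
    unfolding M_def using that by (intro insert.prems(2) ex) (auto simp: le_fun_def)
  define M' where "M' u = (\<Union>k. M k u)" for u
  have stab: "\<exists>K. \<forall>k\<ge>K. M k u = M' u" if u: "u \<in> expo V" for u
  proof -
    obtain K where K: "\<forall>k\<ge>K. M k u = M K u"
      using acc[of "\<lambda>k. M k u"] MS[OF u] Mmono[OF u u] by (metis order_refl le_SucI)
    have "M k u \<subseteq> M K u" for k
      using spec[OF K, of "max k K"] Mmono[OF u u order_refl, of k "max k K"] by simp
    then have "M' u = M K u" by (auto simp: M'_def)
    with K show ?thesis by metis
  qed
  have "\<exists>c. \<forall>c'\<ge>c. \<forall>u\<in>expo V. M' u = M' (cap c' u)"
  proof (rule insert.IH)
    show "M' u \<in> S" if "u \<in> expo V" for u using stab[OF that] MS[OF that] by (metis order_refl)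
    show "M' u \<subseteq> M' v" if "u \<in> expo V" "v \<in> expo V" "u \<le> v" for u v
      using Mmono[OF that] unfolding M'_def by blast
  qed
  then obtain c0 where c0: "\<And>c' u. c' \<ge> c0 \<Longrightarrow> u \<in> expo V \<Longrightarrow> M' u = M' (cap c' u)" by blast
  have "\<exists>c. \<forall>c'\<ge>c. \<forall>u\<in>expo V. M k u = M k (cap c' u)" for k
    using MS Mmono by (intro insert.IH) auto
  then obtain c1 where c1: "\<And>k c' u. c' \<ge> c1 k \<Longrightarrow> u \<in> expo V \<Longrightarrow> M k u = M k (cap c' u)" by metis
  define B where "B = {u \<in> expo V. \<forall>j\<in>V. u j \<le> c0}"
  have finB: "finite B" unfolding B_def by (rule finite_expo_le[OF insert.hyps(1)])
  obtain K0 where K0: "\<And>u k. u \<in> expo V \<Longrightarrow> k \<ge> K0 u \<Longrightarrow> M k u = M' u" using stab by metis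
  define K where "K = Max (insert 0 (K0 ` B))"
  have K: "K0 u \<le> K" if "u \<in> B" for u using that finB by (auto simp: K_def)
  have MK: "M k u = M' u" if u: "u \<in> expo V" and k: "k \<ge> K" for u k
  proof
    show "M k u \<subseteq> M' u" by (auto simp: M'_def)
    have cu: "cap c0 u \<in> B" using expo_cap[OF u] by (auto simp: B_def cap_def)
    have "M' u = M' (cap c0 u)" using c0[OF order_refl u] .
    also have "\<dots> = M k (cap c0 u)" using K0[OF expo_cap[OF u], where k=k] K[OF cu] k by auto
    also have "\<dots> \<subseteq> M k u" using Mmono[OF expo_cap[OF u] u _ order_refl] by (auto simp: cap_def le_fun_def)
    finally show "M' u \<subseteq> M k u" .
  qed
  \<comment> \<open>\<open>K \<le> c\<close> keeps a truncated coordinate \<open>x\<close> in the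
    range where the sections equal \<open>M'\<close>; the finitely many sections below
    \<open>K\<close> bring their own constants.\<close>
  define c where "c = Max (insert K (insert c0 (c1 ` {..<K})))"
  have c: "K \<le> c" "c0 \<le> c" "k < K \<Longrightarrow> c1 k \<le> c" for k
    unfolding c_def by (auto intro!: Max_ge simp del: Max_insert)
  have "L u = L (cap c' u)" if c': "c' \<ge> c" and u: "u \<in> expo (insert x V)" for c' u
  proof -
    define v where "v = u(x := 0)"
    have v: "v \<in> expo V" using u by (auto simp: v_def expo_def)
    have L1: "L u = M (u x) v" by (simp add: M_def v_def)
    have L2: "L (cap c' u) = M (min (u x) c') (cap c' v)"
      unfolding M_def v_def cap_def by (rule arg_cong[where f=L]) auto
    show ?thesis
    proof (cases "u x < K")
      case True
      then have "min (u x) c' = u x" "c' \<ge> c1 (u x)" using c c' order_trans by fastforce+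
      then show ?thesis using L1 L2 c1[OF _ v] by metis
    next
      case False
      then have "u x \<ge> K" "min (u x) c' \<ge> K" "c' \<ge> c0" using c c' by auto
      then show ?thesis using L1 L2 MK[OF v] MK[OF expo_cap[OF v]] c0[OF _ v] by metis
    qed
  qed
  then show ?case by blast
qed

section \<open>Number of monomials of given multidegree and given truncation\<close>

lemma finite_mons:
  assumes "finite V" shows "finite (mons V h n)"
proof (rule finite_subset)
  show "mons V h n \<subseteq> {u \<in> expo V. \<forall>j\<in>V. u j \<le> n (h j)}"
  proof (clarsimp simp: mons_def)
    fix u j assume "j \<in> V"
    then show "u j \<le> gdeg V h u (h j)"
      unfolding gdeg_def using assms by (intro member_le_sum) auto
  qed
qed (rule finite_expo_le[OF assms])

text \<open>Weak compositions of \<open>m\<close> into \<open>f\<close> parts. The case without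
  parts is separate, as the binomial formula would need the lower index -1.\<close>

fun compositions :: "nat \<Rightarrow> nat \<Rightarrow> nat" where
  "compositions 0 m = (if m = 0 then 1 else 0)"
| "compositions (Suc f) m = (m + f) choose f"

text \<open>Splitting off the value \<open>k\<close> of one part reduces stars and bars to the
  hockey-stick identity.\<close>

lemma compositions_Suc: "compositions (Suc f) m = (\<Sum>k\<le>m. compositions f (m - k))"
proof -
  have "(\<Sum>k\<le>m. compositions f (m - k)) = (\<Sum>k\<le>m. compositions f k)"
    by (rule sum.reindex_bij_witness[of _ "\<lambda>k. m - k" "\<lambda>k. m - k"]) auto
  also have "\<dots> = (m + f) choose f"
  proof (cases f)
    case 0
    then show ?thesis by (simp add: sum.delta)
  next
    case (Suc g)
    have "(\<Sum>k\<le>m. (k + g) choose g) = (\<Sum>k\<le>m. (g + k) choose k)"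
      by (intro sum.cong refl) (metis add.commute add_diff_cancel_right' binomial_symmetric le_add2)
    also have "\<dots> = Suc (g + m) choose m" by (rule sum_choose_lower)
    also have "\<dots> = (m + f) choose f"
      using Suc binomial_symmetric[of m "Suc (g + m)"] by (simp add: add.commute)
    finally show ?thesis using Suc by simp
  qed
  finally show ?thesis by simp
qed

text \<open>Induction on the variables: giving the new variable the exponent \<open>k\<close> lowers
  the required degree at \<open>h j\<close> by \<open>k\<close> and changes no other entry, so only
  one factor of the product moves, by \<open>compositions_Suc\<close>.\<close>

lemma card_mons:
  assumes "finite F" "h ` F \<subseteq> {..<r}" "\<And>i. i \<ge> r \<Longrightarrow> m i = 0"
  shows "card (mons F h m) = (\<Prod>i<r. compositions (card {j \<in> F. h j = i}) (m i))"
  using assms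
proof (induction F arbitrary: m)
  case empty
  have "mons {} h m = (if m = (\<lambda>_. 0) then {\<lambda>_. 0} else {})"
    by (auto simp: mons_def expo_def gdeg_def fun_eq_iff)
  moreover have "(\<forall>i<r. m i = 0) \<longleftrightarrow> m = (\<lambda>_. 0)"
    using empty.prems(2) by (metis not_le)
  ultimately show ?case by (auto simp: prod_eq_1_iff intro!: prod_zero)
next
  case (insert j F)
  let ?i = "h j"
  let ?m = "\<lambda>k. m(?i := m ?i - k)"
  have i: "?i < r" using insert.prems by auto
  have gd: "gdeg (insert j F) h (w(j := k)) = (gdeg F h w)(?i := gdeg F h w ?i + k)" for w k
  proof
    fix i'
    have "{j'. j' \<in> insert j F \<and> h j' = i'} = (if i' = ?i then insert j {j'. j' \<in> F \<and> h j' = i'} else {j'. j' \<in> F \<and> h j' = i'})"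
      by auto
    moreover have "(\<Sum>j' | j' \<in> F \<and> h j' = i'. (w(j := k)) j') = (\<Sum>j' | j' \<in> F \<and> h j' = i'. w j')"
      using insert.hyps by (intro sum.cong) auto
    ultimately show "gdeg (insert j F) h (w(j := k)) i' = ((gdeg F h w)(?i := gdeg F h w ?i + k)) i'"
      using insert.hyps by (auto simp: gdeg_def)
  qed
  have eq: "mons (insert j F) h m = (\<Union>k\<in>{..m ?i}. (\<lambda>w. w(j := k)) ` mons F h (?m k))"
  proof (intro equalityI subsetI)
    fix u assume u: "u \<in> mons (insert j F) h m"
    define w where "w = u(j := 0)"
    have uw: "u = w(j := u j)" by (simp add: w_def)
    have "m = (gdeg F h w)(?i := gdeg F h w ?i + u j)"
      using u gd[of w "u j"] uw by (auto simp: mons_def)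
    then have "u j \<le> m ?i" "gdeg F h w = ?m (u j)" by (auto simp: fun_eq_iff)
    moreover have "w \<in> expo F" using u by (auto simp: mons_def expo_def w_def)
    ultimately show "u \<in> (\<Union>k\<in>{..m ?i}. (\<lambda>w. w(j := k)) ` mons F h (?m k))"
      using uw by (auto simp: mons_def)
  next
    fix u assume "u \<in> (\<Union>k\<in>{..m ?i}. (\<lambda>w. w(j := k)) ` mons F h (?m k))"
    then obtain k w where w: "k \<le> m ?i" "w \<in> mons F h (?m k)" "u = w(j := k)" by auto
    then have "gdeg (insert j F) h u = m" unfolding w(3) gd by (auto simp: mons_def)
    moreover have "u \<in> expo (insert j F)" using w by (auto simp: mons_def expo_def)
    ultimately show "u \<in> mons (insert j F) h m" by (simp add: mons_def)
  qed
  have inj: "inj_on (\<lambda>w. w(j := k)) (mons F h (?m k))" for k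
  proof (rule inj_onI)
    fix w w' assume w: "w \<in> mons F h (?m k)" "w' \<in> mons F h (?m k)" "w(j := k) = w'(j := k)"
    then have "w j = w' j" using insert.hyps by (auto simp: mons_def expo_def)
    then show "w = w'" using w(3) by (metis fun_upd_triv fun_upd_upd)
  qed
  have "card (mons (insert j F) h m) = (\<Sum>k\<le>m ?i. card ((\<lambda>w. w(j := k)) ` mons F h (?m k)))"
    unfolding eq using insert.hyps finite_mons
    by (intro card_UN_disjoint) (auto dest: fun_cong[where x=j])
  also have "\<dots> = (\<Sum>k\<le>m ?i. card (mons F h (?m k)))"
    using inj by (simp add: card_image)
  also have "\<dots> = (\<Sum>k\<le>m ?i. \<Prod>i<r. compositions (card {j \<in> F. h j = i}) (?m k i))"
    using insert.prems i by (intro sum.cong refl insert.IH) auto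
  also have "\<dots> = (\<Sum>k\<le>m ?i. compositions (card {j \<in> F. h j = ?i}) (m ?i - k) *
      (\<Prod>i\<in>{..<r} - {?i}. compositions (card {j \<in> F. h j = i}) (m i)))"
  proof (intro sum.cong refl)
    fix k
    have "(\<Prod>i\<in>{..<r} - {?i}. compositions (card {j \<in> F. h j = i}) (?m k i)) =
       (\<Prod>i\<in>{..<r} - {?i}. compositions (card {j \<in> F. h j = i}) (m i))"
      by (intro prod.cong) auto
    then show "(\<Prod>i<r. compositions (card {j \<in> F. h j = i}) (?m k i)) =
        compositions (card {j \<in> F. h j = ?i}) (m ?i - k) * (\<Prod>i\<in>{..<r} - {?i}. compositions (card {j \<in> F. h j = i}) (m i))"
      using i by (subst prod.remove[of _ ?i]) auto
  qed
  also have "\<dots> = compositions (Suc (card {j \<in> F. h j = ?i})) (m ?i) *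
      (\<Prod>i\<in>{..<r} - {?i}. compositions (card {j \<in> F. h j = i}) (m i))"
    unfolding compositions_Suc sum_distrib_right ..
  also have "\<dots> = (\<Prod>i<r. compositions (card {j' \<in> insert j F. h j' = i}) (m i))"
  proof -
    have "{j' \<in> insert j F. h j' = ?i} = insert j {j \<in> F. h j = ?i}" by auto
    then have "card {j' \<in> insert j F. h j' = ?i} = Suc (card {j \<in> F. h j = ?i})"
      using insert.hyps by simp
    moreover have "(\<Prod>i\<in>{..<r} - {?i}. compositions (card {j' \<in> insert j F. h j' = i}) (m i)) =
       (\<Prod>i\<in>{..<r} - {?i}. compositions (card {j \<in> F. h j = i}) (m i))"
      by (intro prod.cong refl arg_cong2[where f=compositions] arg_cong[where f=card]) auto
    ultimately show ?thesis using i by (subst (2) prod.remove[of _ ?i]) auto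
  qed
  finally show ?case .
qed

text \<open>Subtracting \<open>v\<close> is a bijection: a vector with truncation \<open>v\<close>
  can exceed \<open>v\<close> only where \<open>v\<close> has reached the cap, and there by any
  amount. Only these variables remain free.\<close>

lemma card_mons_cap:
  assumes V: "finite V" and v: "v \<in> expo V" "\<And>j. v j \<le> c" and n: "gdeg V h v \<le> n"
  shows "card {u \<in> mons V h n. cap c u = v} = card (mons {j \<in> V. v j = c} h (\<lambda>i. n i - gdeg V h v i))"
proof (rule bij_betw_same_card)
  let ?F = "{j \<in> V. v j = c}"
  have gd: "gdeg V h (\<lambda>j. v j + w j) i = gdeg V h v i + gdeg ?F h w i" if "w \<in> expo ?F" for w i
  proof -
    have "(\<Sum>j | j \<in> V \<and> h j = i. w j) = (\<Sum>j | j \<in> ?F \<and> h j = i. w j)"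
      using that V by (intro sum.mono_neutral_right) (auto simp: expo_def)
    then show ?thesis by (simp add: gdeg_def sum.distrib)
  qed
  show "bij_betw (\<lambda>u j. u j - v j) {u \<in> mons V h n. cap c u = v} (mons ?F h (\<lambda>i. n i - gdeg V h v i))"
  proof (rule bij_betw_byWitness[where f'="\<lambda>w j. v j + w j"])
    have le: "v j \<le> u j" if "cap c u = v" for u j using that by (auto simp: cap_def)
    show "\<forall>u\<in>{u \<in> mons V h n. cap c u = v}. (\<lambda>j. v j + (u j - v j)) = u"
      using le by (auto simp: fun_eq_iff)
    show "\<forall>w\<in>mons ?F h (\<lambda>i. n i - gdeg V h v i). (\<lambda>j. v j + w j - v j) = w" by auto
    show "(\<lambda>u j. u j - v j) ` {u \<in> mons V h n. cap c u = v} \<subseteq> mons ?F h (\<lambda>i. n i - gdeg V h v i)"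
    proof clarify
      fix u assume u: "u \<in> mons V h n" and vu: "v = cap c u"
      have e: "(\<lambda>j. u j - v j) \<in> expo ?F"
        using u by (auto simp: vu expo_def mons_def cap_def min_def)
      have "(\<lambda>j. v j + (u j - v j)) = u" using le vu by (auto simp: fun_eq_iff)
      then have "n i = gdeg V h v i + gdeg ?F h (\<lambda>j. u j - v j) i" for i
        using gd[OF e, of i] u by (auto simp: mons_def)
      then have "gdeg ?F h (\<lambda>j. u j - v j) = (\<lambda>i. n i - gdeg V h v i)" by auto
      with e show "(\<lambda>j. u j - cap c u j) \<in> mons {j \<in> V. cap c u j = c} h (\<lambda>i. n i - gdeg V h (cap c u) i)"
        unfolding mons_def vu[symmetric] by blast
    qed
    show "(\<lambda>w j. v j + w j) ` mons ?F h (\<lambda>i. n i - gdeg V h v i) \<subseteq> {u \<in> mons V h n. cap c u = v}"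
    proof clarify
      fix w assume w: "w \<in> mons ?F h (\<lambda>i. n i - gdeg V h v i)"
      then have e: "w \<in> expo ?F" by (simp add: mons_def)
      have "gdeg V h (\<lambda>j. v j + w j) = n"
        using gd[OF e] w n by (auto simp: mons_def le_fun_def fun_eq_iff)
      moreover have "(\<lambda>j. v j + w j) \<in> expo V" using e v(1) by (auto simp: expo_def)
      moreover have "cap c (\<lambda>j. v j + w j) = v"
      proof
        fix j show "cap c (\<lambda>j. v j + w j) j = v j"
          using e v(2)[of j] by (cases "j \<in> ?F") (auto simp: cap_def expo_def)
      qed
      ultimately show "(\<lambda>j. v j + w j) \<in> mons V h n \<and> cap c (\<lambda>j. v j + w j) = v" by (simp add: mons_def)
    qed
  qed
qed

section \<open>Numerical polynomials\<close>

text \<open>Closure under sums and products is proved for functions; exponents and coefficients are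
  extracted only at the end.\<close>

definition poly_fun :: "nat \<Rightarrow> nat \<Rightarrow> ((nat \<Rightarrow> int) \<Rightarrow> rat) \<Rightarrow> bool" where
  "poly_fun r d F \<longleftrightarrow> (\<exists>A c. mpoly_repr r d A \<and> (\<forall>x. F x = mpoly_eval r A c x))"

lemma poly_fun_mono: "poly_fun r d F \<Longrightarrow> d \<le> d' \<Longrightarrow> poly_fun r d' F"
  unfolding poly_fun_def mpoly_repr_def by (meson le_trans)

lemma poly_fun_const: "poly_fun r d (\<lambda>_. a)"
  unfolding poly_fun_def
  by (intro exI[of _ "{\<lambda>_. 0}"] exI[of _ "\<lambda>_. a"]) (simp add: mpoly_repr_def mpoly_eval_def)

lemma poly_fun_scale: "poly_fun r d F \<Longrightarrow> poly_fun r d (\<lambda>x. a * F x)"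
  unfolding poly_fun_def
proof clarify
  fix A c assume "mpoly_repr r d A" "\<forall>x. F x = mpoly_eval r A c x"
  then show "\<exists>A c. mpoly_repr r d A \<and> (\<forall>x. a * F x = mpoly_eval r A c x)"
    by (intro exI[of _ A] exI[of _ "\<lambda>\<alpha>. a * c \<alpha>"])
      (simp add: mpoly_eval_def sum_distrib_left mult.assoc)
qed

lemma poly_fun_add:
  assumes "poly_fun r d F" "poly_fun r d G" shows "poly_fun r d (\<lambda>x. F x + G x)"
proof -
  obtain A c where A: "mpoly_repr r d A" "\<And>x. F x = mpoly_eval r A c x" using assms by (auto simp: poly_fun_def)
  obtain B e where B: "mpoly_repr r d B" "\<And>x. G x = mpoly_eval r B e x" using assms by (auto simp: poly_fun_def)
  have fin: "finite A" "finite B" using A B by (auto simp: mpoly_repr_def)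
  let ?c = "\<lambda>\<alpha>. (if \<alpha> \<in> A then c \<alpha> else 0)" and ?e = "\<lambda>\<alpha>. (if \<alpha> \<in> B then e \<alpha> else 0)"
  have "F x = (\<Sum>\<alpha>\<in>A \<union> B. ?c \<alpha> * (\<Prod>i<r. of_int (x i) ^ \<alpha> i))" for x
    unfolding A mpoly_eval_def using fin by (intro sum.mono_neutral_cong_left) auto
  moreover have "G x = (\<Sum>\<alpha>\<in>A \<union> B. ?e \<alpha> * (\<Prod>i<r. of_int (x i) ^ \<alpha> i))" for x
    unfolding B mpoly_eval_def using fin by (intro sum.mono_neutral_cong_left) auto
  ultimately have "F x + G x = mpoly_eval r (A \<union> B) (\<lambda>\<alpha>. ?c \<alpha> + ?e \<alpha>) x" for x
    unfolding mpoly_eval_def by (simp add: distrib_right sum.distrib)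
  moreover have "mpoly_repr r d (A \<union> B)" using A B by (auto simp: mpoly_repr_def)
  ultimately show ?thesis by (auto simp: poly_fun_def)
qed

lemma poly_fun_sum: "finite S \<Longrightarrow> (\<And>s. s \<in> S \<Longrightarrow> poly_fun r d (F s)) \<Longrightarrow> poly_fun r d (\<lambda>x. \<Sum>s\<in>S. F s x)"
  by (induction S rule: finite_induct) (auto intro: poly_fun_const poly_fun_add)

lemma poly_fun_coordinate:
  assumes "poly_fun r d F" "i < r" shows "poly_fun r (Suc d) (\<lambda>x. of_int (x i) * F x)"
proof -
  obtain A c where A: "mpoly_repr r d A" "\<And>x. F x = mpoly_eval r A c x" using assms by (auto simp: poly_fun_def)
  let ?s = "\<lambda>\<alpha>::nat\<Rightarrow>nat. \<alpha>(i := Suc (\<alpha> i))"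
  have inj: "inj_on ?s A"
  proof (rule inj_onI)
    fix a b assume e: "?s a = ?s b"
    show "a = b"
    proof
      fix k show "a k = b k" using fun_cong[OF e, of k] by (cases "k = i") auto
    qed
  qed
  have m: "(\<Prod>j<r. of_int (x j) ^ ?s \<alpha> j) = of_int (x i) * (\<Prod>j<r. of_int (x j) ^ \<alpha> j :: rat)" for x \<alpha>
  proof -
    have "(\<Prod>j\<in>{..<r} - {i}. of_int (x j) ^ ?s \<alpha> j) = (\<Prod>j\<in>{..<r} - {i}. of_int (x j) ^ \<alpha> j :: rat)"
      by (intro prod.cong) auto
    then show ?thesis using assms(2) by (simp add: prod.remove[of "{..<r}" i])
  qed
  have "of_int (x i) * F x = mpoly_eval r (?s ` A) (\<lambda>\<alpha>. c (\<alpha>(i := \<alpha> i - 1))) x" for x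
    unfolding A mpoly_eval_def sum.reindex[OF inj] comp_def m
    by (simp add: sum_distrib_left mult.left_commute)
  moreover have "mpoly_repr r (Suc d) (?s ` A)"
    unfolding mpoly_repr_def
  proof (intro conjI ballI)
    show "finite (?s ` A)" using A by (simp add: mpoly_repr_def)
    fix \<beta> assume "\<beta> \<in> ?s ` A"
    then obtain \<alpha> where \<alpha>: "\<alpha> \<in> A" "\<beta> = ?s \<alpha>" by auto
    then show "\<forall>k\<ge>r. \<beta> k = 0" using A assms(2) by (auto simp: mpoly_repr_def)
    have "(\<Sum>k<r. \<beta> k) = Suc (\<Sum>k<r. \<alpha> k)"
      using assms(2) unfolding \<alpha> by (simp add: sum.remove[of "{..<r}" i])
    then show "(\<Sum>k<r. \<beta> k) \<le> Suc d" using A \<alpha> by (auto simp: mpoly_repr_def)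
  qed
  ultimately show ?thesis by (auto simp: poly_fun_def)
qed

text \<open>Each increase of the lower index multiplies by the linear factor
  \<open>(X - g) / (g + 1)\<close>, hence costs one degree.\<close>

lemma poly_fun_gchoose:
  assumes "poly_fun r d F" "i < r"
  shows "poly_fun r (d + g) (\<lambda>x. ((of_int (x i) + b) gchoose g) * F x)"
proof (induction g)
  case 0
  then show ?case using assms by simp
next
  case (Suc g)
  let ?G = "\<lambda>x. ((of_int (x i) + b) gchoose g) * F x"
  have "(of_int (x i) + b) gchoose (Suc g) = (of_int (x i) + b - of_nat g) / of_nat (Suc g) * ((of_int (x i) + b) gchoose g)" for x :: "nat \<Rightarrow> int"
    by (simp add: gbinomial_prod_rev field_simps)
  note eq = this
  have e: "((of_int (x i) + b) gchoose (Suc g)) * F x =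
      1 / of_nat (Suc g) * (of_int (x i) * ?G x + (b - of_nat g) * ?G x)" for x
    unfolding eq by (simp add: algebra_simps add_divide_distrib diff_divide_distrib)
  have "poly_fun r (Suc (d + g)) (\<lambda>x. 1 / of_nat (Suc g) * (of_int (x i) * ?G x + (b - of_nat g) * ?G x))"
    using Suc assms
    by (intro poly_fun_scale poly_fun_add poly_fun_coordinate) (auto intro: poly_fun_mono)
  then show ?case unfolding e by simp
qed

lemma poly_fun_prod_gchoose:
  "r' \<le> r \<Longrightarrow> poly_fun r (\<Sum>i<r'. g i) (\<lambda>x. \<Prod>i<r'. (of_int (x i) + b i) gchoose g i)"
proof (induction r')
  case 0
  then show ?case using poly_fun_const[of r 0 1] by simp
next
  case (Suc r')
  then have "poly_fun r ((\<Sum>i<r'. g i) + g r') (\<lambda>x. ((of_int (x r') + b r') gchoose g r') * (\<Prod>i<r'. (of_int (x i) + b i) gchoose g i))"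
    by (intro poly_fun_gchoose) auto
  then show ?case by (simp add: mult.commute)
qed

text \<open>\<open>numerical\<close> ranges over all integer points, so negative upper indices
  occur. There the reflection formula gives an ordinary binomial coefficient up to sign.\<close>

lemma gbinomial_of_int_in_Ints: "((of_int a :: rat) gchoose k) \<in> \<int>"
proof (cases "a \<ge> 0")
  case True
  then have "(of_int a :: rat) = of_nat (nat a)" by simp
  then show ?thesis by (metis binomial_gbinomial Ints_of_nat)
next
  case False
  define m where "m = nat (- a) - 1"
  have a: "(of_int a :: rat) = - of_nat (Suc m)" using False by (simp add: m_def)
  have "(of_nat (Suc m) + of_nat k - 1 :: rat) = of_nat (m + k)" by simp
  then have "((of_int a :: rat) gchoose k) = (-1) ^ k * of_nat ((m + k) choose k)"
    unfolding a gbinomial_minus by (simp add: binomial_gbinomial)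
  then show ?thesis by simp
qed

lemma power_le_binomial: "m ^ g \<le> fact g * ((m + g) choose g)"
proof (induction g)
  case (Suc g)
  have "m ^ Suc g \<le> m * (fact g * ((m + g) choose g))" using Suc by simp
  also have "\<dots> \<le> (m + Suc g) * (fact g * ((m + g) choose g))" by (rule mult_le_mono1) simp
  also have "\<dots> = fact g * (Suc (m + g) * ((m + g) choose g))"
    by (simp only: add_Suc_right mult.left_commute)
  also have "\<dots> = fact g * (Suc g * (Suc (m + g) choose Suc g))" by (simp only: Suc_times_binomial_eq mult.commute)
  finally show ?case by (simp add: algebra_simps)
qed simp

text \<open>The lower bound on \<open>n\<close> dominates the multidegree of every truncated vector,
  so all differences \<open>n i - gdeg V h v i\<close> are genuine.\<close>

lemma sum_mons_by_cap:
  fixes f :: "(nat \<Rightarrow> nat) \<Rightarrow> nat"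
  assumes V: "finite V" "h ` V \<subseteq> {..<r}" and f: "\<And>u. u \<in> expo V \<Longrightarrow> f u = f (cap c u)"
    and n: "\<And>i. i \<ge> r \<Longrightarrow> n i = 0" "\<And>i. i < r \<Longrightarrow> n i \<ge> c * card V"
  shows "(\<Sum>u\<in>mons V h n. f u) = (\<Sum>v | v \<in> expo V \<and> (\<forall>j\<in>V. v j \<le> c).
     f v * (\<Prod>i<r. compositions (card {j \<in> V. v j = c \<and> h j = i}) (n i - gdeg V h v i)))"
proof -
  let ?B = "{v \<in> expo V. \<forall>j\<in>V. v j \<le> c}"
  have fB: "finite ?B" by (rule finite_expo_le[OF V(1)])
  have "(\<Sum>u\<in>mons V h n. f u) = (\<Sum>v\<in>?B. \<Sum>u\<in>{u \<in> mons V h n. cap c u = v}. f u)"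
    using finite_mons[OF V(1)] fB
    by (intro sum.group[symmetric]) (auto simp: mons_def expo_cap, simp add: cap_def)
  also have "\<dots> = (\<Sum>v\<in>?B. f v * card {u \<in> mons V h n. cap c u = v})"
  proof (intro sum.cong refl)
    fix v
    have "(\<Sum>u\<in>{u \<in> mons V h n. cap c u = v}. f u) = (\<Sum>u\<in>{u \<in> mons V h n. cap c u = v}. f v)"
      using f by (intro sum.cong) (auto simp: mons_def)
    then show "(\<Sum>u\<in>{u \<in> mons V h n. cap c u = v}. f u) = f v * card {u \<in> mons V h n. cap c u = v}" by simp
  qed
  also have "\<dots> = (\<Sum>v\<in>?B. f v * (\<Prod>i<r. compositions (card {j \<in> V. v j = c \<and> h j = i}) (n i - gdeg V h v i)))"
  proof (intro sum.cong refl arg_cong2[where f="(*)"])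
    fix v assume v: "v \<in> ?B"
    then have vle: "v j \<le> c" for j by (cases "j \<in> V") (auto simp: expo_def)
    have "gdeg V h v i \<le> n i" for i
    proof (cases "i < r")
      case True
      have "gdeg V h v i \<le> (\<Sum>j | j \<in> V \<and> h j = i. c)" unfolding gdeg_def using vle by (intro sum_mono) auto
      also have "\<dots> \<le> c * card V" using V by (auto intro: card_mono)
      finally show ?thesis using n(2)[OF True] by simp
    next
      case False
      then have "{j. j \<in> V \<and> h j = i} = {}" using V by auto
      then show ?thesis unfolding gdeg_def by (simp only: sum.empty)
    qed
    then have "card {u \<in> mons V h n. cap c u = v} = card (mons {j \<in> V. v j = c} h (\<lambda>i. n i - gdeg V h v i))"
      using v vle V by (intro card_mons_cap) (auto simp: le_fun_def)
    also have "\<dots> = (\<Prod>i<r. compositions (card {j \<in> {j \<in> V. v j = c}. h j = i}) (n i - gdeg V h v i))"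
      using V n by (intro card_mons) auto
    finally show "card {u \<in> mons V h n. cap c u = v} =
        (\<Prod>i<r. compositions (card {j \<in> V. v j = c \<and> h j = i}) (n i - gdeg V h v i))" by simp
  qed
  finally show ?thesis .
qed

text \<open>By \<open>power_le_binomial\<close> the product is at least a positive constant times a
  power of exponent \<open>\<Sum>i<r. g i\<close>, which outgrows the right-hand side if that
  exponent exceeds \<open>d\<close>.\<close>

lemma growth_bounds_degree:
  fixes a g :: "nat \<Rightarrow> nat"
  assumes "\<And>t. t \<ge> N \<Longrightarrow> (\<Prod>i<r. (t - a i + g i) choose g i) \<le> C * (t + 1) ^ d"
  shows "(\<Sum>i<r. g i) \<le> d"
proof (rule ccontr)
  assume "\<not> (\<Sum>i<r. g i) \<le> d"
  then obtain e where e: "(\<Sum>i<r. g i) = d + Suc e" by (metis add_Suc_right less_imp_Suc_add not_le)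
  \<comment> \<open>At \<open>t = s + b\<close> the hypothesis applies and every
    \<open>t - a i\<close> is at least \<open>s\<close>. All constants are collected in
    \<open>D\<close>, and \<open>s = D + 1\<close> contradicts
    \<open>s ^ Suc e \<le> D\<close>.\<close>
  define b where "b = N + (\<Sum>i<r. a i)"
  define D where "D = (\<Prod>i<r. fact (g i)) * C * (b + 2) ^ d"
  define s where "s = Suc D"
  have "s ^ (d + Suc e) = (\<Prod>i<r. s ^ g i)" unfolding e[symmetric] by (rule power_sum)
  also have "\<dots> \<le> (\<Prod>i<r. fact (g i) * ((s + b - a i + g i) choose g i))"
  proof (intro prod_mono conjI)
    fix i assume "i \<in> {..<r}"
    then have "a i \<le> b" unfolding b_def by (meson finite_lessThan le_add2 le_trans member_le_sum zero_le)
    then have "s ^ g i \<le> (s + b - a i) ^ g i" by (intro power_mono) auto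
    also have "\<dots> \<le> fact (g i) * ((s + b - a i + g i) choose g i)" by (rule power_le_binomial)
    finally show "s ^ g i \<le> fact (g i) * ((s + b - a i + g i) choose g i)" .
  qed auto
  also have "\<dots> = (\<Prod>i<r. fact (g i)) * (\<Prod>i<r. (s + b - a i + g i) choose g i)" by (simp add: prod.distrib)
  also have "\<dots> \<le> (\<Prod>i<r. fact (g i)) * (C * (s + b + 1) ^ d)"
    using assms[of "s + b"] by (intro mult_left_mono) (auto simp: b_def)
  also have "\<dots> \<le> (\<Prod>i<r. fact (g i)) * (C * (s * (b + 2)) ^ d)"
    by (intro mult_left_mono power_mono) (auto simp: s_def)
  also have "\<dots> = D * s ^ d" unfolding D_def power_mult_distrib by (simp only: mult_ac)
  finally have "s ^ Suc e * s ^ d \<le> D * s ^ d" by (simp add: power_add mult_ac)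
  then have "s ^ Suc e \<le> D" by (simp add: s_def)
  moreover have "s \<le> s ^ Suc e" by (rule self_le_power) (simp_all add: s_def)
  ultimately show False by (simp add: s_def)
qed

text \<open>The values of \<open>f\<close> are natural numbers, so every binomial product with
  nonzero coefficient is at most the whole sum. Its degree is therefore bounded by the growth of the
  sum on the diagonal.\<close>

theorem sum_mons_eventually_numerical_polynomial:
  fixes f :: "(nat \<Rightarrow> nat) \<Rightarrow> nat"
  assumes V: "finite V" "h ` V \<subseteq> {..<r}" and f: "\<And>u. u \<in> expo V \<Longrightarrow> f u = f (cap c u)"
    and growth: "\<And>t. t \<ge> N0 \<Longrightarrow> (\<Sum>u\<in>mons V h (\<lambda>i. if i < r then t else 0). f u) \<le> C * (t + 1) ^ d"
  shows "\<exists>A e. mpoly_repr r d A \<and> numerical r A e \<and> (\<exists>N. \<forall>n. (\<forall>i<r. N \<le> n i) \<and> (\<forall>i\<ge>r. n i = 0) \<longrightarrow>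
     of_nat (\<Sum>u\<in>mons V h n. f u) = mpoly_eval r A e (\<lambda>i. int (n i)))"
proof -
  define B where "B = {v \<in> expo V. \<forall>j\<in>V. v j \<le> c}"
  have fB: "finite B" unfolding B_def by (rule finite_expo_le[OF V(1)])
  define k where "k v i = card {j \<in> V. v j = c \<and> h j = i}" for v i
  \<comment> \<open>Discards the terms that vanish for large \<open>n\<close>: those with
    coefficient zero, whose degree no growth bound can see, and those with an index \<open>i\<close>
    without free variable, where the binomial formula is wrong.\<close>
  define good where "good v \<longleftrightarrow> f v \<noteq> 0 \<and> (\<forall>i<r. k v i \<noteq> 0)" for v
  let ?a = "gdeg V h"
  \<comment> \<open>The successor makes every \<open>n i - gdeg V h v i\<close> positive and so
    avoids the exceptional value 1 of \<open>compositions 0 0\<close>.\<close>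
  define N where "N = Suc (c * card V)"
  have aN: "?a v i < N" if "v \<in> B" for v i
  proof -
    have "?a v i \<le> (\<Sum>j | j \<in> V \<and> h j = i. c)" unfolding gdeg_def using that by (intro sum_mono) (auto simp: B_def)
    also have "\<dots> \<le> c * card V" using V by (auto intro: card_mono)
    finally show ?thesis by (simp add: N_def)
  qed
  have comp: "compositions (k v i) m = (if k v i = 0 then 0 else (m + (k v i - 1)) choose (k v i - 1))" if "m > 0" for v i m
    using that by (cases "k v i") auto
  have sum: "(\<Sum>u\<in>mons V h n. f u) = (\<Sum>v | v \<in> B \<and> good v. f v * (\<Prod>i<r. (n i - ?a v i + (k v i - 1)) choose (k v i - 1)))"
    if n: "\<forall>i<r. N \<le> n i" "\<forall>i\<ge>r. n i = 0" for n
  proof -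
    have "(\<Sum>u\<in>mons V h n. f u) = (\<Sum>v\<in>B. f v * (\<Prod>i<r. compositions (k v i) (n i - ?a v i)))"
      unfolding B_def k_def using n by (intro sum_mons_by_cap V f) (auto simp: N_def Suc_le_eq less_imp_le)
    also have "\<dots> = (\<Sum>v | v \<in> B \<and> good v. f v * (\<Prod>i<r. compositions (k v i) (n i - ?a v i)))"
    proof (rule sum.mono_neutral_right[OF fB])
      show "\<forall>v\<in>B - {v. v \<in> B \<and> good v}. f v * (\<Prod>i<r. compositions (k v i) (n i - ?a v i)) = 0"
      proof
        fix v assume v: "v \<in> B - {v. v \<in> B \<and> good v}"
        then consider "f v = 0" | i where "i < r" "k v i = 0" by (auto simp: good_def)
        then show "f v * (\<Prod>i<r. compositions (k v i) (n i - ?a v i)) = 0"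
        proof cases
          case 2
          then have "n i - ?a v i > 0" using n(1) aN[of v i] v by fastforce
          then have "compositions (k v i) (n i - ?a v i) = 0" using 2 by simp
          then have "(\<Prod>i<r. compositions (k v i) (n i - ?a v i)) = 0" using 2(1) by (intro prod_zero) auto
          then show ?thesis by simp
        qed simp
      qed
    qed auto
    also have "\<dots> = (\<Sum>v | v \<in> B \<and> good v. f v * (\<Prod>i<r. (n i - ?a v i + (k v i - 1)) choose (k v i - 1)))"
    proof (intro sum.cong refl arg_cong2[where f="(*)"] prod.cong)
      fix v i assume v: "v \<in> {v. v \<in> B \<and> good v}" and i: "i \<in> {..<r}"
      then have "n i - ?a v i > 0" "k v i \<noteq> 0" using n aN[of v i] by (fastforce simp: good_def)+
      then show "compositions (k v i) (n i - ?a v i) = (n i - ?a v i + (k v i - 1)) choose (k v i - 1)"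
        using comp by simp
    qed
    finally show ?thesis .
  qed
  have deg: "(\<Sum>i<r. k v i - 1) \<le> d" if v: "v \<in> B" "good v" for v
  proof (rule growth_bounds_degree[where N="max N N0" and C=C and a="?a v"])
    fix t assume t: "t \<ge> max N N0"
    let ?n = "\<lambda>i. if i < r then t else 0"
    have "(\<Prod>i<r. (t - ?a v i + (k v i - 1)) choose (k v i - 1)) = (\<Prod>i<r. (?n i - ?a v i + (k v i - 1)) choose (k v i - 1))"
      by (intro prod.cong) auto
    also have "\<dots> \<le> f v * (\<Prod>i<r. (?n i - ?a v i + (k v i - 1)) choose (k v i - 1))"
      using v by (simp add: good_def)
    also have "\<dots> \<le> (\<Sum>v | v \<in> B \<and> good v. f v * (\<Prod>i<r. (?n i - ?a v i + (k v i - 1)) choose (k v i - 1)))"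
      using v fB by (intro member_le_sum) auto
    also have "\<dots> = (\<Sum>u\<in>mons V h ?n. f u)" using t by (intro sum[symmetric]) auto
    also have "\<dots> \<le> C * (t + 1) ^ d" using growth t by simp
    finally show "(\<Prod>i<r. (t - ?a v i + (k v i - 1)) choose (k v i - 1)) \<le> C * (t + 1) ^ d" .
  qed
  \<comment> \<open>The shift is taken in the rationals, since \<open>F\<close> must be a polynomial
    at all integer points, where truncated subtraction would not be one.\<close>
  let ?b = "\<lambda>v i. (of_nat (k v i - 1) - of_nat (?a v i) :: rat)"
  define F where "F x = (\<Sum>v | v \<in> B \<and> good v. of_nat (f v) * (\<Prod>i<r. (of_int (x i) + ?b v i) gchoose (k v i - 1)))"
    for x :: "nat \<Rightarrow> int"
  have "poly_fun r d F"
    unfolding F_def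
  proof (intro poly_fun_sum poly_fun_scale)
    fix v assume "v \<in> {v. v \<in> B \<and> good v}"
    then show "poly_fun r d (\<lambda>x. \<Prod>i<r. (of_int (x i) + ?b v i) gchoose (k v i - 1))"
      using deg by (intro poly_fun_mono[OF poly_fun_prod_gchoose]) auto
  qed (use fB in auto)
  then obtain A e where A: "mpoly_repr r d A" "\<And>x. F x = mpoly_eval r A e x" by (auto simp: poly_fun_def)
  have "F x \<in> \<int>" for x
    unfolding F_def
  proof (intro Ints_sum Ints_mult Ints_prod)
    fix v i
    have "(of_int (x i) + ?b v i) = of_int (x i + int (k v i - 1) - int (?a v i))" by simp
    then show "(of_int (x i) + ?b v i) gchoose (k v i - 1) \<in> \<int>" using gbinomial_of_int_in_Ints by metis
  qed auto
  then have num: "numerical r A e" by (simp add: numerical_def A)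
  have "of_nat (\<Sum>u\<in>mons V h n. f u) = mpoly_eval r A e (\<lambda>i. int (n i))"
    if n: "\<forall>i<r. N \<le> n i" "\<forall>i\<ge>r. n i = 0" for n
  proof -
    have "of_nat (\<Sum>u\<in>mons V h n. f u) = F (\<lambda>i. int (n i))"
      unfolding sum[OF n] F_def of_nat_sum of_nat_mult of_nat_prod
    proof (intro sum.cong refl arg_cong2[where f="(*)"] prod.cong)
      fix v i assume v: "v \<in> {v. v \<in> B \<and> good v}" and i: "i \<in> {..<r}"
      then have "?a v i \<le> n i" using n aN[of v i] by fastforce
      then have "(of_nat (n i - ?a v i + (k v i - 1)) :: rat) = of_int (int (n i)) + ?b v i"
        by (simp add: of_nat_diff)
      then show "of_nat ((n i - ?a v i + (k v i - 1)) choose (k v i - 1)) =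
          ((of_int (int (n i)) + ?b v i) gchoose (k v i - 1))"
        by (simp only: binomial_gbinomial)
    qed
    then show ?thesis by (simp add: A)
  qed
  then show ?thesis using A(1) num by blast
qed

section \<open>Length\<close>

text \<open>Without ideals \<open>N \<subseteq> M\<close> there is no chain at all, and the following predicate holds vacuously.\<close>

definition len_le :: "('a, 'b) ring_scheme \<Rightarrow> 'a set \<Rightarrow> 'a set \<Rightarrow> nat \<Rightarrow> bool" where
  "len_le R N M b \<longleftrightarrow> (\<forall>K n. ideal_chain R N M K n \<longrightarrow> n \<le> b)"

definition colon :: "('a, 'b) ring_scheme \<Rightarrow> 'a set \<Rightarrow> 'a \<Rightarrow> 'a set" where
  "colon R B u = {x \<in> carrier R. x \<otimes>\<^bsub>R\<^esub> u \<in> B}"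

lemma finite_length_iff_len_le: "finite_length R N M \<longleftrightarrow> (\<exists>b. len_le R N M b)"
  by (simp add: finite_length_def len_le_def)

lemma len_le_mono: "len_le R N M b \<Longrightarrow> b \<le> b' \<Longrightarrow> len_le R N M b'"
  unfolding len_le_def by (meson le_trans)

lemma ideal_chain_mono:
  assumes "ideal_chain R N M K n" "i \<le> j" "j \<le> n"
  shows "K i \<subseteq> K j"
  using assms(2,3)
proof (induction j)
  case (Suc j)
  show ?case
  proof (cases "i = Suc j")
    case False
    then have "K i \<subseteq> K j" using Suc by simp
    also have "K j \<subseteq> K (Suc j)" using assms(1) Suc.prems unfolding ideal_chain_def
      by (meson Suc_le_lessD psubset_imp_subset)
    finally show ?thesis .
  qed simp
qed simp

lemma ideal_chain_between:
  assumes "ideal_chain R N M K n" "i \<le> n"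
  shows "ideal (K i) R" "N \<subseteq> K i" "K i \<subseteq> M"
  using assms ideal_chain_mono[OF assms(1), of 0 i] ideal_chain_mono[OF assms(1), of i n]
  by (auto simp: ideal_chain_def)

lemma ideal_chain_append:
  assumes "ideal_chain R N M K n" "ideal_chain R M P K' m"
  shows "ideal_chain R N P (\<lambda>i. if i \<le> n then K i else K' (i - n)) (n + m)"
proof -
  have "(if i \<le> n then K i else K' (i - n)) \<subset> (if Suc i \<le> n then K (Suc i) else K' (Suc i - n))"
    if lt: "i < n + m" for i
  proof -
    consider "Suc i \<le> n" | "i = n" "0 < m" | "n < i" using lt by linarith
    then show ?thesis
    proof cases
      case 1 then show ?thesis using assms(1) by (simp add: ideal_chain_def)
    next
      case 2 then show ?thesis using assms by (simp add: ideal_chain_def Suc_diff_le) metis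
    next
      case 3 then show ?thesis using assms(2) lt by (simp add: ideal_chain_def Suc_diff_le)
    qed
  qed
  then show ?thesis using assms by (auto simp: ideal_chain_def)
qed

lemma ideal_chain_exists:
  assumes "ideal N R" "ideal M R" "N \<subseteq> M"
  shows "\<exists>K n. ideal_chain R N M K n"
proof (cases "N = M")
  case True
  then have "ideal_chain R N M (\<lambda>_. N) 0" using assms by (simp add: ideal_chain_def)
  then show ?thesis by blast
next
  case False
  then have "ideal_chain R N M (\<lambda>i. if i = 0 then N else M) 1"
    using assms by (auto simp: ideal_chain_def)
  then show ?thesis by blast
qed

text \<open>Deleting repetitions leaves a strict chain. This counts the steps of a chain that
  survive under a map of ideals that is merely monotone.\<close>

lemma weak_chain_card:
  assumes "\<And>i. i \<le> n \<Longrightarrow> ideal (K i) R" "\<And>i. i < n \<Longrightarrow> K i \<subseteq> K (Suc i)"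
  shows "\<exists>K'. ideal_chain R (K 0) (K n) K' (card {i. i < n \<and> K i \<noteq> K (Suc i)})"
  using assms
proof (induction n)
  case 0
  then have "ideal_chain R (K 0) (K 0) K 0" by (simp add: ideal_chain_def)
  then show ?case by auto
next
  case (Suc n)
  let ?S = "\<lambda>n. {i. i < n \<and> K i \<noteq> K (Suc i)}"
  obtain K' where K': "ideal_chain R (K 0) (K n) K' (card (?S n))" using Suc by auto
  show ?case
  proof (cases "K n = K (Suc n)")
    case True
    then have "?S (Suc n) = ?S n" by (auto simp: less_Suc_eq)
    with K' True show ?thesis by auto
  next
    case False
    then have S: "?S (Suc n) = insert n (?S n)" by (auto simp: less_Suc_eq)
    have c: "card (?S (Suc n)) = card (?S n) + 1" unfolding S by simp
    have "ideal_chain R (K n) (K (Suc n)) (\<lambda>i. if i = 0 then K n else K (Suc n)) 1"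
      using False Suc.prems by (auto simp: ideal_chain_def)
    from ideal_chain_append[OF K' this] show ?thesis unfolding c by blast
  qed
qed

lemma len_le_weak_chain:
  assumes "len_le R N M b" "\<And>i. i \<le> n \<Longrightarrow> ideal (K i) R" "\<And>i. i < n \<Longrightarrow> K i \<subseteq> K (Suc i)"
    "K 0 = N" "K n = M"
  shows "card {i. i < n \<and> K i \<noteq> K (Suc i)} \<le> b"
  using weak_chain_card[of n K R] assms by (auto simp: len_le_def)

text \<open>A strictly monotone map of ideals preserves the length of chains, and filling the gaps
  at both ends can only lengthen them. As quotient modules are encoded as pairs of ideals, such maps
  take the place of module homomorphisms.\<close>

lemma len_le_map:
  assumes f: "\<And>K. ideal K R \<Longrightarrow> N \<subseteq> K \<Longrightarrow> K \<subseteq> M \<Longrightarrow> ideal (f K) R"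
    and mono: "\<And>K L. ideal K R \<Longrightarrow> ideal L R \<Longrightarrow> N \<subseteq> K \<Longrightarrow> K \<subset> L \<Longrightarrow> L \<subseteq> M \<Longrightarrow> f K \<subset> f L"
    and "ideal N' R" "ideal M' R" "N' \<subseteq> f N" "f M \<subseteq> M'"
    and b: "len_le R N' M' b"
  shows "len_le R N M b"
  unfolding len_le_def
proof (intro allI impI)
  fix K n assume K: "ideal_chain R N M K n"
  have id: "ideal N R" "ideal M R" "N \<subseteq> M"
    using ideal_chain_between[OF K, of 0] ideal_chain_between[OF K, of n] K
    by (auto simp: ideal_chain_def)
  have "ideal_chain R (f N) (f M) (\<lambda>i. f (K i)) n"
    unfolding ideal_chain_def
  proof (intro conjI allI impI)
    show "f (K 0) = f N" "f (K n) = f M" using K by (auto simp: ideal_chain_def)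
    show "ideal (f (K i)) R" if "i \<le> n" for i using f ideal_chain_between[OF K that] by blast
    show "f (K i) \<subset> f (K (Suc i))" if "i < n" for i
      using mono ideal_chain_between[OF K, of i] ideal_chain_between[OF K, of "Suc i"] that K
      by (simp add: ideal_chain_def)
  qed
  moreover obtain K1 n1 where "ideal_chain R N' (f N) K1 n1"
    using ideal_chain_exists[of N' R "f N"] assms(3,5) f[OF id(1)] id by blast
  moreover obtain K2 n2 where "ideal_chain R (f M) M' K2 n2"
    using ideal_chain_exists[of "f M" R M'] assms(4,6) f[OF id(2)] id by blast
  ultimately obtain K3 where "ideal_chain R N' M' K3 (n1 + n + n2)"
    using ideal_chain_append by blast
  then show "n \<le> b" using b unfolding len_le_def by fastforce
qed

lemma len_le_sub:
  assumes "len_le R N' M' b" "ideal N' R" "ideal M' R" "N' \<subseteq> N" "M \<subseteq> M'"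
  shows "len_le R N M b"
  by (rule len_le_map[where f="\<lambda>K. K" and N'=N' and M'=M']) (use assms in auto)

no_notation Sum_Type.Plus (infixr "<+>" 65)

context cring
begin

lemma ideal_add_mem: "ideal A R \<Longrightarrow> x \<in> A \<Longrightarrow> y \<in> A \<Longrightarrow> x \<oplus> y \<in> A"
  by (meson additive_subgroup.a_closed ideal.axioms(1))

lemma ideal_minus_mem: "ideal A R \<Longrightarrow> x \<in> A \<Longrightarrow> y \<in> A \<Longrightarrow> x \<ominus> y \<in> A"
  by (simp add: a_minus_def additive_subgroup.a_inv_closed ideal.axioms(1) ideal_add_mem)

lemma ideal_mult_mem: "ideal A R \<Longrightarrow> x \<in> A \<Longrightarrow> y \<in> carrier R \<Longrightarrow> y \<otimes> x \<in> A"
  by (simp add: ideal.I_l_closed)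

lemma ideal_carr: "ideal A R \<Longrightarrow> A \<subseteq> carrier R"
  by (rule subsetI, rule ideal.Icarr)

lemma ideal_zero_mem: "ideal A R \<Longrightarrow> \<zero> \<in> A"
  by (simp add: additive_subgroup.zero_closed ideal.axioms(1))

lemma ideal_by_closure:
  assumes "A \<subseteq> carrier R" "\<zero> \<in> A" "\<And>x y. x \<in> A \<Longrightarrow> y \<in> A \<Longrightarrow> x \<oplus> y \<in> A"
    "\<And>x y. x \<in> A \<Longrightarrow> y \<in> carrier R \<Longrightarrow> y \<otimes> x \<in> A"
  shows "ideal A R"
proof (rule idealI[OF ring_axioms])
  have "\<ominus> x \<in> A" if "x \<in> A" for x
    using assms(4)[OF that, of "\<ominus> \<one>"] assms(1) that l_minus by auto
  then show "subgroup A (add_monoid R)"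
    using assms by (intro add.subgroupI) (auto simp flip: a_inv_def)
next
  show "x \<otimes> a \<in> A" "a \<otimes> x \<in> A" if "a \<in> A" "x \<in> carrier R" for a x
    using assms(1) assms(4)[OF that] m_comm[of a x] that by auto
qed

lemma add_minus_cancel: "x \<in> carrier R \<Longrightarrow> y \<in> carrier R \<Longrightarrow> (x \<oplus> y) \<ominus> x = y"
  using a_comm[of "x \<oplus> y" "\<ominus> x"] r_neg1[of x y] by (simp add: a_minus_def)

lemma set_add_iff: "x \<in> A <+> B \<longleftrightarrow> (\<exists>a\<in>A. \<exists>b\<in>B. x = a \<oplus> b)"
  by (auto simp: set_add_def')

lemma add_upper: "ideal A R \<Longrightarrow> ideal B R \<Longrightarrow> A \<subseteq> A <+> B \<and> B \<subseteq> A <+> B"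
proof (intro conjI subsetI)
  assume A: "ideal A R" and B: "ideal B R"
  fix x
  show "x \<in> A <+> B" if "x \<in> A"
    unfolding set_add_iff using that ideal_carr[OF A] ideal_zero_mem[OF B]
    by (intro bexI[of _ x] bexI[of _ \<zero>]) auto
  show "x \<in> A <+> B" if "x \<in> B"
    unfolding set_add_iff using that ideal_carr[OF B] ideal_zero_mem[OF A]
    by (intro bexI[of _ \<zero>] bexI[of _ x]) auto
qed

lemma add_least: "ideal C R \<Longrightarrow> A \<subseteq> C \<Longrightarrow> B \<subseteq> C \<Longrightarrow> A <+> B \<subseteq> C"
  by (auto simp: set_add_iff intro!: ideal_add_mem)

lemma add_mono_ideal: "A \<subseteq> A' \<Longrightarrow> B \<subseteq> B' \<Longrightarrow> A <+> B \<subseteq> A' <+> B'"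
  unfolding subset_iff set_add_iff by metis

section \<open>Additivity of length and the isomorphism theorems\<close>

text \<open>The modular law: an element \<open>x\<close> of \<open>L\<close> is
  \<open>k \<oplus> m\<close> with \<open>k \<in> K\<close> and \<open>m \<in> M\<close>, and then
  \<open>m = x \<ominus> k\<close> lies in \<open>L \<inter> M = K \<inter> M\<close>.\<close>

lemma modular_eq:
  assumes id: "ideal K R" "ideal L R" "ideal M R" and "K \<subseteq> L" "K \<inter> M = L \<inter> M" "K <+> M = L <+> M"
  shows "K = L"
proof
  show "L \<subseteq> K"
  proof
    fix x assume x: "x \<in> L"
    then have "x \<in> K <+> M" using assms(6) add_upper[OF id(2,3)] by auto
    then obtain k m where km: "k \<in> K" "m \<in> M" "x = k \<oplus> m" by (auto simp: set_add_iff)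
    have "m = x \<ominus> k" using km ideal_carr[OF id(1)] ideal_carr[OF id(3)] add_minus_cancel[of k m] by (metis subsetD)
    then have "m \<in> L" using x km assms(4) ideal_minus_mem[OF id(2)] by (metis subsetD)
    then show "x \<in> K" using km assms(5) ideal_add_mem[OF id(1)] by auto
  qed
qed fact

text \<open>By \<open>modular_eq\<close>, a strict step of a chain stays strict after intersecting
  with \<open>M\<close> or after adding \<open>M\<close>. The first kind is counted by
  \<open>b1\<close>, the second by \<open>b2\<close>.\<close>

lemma len_le_add:
  assumes id: "ideal N R" "ideal M R" "ideal P R" and sub: "N \<subseteq> M" "M \<subseteq> P"
    and b: "len_le R N M b1" "len_le R M P b2"
  shows "len_le R N P (b1 + b2)"
  unfolding len_le_def
proof (intro allI impI)
  fix K n assume K: "ideal_chain R N P K n"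
  note bet = ideal_chain_between[OF K]
  have st: "K i \<subset> K (Suc i)" if "i < n" for i using K that by (auto simp: ideal_chain_def)
  have 1: "card {i. i < n \<and> K i \<inter> M \<noteq> K (Suc i) \<inter> M} \<le> b1"
  proof (rule len_le_weak_chain[OF b(1), where K="\<lambda>i. K i \<inter> M"])
    show "ideal (K i \<inter> M) R" if "i \<le> n" for i using bet[OF that] id i_intersect by blast
    show "K i \<inter> M \<subseteq> K (Suc i) \<inter> M" if "i < n" for i using st[OF that] by blast
    show "K 0 \<inter> M = N" "K n \<inter> M = M" using K sub by (auto simp: ideal_chain_def)
  qed
  have 2: "card {i. i < n \<and> K i <+> M \<noteq> K (Suc i) <+> M} \<le> b2"
  proof (rule len_le_weak_chain[OF b(2), where K="\<lambda>i. K i <+> M"])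
    show "ideal (K i <+> M) R" if "i \<le> n" for i using bet[OF that] id add_ideals by blast
    show "K i <+> M \<subseteq> K (Suc i) <+> M" if "i < n" for i
      using st[OF that] by (intro add_mono_ideal) auto
    show "K 0 <+> M = M"
      using K add_upper[OF id(1,2)] add_least[OF id(2) sub(1) order_refl] by (simp add: ideal_chain_def subset_antisym)
    show "K n <+> M = P"
      using K add_upper[OF id(3,2)] add_least[OF id(3) order_refl sub(2)] by (simp add: ideal_chain_def subset_antisym)
  qed
  let ?A = "{i. i < n \<and> K i \<inter> M \<noteq> K (Suc i) \<inter> M}" and ?B = "{i. i < n \<and> K i <+> M \<noteq> K (Suc i) <+> M}"
  have "{..<n} \<subseteq> ?A \<union> ?B"
  proof
    fix i assume i: "i \<in> {..<n}"
    then have "ideal (K i) R" "ideal (K (Suc i)) R" using bet[of i] bet[of "Suc i"] by auto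
    then show "i \<in> ?A \<union> ?B" using modular_eq[of "K i" "K (Suc i)" M] st[of i] i id by blast
  qed
  then have "n \<le> card (?A \<union> ?B)" using card_mono[of "?A \<union> ?B" "{..<n}"] by auto
  also have "\<dots> \<le> card ?A + card ?B" by (rule card_Un_le)
  finally show "n \<le> b1 + b2" using 1 2 by linarith
qed

text \<open>\<open>GREATEST\<close> is attained only if some chain exists and the lengths are
  bounded; inclusion of ideals gives the first, finite length the second.\<close>

lemma quot_length_chain:
  assumes "finite_length R N M" "ideal N R" "ideal M R" "N \<subseteq> M"
  shows "\<exists>K. ideal_chain R N M K (quot_length R N M)"
proof -
  obtain K n where "ideal_chain R N M K n" using ideal_chain_exists assms(2-4) by blast
  then have ex: "\<exists>n. \<exists>K. ideal_chain R N M K n" by blast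
  obtain b where "\<forall>n. (\<exists>K. ideal_chain R N M K n) \<longrightarrow> n \<le> b"
    using assms(1) unfolding finite_length_def by blast
  with ex show ?thesis unfolding quot_length_def
    using GreatestI_ex_nat[of "\<lambda>n. \<exists>K. ideal_chain R N M K n" b] by blast
qed

lemma quot_length_le:
  assumes "len_le R N M b" "ideal N R" "ideal M R" "N \<subseteq> M"
  shows "quot_length R N M \<le> b"
  using quot_length_chain[of N M] assms unfolding finite_length_iff_len_le len_le_def by blast

lemma len_le_quot_length:
  assumes "finite_length R N M" shows "len_le R N M (quot_length R N M)"
  unfolding len_le_def quot_length_def
proof (intro allI impI)
  fix K n assume "ideal_chain R N M K n"
  moreover obtain b where "\<forall>n. (\<exists>K. ideal_chain R N M K n) \<longrightarrow> n \<le> b"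
    using assms(1) unfolding finite_length_def by blast
  ultimately show "n \<le> (GREATEST n. \<exists>K. ideal_chain R N M K n)"
    using Greatest_le_nat[of "\<lambda>n. \<exists>K. ideal_chain R N M K n" n b] by blast
qed

lemma quot_length_eqI:
  assumes "finite_length R N M" "ideal N R" "ideal M R" "N \<subseteq> M"
    "finite_length R N' M'" "ideal N' R" "ideal M' R" "N' \<subseteq> M'"
    "\<And>b. len_le R N M b \<longleftrightarrow> len_le R N' M' b"
  shows "quot_length R N M = quot_length R N' M'"
proof (rule order_antisym)
  show "quot_length R N M \<le> quot_length R N' M'"
    using quot_length_le[OF _ assms(2-4)] assms(9) len_le_quot_length[OF assms(5)] by blast
  show "quot_length R N' M' \<le> quot_length R N M"
    using quot_length_le[OF _ assms(6-8)] assms(9) len_le_quot_length[OF assms(1)] by blast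
qed

lemma quot_length_add:
  assumes id: "ideal N R" "ideal M R" "ideal P R" and sub: "N \<subseteq> M" "M \<subseteq> P"
    and f: "finite_length R N M" "finite_length R M P"
  shows "finite_length R N P" "quot_length R N P = quot_length R N M + quot_length R M P"
proof -
  have le: "len_le R N P (quot_length R N M + quot_length R M P)"
    by (rule len_le_add[OF id sub]) (use len_le_quot_length f in auto)
  then show fin: "finite_length R N P" by (auto simp: finite_length_iff_len_le)
  obtain K K' where "ideal_chain R N M K (quot_length R N M)" "ideal_chain R M P K' (quot_length R M P)"
    using quot_length_chain[OF f(1) id(1,2) sub(1)] quot_length_chain[OF f(2) id(2,3) sub(2)] by blast
  from ideal_chain_append[OF this] have "quot_length R N M + quot_length R M P \<le> quot_length R N P"
    using len_le_quot_length[OF fin] unfolding len_le_def by blast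
  then show "quot_length R N P = quot_length R N M + quot_length R M P"
    using quot_length_le[OF le] id sub by auto
qed

lemma len_le_refl: "len_le R N N 0"
  unfolding len_le_def
proof (intro allI impI)
  fix K n assume K: "ideal_chain R N N K n"
  show "n \<le> 0"
  proof (rule ccontr)
    assume "\<not> n \<le> 0"
    then have "K 0 \<subset> K 1" "K 1 \<subseteq> K n" using ideal_chain_mono[OF K, of 1 n] K by (auto simp: ideal_chain_def)
    then show False using K unfolding ideal_chain_def by blast
  qed
qed

lemma quot_length_refl: "ideal N R \<Longrightarrow> finite_length R N N \<and> quot_length R N N = 0"
  using len_le_refl[of N] quot_length_le[of N N 0] finite_length_iff_len_le[of R N N] by auto

lemma colon_ideal: "ideal B R \<Longrightarrow> u \<in> carrier R \<Longrightarrow> ideal (colon R B u) R"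
  unfolding colon_def
  by (intro ideal_by_closure)
    (auto simp: ideal_zero_mem l_distr m_assoc intro: ideal_add_mem ideal_mult_mem)

lemma mem_add_cgenideal: "x \<in> B <+> PIdl u \<longleftrightarrow> (\<exists>b\<in>B. \<exists>r\<in>carrier R. x = b \<oplus> r \<otimes> u)"
  by (auto simp: set_add_iff cgenideal_def)

text \<open>Length form of the isomorphism of \<open>R / (B : u)\<close> with
  \<open>(B + Ru) / B\<close>. On ideals it is given by \<open>K \<mapsto> (K : u)\<close> in one
  direction and by \<open>K \<mapsto> B + Ku\<close> in the other.\<close>

lemma cyclic_quotient_len:
  assumes B: "ideal B R" and u: "u \<in> carrier R"
  shows "len_le R B (B <+> PIdl u) b \<longleftrightarrow> len_le R (colon R B u) (carrier R) b"
proof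
  have idu: "ideal (PIdl u) R" using u by (rule cgenideal_ideal)
  have cB: "ideal (colon R B u) R" using colon_ideal[OF B u] .
  have idBu: "ideal (B <+> PIdl u) R" using add_ideals[OF B idu] .
  have uBu: "u \<in> B <+> PIdl u" using add_upper[OF B idu] cgenideal_self[OF u] by auto
  assume b: "len_le R (colon R B u) (carrier R) b"
  show "len_le R B (B <+> PIdl u) b"
  proof (rule len_le_map[where f="\<lambda>K. colon R K u", OF _ _ cB oneideal _ _ b])
    show "ideal (colon R K u) R" if "ideal K R" for K using colon_ideal[OF that u] .
    fix K L assume KL: "ideal K R" "ideal L R" "B \<subseteq> K" "K \<subset> L" "L \<subseteq> B <+> PIdl u"
    obtain x where x: "x \<in> L" "x \<notin> K" using KL by blast
    then obtain c r where cr: "c \<in> B" "r \<in> carrier R" "x = c \<oplus> r \<otimes> u" using KL mem_add_cgenideal by blast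
    have cc: "c \<in> carrier R" using cr ideal_carr[OF B] by auto
    have cK: "c \<in> K" "c \<in> L" using cr(1) KL(3,4) by blast+
    have eq: "x \<ominus> c = r \<otimes> u" using cr cc u add_minus_cancel[of c "r \<otimes> u"] by simp
    have "r \<otimes> u \<in> L" using ideal_minus_mem[OF KL(2) x(1) cK(2)] unfolding eq .
    moreover have "r \<otimes> u \<notin> K" using cr(3) x(2) ideal_add_mem[OF KL(1) cK(1), of "r \<otimes> u"] by blast
    ultimately show "colon R K u \<subset> colon R L u" using KL(4) cr(2) unfolding colon_def by blast
  qed (auto simp: colon_def)
next
  have idu: "ideal (PIdl u) R" using u by (rule cgenideal_ideal)
  have cB: "ideal (colon R B u) R" using colon_ideal[OF B u] .
  have idBu: "ideal (B <+> PIdl u) R" using add_ideals[OF B idu] .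
  assume b: "len_le R B (B <+> PIdl u) b"
  let ?f = "\<lambda>K. {x \<in> carrier R. \<exists>c\<in>B. \<exists>r\<in>K. x = c \<oplus> r \<otimes> u}"
  show "len_le R (colon R B u) (carrier R) b"
  proof (rule len_le_map[where f="?f", OF _ _ B idBu _ _ b])
    fix K assume K: "ideal K R"
    show "ideal (?f K) R"
    proof (intro ideal_by_closure)
      show "\<zero> \<in> ?f K" using ideal_zero_mem[OF K] ideal_zero_mem[OF B] u by force
    next
      fix x y assume "x \<in> ?f K" "y \<in> ?f K"
      then obtain c r c' r' where "c \<in> B" "r \<in> K" "x = c \<oplus> r \<otimes> u" "c' \<in> B" "r' \<in> K" "y = c' \<oplus> r' \<otimes> u" by auto
      moreover from this have "c \<in> carrier R" "r \<in> carrier R" "c' \<in> carrier R" "r' \<in> carrier R"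
        using ideal_carr[OF B] ideal_carr[OF K] by auto
      ultimately have "x \<oplus> y = (c \<oplus> c') \<oplus> (r \<oplus> r') \<otimes> u" "c \<oplus> c' \<in> B" "r \<oplus> r' \<in> K" "x \<oplus> y \<in> carrier R"
        using ideal_add_mem[OF K] ideal_add_mem[OF B] u by (auto simp: l_distr a_ac)
      then show "x \<oplus> y \<in> ?f K" by blast
    next
      fix x y assume "x \<in> ?f K" and y: "y \<in> carrier R"
      then obtain c r where "c \<in> B" "r \<in> K" "x = c \<oplus> r \<otimes> u" by auto
      moreover from this have "c \<in> carrier R" "r \<in> carrier R"
        using ideal_carr[OF B] ideal_carr[OF K] by auto
      ultimately have "y \<otimes> x = (y \<otimes> c) \<oplus> (y \<otimes> r) \<otimes> u" "y \<otimes> c \<in> B" "y \<otimes> r \<in> K" "y \<otimes> x \<in> carrier R"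
        using ideal_mult_mem[OF K] ideal_mult_mem[OF B] u y by (auto simp: r_distr m_assoc)
      then show "y \<otimes> x \<in> ?f K" by blast
    qed auto
  next
    fix K L assume KL: "ideal K R" "ideal L R" "colon R B u \<subseteq> K" "K \<subset> L" "L \<subseteq> carrier R"
    obtain x where x: "x \<in> L" "x \<notin> K" using KL by blast
    have xc: "x \<in> carrier R" using x KL by auto
    have "x \<otimes> u = \<zero> \<oplus> x \<otimes> u" using xc u by simp
    then have 1: "x \<otimes> u \<in> ?f L" using x xc u ideal_zero_mem[OF B] by blast
    have 2: "x \<otimes> u \<notin> ?f K"
    proof
      assume "x \<otimes> u \<in> ?f K"
      then obtain c r where cr: "c \<in> B" "r \<in> K" "x \<otimes> u = c \<oplus> r \<otimes> u" by auto
      then have cc: "c \<in> carrier R" "r \<in> carrier R" using ideal_carr[OF B] ideal_carr[OF KL(1)] by auto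
      have "(x \<ominus> r) \<otimes> u = c \<oplus> r \<otimes> u \<ominus> r \<otimes> u"
        using cc xc u cr(3) by (simp add: a_minus_def l_distr l_minus)
      also have "\<dots> = c" using cc u by (simp add: a_minus_def a_assoc r_neg)
      finally have "x \<ominus> r \<in> colon R B u" using cr cc xc by (simp add: colon_def)
      then have "x \<ominus> r \<in> K" using KL(3) by blast
      then have "(x \<ominus> r) \<oplus> r \<in> K" using ideal_add_mem[OF KL(1)] cr(2) by blast
      then show False using x xc cc by (simp add: a_minus_def a_assoc l_neg)
    qed
    show "?f K \<subset> ?f L" using KL 1 2 by blast
  next
    show "B \<subseteq> ?f (colon R B u)"
    proof
      fix x assume x: "x \<in> B"
      then have "x \<in> carrier R" "x = x \<oplus> \<zero> \<otimes> u" using ideal_carr[OF B] u by auto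
      moreover have "\<zero> \<in> colon R B u" using ideal_zero_mem[OF cB] .
      ultimately show "x \<in> ?f (colon R B u)" using x by blast
    qed
    show "?f (carrier R) \<subseteq> B <+> PIdl u" unfolding subset_iff mem_add_cgenideal by blast
  qed
qed

text \<open>\<open>A / (A \<inter> B)\<close> embeds into \<open>E / B\<close> by
  \<open>K \<mapsto> K + B\<close>. Strict inclusions survive because all ideals between
  \<open>C\<close> and \<open>A\<close> have the same intersection \<open>A \<inter> B\<close> with
  \<open>B\<close>.\<close>

lemma len_le_second_iso:
  assumes id: "ideal A R" "ideal B R" "ideal C R" and sub: "A \<inter> B \<subseteq> C" "A \<subseteq> E" "B \<subseteq> E" "ideal E R"
    and b: "len_le R B E b"
  shows "len_le R C A b"
proof (rule len_le_map[where f="\<lambda>K. K <+> B", OF _ _ id(2) sub(4) _ _ b])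
  show "ideal (K <+> B) R" if "ideal K R" for K using add_ideals[OF that id(2)] .
  show "B \<subseteq> C <+> B" using add_upper[OF id(3,2)] by simp
  show "A <+> B \<subseteq> E" using add_least[OF sub(4)] sub by blast
  fix K L assume KL: "ideal K R" "ideal L R" "C \<subseteq> K" "K \<subset> L" "L \<subseteq> A"
  have "K <+> B \<noteq> L <+> B"
    using modular_eq[OF KL(1,2) id(2)] KL sub by blast
  moreover have "K <+> B \<subseteq> L <+> B" using KL by (intro add_mono_ideal) auto
  ultimately show "K <+> B \<subset> L <+> B" by blast
qed

end

section \<open>Noetherian local rings\<close>

locale noetherian_cring = noetherian_ring R + cring R for R (structure)

context cring
begin

section \<open>Products and powers of ideals\<close>

lemma ideal_prod_mem: "x \<in> A \<Longrightarrow> y \<in> B \<Longrightarrow> x \<otimes> y \<in> A \<cdot> B"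
  by (rule ideal_prod.prod)

lemma ideal_prod_least:
  assumes "ideal C R" "\<And>x y. x \<in> A \<Longrightarrow> y \<in> B \<Longrightarrow> x \<otimes> y \<in> C"
  shows "A \<cdot> B \<subseteq> C"
proof
  fix s assume "s \<in> A \<cdot> B"
  then show "s \<in> C"
    by (induct s rule: ideal_prod.induct) (use assms ideal_add_mem in blast)+
qed

lemma ideal_prod_mono: "A \<subseteq> A' \<Longrightarrow> B \<subseteq> B' \<Longrightarrow> A \<cdot> B \<subseteq> A' \<cdot> B'"
proof
  fix s assume sub: "A \<subseteq> A'" "B \<subseteq> B'" and "s \<in> A \<cdot> B"
  from this(3) show "s \<in> A' \<cdot> B'"
  proof (induct s rule: ideal_prod.induct)
    case (prod i j)
    then show ?case using sub ideal_prod_mem[of i A' j B'] by blast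
  next
    case (sum s1 s2)
    then show ?case by (intro ideal_prod.sum)
  qed
qed

lemma ideal_prod_lower:
  assumes "ideal A R" "ideal B R" shows "A \<cdot> B \<subseteq> A" "A \<cdot> B \<subseteq> B"
  using ideal_prod_inter[OF assms] by auto

lemma ideal_prod_one_left: "ideal A R \<Longrightarrow> carrier R \<cdot> A = A"
  using ideal_prod_commute[of A "carrier R"] ideal_prod_one[of A] oneideal by simp

lemma ideal_prod_left_commute:
  assumes "ideal A R" "ideal B R" "ideal C R"
  shows "A \<cdot> (B \<cdot> C) = B \<cdot> (A \<cdot> C)"
  using ideal_prod_assoc[OF assms] ideal_prod_assoc[OF assms(2,1,3)] ideal_prod_commute[OF assms(1,2)]
  by simp

lemma ideal_add_commute: "ideal A R \<Longrightarrow> ideal B R \<Longrightarrow> A <+> B = B <+> A"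
  by (rule set_add_comm) (rule ideal_carr, assumption)+

lemma ideal_add_assoc:
  assumes "ideal A R" "ideal B R" "ideal C R"
  shows "A <+> B <+> C = A <+> (B <+> C)"
  using assms by (simp add: add.set_mult_assoc ideal_carr set_add_defs(1))

lemma ideal_add_absorb: "ideal A R \<Longrightarrow> ideal B R \<Longrightarrow> B \<subseteq> A \<Longrightarrow> A <+> B = A"
  using add_least[of A A B] add_upper[of A B] by blast

lemma ideal_pow_0: "ideal_pow R A 0 = carrier R"
  and ideal_pow_Suc: "ideal_pow R A (Suc k) = A \<cdot> ideal_pow R A k"
  by (simp_all add: ideal_pow_def)

lemma ideal_pow_ideal: "ideal A R \<Longrightarrow> ideal (ideal_pow R A k) R"
  by (induction k) (simp_all add: ideal_pow_0 ideal_pow_Suc oneideal ideal_prod_is_ideal)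

lemma ideal_pow_add: "ideal A R \<Longrightarrow> ideal_pow R A (k + l) = ideal_pow R A k \<cdot> ideal_pow R A l"
  by (induction k)
    (simp_all add: ideal_pow_0 ideal_pow_Suc ideal_prod_one_left ideal_pow_ideal ideal_prod_assoc)

lemma ideal_pow_antimono:
  assumes "ideal A R" "k \<le> l" shows "ideal_pow R A l \<subseteq> ideal_pow R A k"
proof -
  obtain m where "l = k + m" using assms(2) le_iff_add by auto
  then show ?thesis
    using ideal_pow_add[OF assms(1)] ideal_prod_lower(1)[OF ideal_pow_ideal[OF assms(1)] ideal_pow_ideal[OF assms(1)]]
    by simp
qed

lemma power_mem_ideal_pow: "ideal A R \<Longrightarrow> z \<in> A \<Longrightarrow> z [^] k \<in> ideal_pow R A (k::nat)"
proof (induction k)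
  case 0 then show ?case by (simp add: ideal_pow_0)
next
  case (Suc k)
  have "z \<in> carrier R" using Suc.prems ideal_carr by blast
  then have "z [^] Suc k = z \<otimes> z [^] k" using nat_pow_Suc2 by blast
  then show ?case using ideal_prod_mem[OF Suc.prems(2) Suc.IH[OF Suc.prems]] by (simp add: ideal_pow_Suc)
qed

text \<open>Multiplication by \<open>u\<close> makes \<open>(B + Ru) / B\<close> a quotient of
  \<open>R / a\<close>.\<close>

lemma len_le_colon_step:
  assumes "ideal a R" "ideal B R" "u \<in> carrier R" "\<And>x. x \<in> a \<Longrightarrow> x \<otimes> u \<in> B" "len_le R a (carrier R) b"
  shows "len_le R B (B <+> PIdl u) b"
proof -
  have "a \<subseteq> colon R B u" using assms(4) ideal_carr[OF assms(1)] by (auto simp: colon_def)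
  then have "len_le R (colon R B u) (carrier R) b"
    using assms(5) by (rule_tac len_le_sub[OF _ assms(1) oneideal]) auto
  then show ?thesis using cyclic_quotient_len[OF assms(2,3)] by blast
qed

section \<open>Colength of ideals generated by powers of elements\<close>

text \<open>Multiplication by \<open>z [^] k\<close> maps \<open>R / (c + Rz)\<close> onto the
  factor between the ideals for \<open>k + 1\<close> and for \<open>k\<close>, so each of the
  factors has length at most \<open>b\<close>.\<close>

lemma len_le_principal_power:
  assumes c: "ideal c R" and z: "z \<in> carrier R" and b: "len_le R (c <+> PIdl z) (carrier R) b"
  shows "len_le R (c <+> PIdl (z [^] (k::nat))) (carrier R) (k * b)"
proof (induction k)
  case 0
  have "PIdl \<one> = carrier R" using cgenideal_eq_genideal[OF one_closed] genideal_one by simp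
  then have "c <+> PIdl (z [^] (0::nat)) = carrier R"
    using ideal_add_commute[OF c oneideal] ideal_add_absorb[OF oneideal c ideal_carr[OF c]] by simp
  then show ?case using len_le_refl by simp
next
  case (Suc k)
  let ?P = "\<lambda>k::nat. PIdl (z [^] k)"
  have id: "ideal (?P k) R" "ideal (c <+> ?P k) R" for k
    using add_ideals[OF c] cgenideal_ideal z by auto
  have idz: "ideal (c <+> PIdl z) R" using add_ideals[OF c] cgenideal_ideal z by auto
  have sub: "?P (Suc k) \<subseteq> ?P k"
    by (rule cgenideal_minimal[OF id(1)]) (use z in \<open>auto simp: cgenideal_def m_comm\<close>)
  have eq: "(c <+> ?P (Suc k)) <+> ?P k = c <+> ?P k"
    unfolding ideal_add_assoc[OF c id(1) id(1)] ideal_add_commute[OF id(1)[of "Suc k"] id(1)[of k]]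
      ideal_add_absorb[OF id(1) id(1) sub] ..
  have "len_le R (c <+> ?P (Suc k)) ((c <+> ?P (Suc k)) <+> ?P k) b"
  proof (rule len_le_colon_step[OF idz id(2) _ _ b])
    fix x assume "x \<in> c <+> PIdl z"
    then obtain a s where x: "a \<in> c" "s \<in> carrier R" "x = a \<oplus> s \<otimes> z" unfolding mem_add_cgenideal by blast
    have a: "a \<in> carrier R" using x ideal_carr[OF c] by auto
    have "x \<otimes> z [^] k = (z [^] k \<otimes> a) \<oplus> s \<otimes> z [^] Suc k"
      using x a z unfolding nat_pow_Suc2[OF z] by (simp add: l_distr m_assoc m_comm[of a "z [^] k"])
    moreover have "z [^] k \<otimes> a \<in> c" using x z ideal_mult_mem[OF c] by auto
    ultimately show "x \<otimes> z [^] k \<in> c <+> ?P (Suc k)" unfolding mem_add_cgenideal using x by blast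
  qed (use z in auto)
  then have "len_le R (c <+> ?P (Suc k)) (c <+> ?P k) b" using eq by simp
  moreover have "c <+> ?P (Suc k) \<subseteq> c <+> ?P k" using sub by (intro add_mono_ideal) auto
  ultimately have "len_le R (c <+> ?P (Suc k)) (carrier R) (b + k * b)"
    using len_le_add[OF id(2) id(2) oneideal] Suc.IH ideal_carr[OF id(2)] by blast
  then show ?case by simp
qed

text \<open>The ideal \<open>A + (z 0, ..., z (d - 1))\<close>. The base \<open>A\<close> is kept as
  an argument so that generators not yet treated can be moved into it.\<close>

primrec gensum :: "'a set \<Rightarrow> (nat \<Rightarrow> 'a) \<Rightarrow> nat \<Rightarrow> 'a set" where
  "gensum A z 0 = A"
| "gensum A z (Suc d) = gensum A z d <+> PIdl (z d)"

lemma gensum_ideal: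
  "ideal A R \<Longrightarrow> (\<And>i. i < d \<Longrightarrow> z i \<in> carrier R) \<Longrightarrow> ideal (gensum A z d) R"
  by (induction d) (auto intro: add_ideals cgenideal_ideal)

lemma gensum_add:
  assumes "ideal A R" "ideal B R" "\<And>i. i < d \<Longrightarrow> z i \<in> carrier R"
  shows "gensum (A <+> B) z d = gensum A z d <+> B"
  using assms(3)
proof (induction d)
  case (Suc d)
  have id: "ideal (gensum A z d) R" "ideal (PIdl (z d)) R"
    using gensum_ideal[OF assms(1)] Suc.prems cgenideal_ideal by auto
  have "gensum (A <+> B) z (Suc d) = gensum A z d <+> B <+> PIdl (z d)" using Suc by simp
  also have "\<dots> = gensum A z (Suc d) <+> B"
    using ideal_add_assoc[OF id(1) assms(2) id(2)] ideal_add_assoc[OF id(1) id(2) assms(2)]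
      ideal_add_commute[OF assms(2) id(2)] by simp
  finally show ?case .
qed simp

text \<open>Raising one generator at a time to the power \<open>k\<close> multiplies the bound by
  \<open>k\<close>. The induction hypothesis is used with the last generator, still unchanged,
  absorbed in the base ideal.\<close>

lemma len_le_gensum_power:
  fixes k :: nat
  assumes "ideal A R" "\<And>i. i < d \<Longrightarrow> z i \<in> carrier R" "len_le R (gensum A z d) (carrier R) b"
  shows "len_le R (gensum A (\<lambda>i. z i [^] k) d) (carrier R) (k ^ d * b)"
  using assms
proof (induction d arbitrary: A b)
  case (Suc d)
  let ?w = "\<lambda>i. z i [^] k"
  have zd: "z d \<in> carrier R" and z: "\<And>i. i < d \<Longrightarrow> z i \<in> carrier R" using Suc.prems by auto
  have w: "\<And>i. i < d \<Longrightarrow> ?w i \<in> carrier R" using z by auto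
  have idP: "ideal (PIdl (z d)) R" using zd cgenideal_ideal by auto
  have "len_le R (gensum (A <+> PIdl (z d)) z d) (carrier R) b"
    using Suc.prems(3) gensum_add[OF Suc.prems(1) idP z] by simp
  then have "len_le R (gensum (A <+> PIdl (z d)) ?w d) (carrier R) (k ^ d * b)"
    using Suc.IH[OF add_ideals[OF Suc.prems(1) idP] z] by blast
  then have "len_le R (gensum A ?w d <+> PIdl (z d)) (carrier R) (k ^ d * b)"
    using gensum_add[OF Suc.prems(1) idP w] by simp
  from len_le_principal_power[OF gensum_ideal[OF Suc.prems(1) w] zd this, of k]
  show ?case by (simp add: mult.assoc)
qed simp

section \<open>Prime avoidance, Noetherian induction and primes over an ideal\<close>

lemma mem_ideal_avoiding_prime:
  assumes P: "primeideal P R" and A: "ideal A R" "\<not> A \<subseteq> P"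
    and S: "finite S" "\<And>Q. Q \<in> S \<Longrightarrow> ideal Q R \<and> \<not> Q \<subseteq> P"
  shows "\<exists>y\<in>A. (\<forall>Q\<in>S. y \<in> Q) \<and> y \<notin> P"
  using S
proof (induction S rule: finite_induct)
  case empty
  then show ?case using A by auto
next
  case (insert Q S)
  obtain y where y: "y \<in> A" "\<forall>Q\<in>S. y \<in> Q" "y \<notin> P" using insert by auto
  have Q: "ideal Q R" "\<not> Q \<subseteq> P" using insert.prems by auto
  obtain x where x: "x \<in> Q" "x \<notin> P" using Q by auto
  have car: "x \<in> carrier R" "y \<in> carrier R" using x y ideal_carr[OF Q(1)] ideal_carr[OF A(1)] by auto
  have "x \<otimes> y \<notin> P" using primeideal.I_prime[OF P car] x y by blast
  moreover have "x \<otimes> y \<in> A" using ideal_mult_mem[OF A(1) y(1) car(1)] .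
  moreover have "x \<otimes> y \<in> Q" using ideal_mult_mem[OF Q(1) x(1) car(2)] m_comm[OF car] by simp
  moreover have "x \<otimes> y \<in> Q'" if "Q' \<in> S" for Q'
    using ideal_mult_mem[of Q' y x] insert.prems that y car by auto
  ultimately show ?case by (intro bexI[of _ "x \<otimes> y"]) auto
qed

lemma prime_avoidance:
  assumes A: "ideal A R" and "finite S" "\<And>P. P \<in> S \<Longrightarrow> primeideal P R" "\<And>P. P \<in> S \<Longrightarrow> \<not> A \<subseteq> P"
  shows "\<exists>z\<in>A. \<forall>P\<in>S. z \<notin> P"
  using assms(2-)
proof (induction S rule: finite_psubset_induct)
  case (psubset S)
  have IH: "\<exists>z\<in>A. \<forall>P\<in>S - {Q}. z \<notin> P" if "Q \<in> S" for Q
    using psubset.IH[of "S - {Q}"] psubset.prems that by blast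
  show ?case
  proof (cases "S = {}")
    case True
    then show ?thesis using ideal_zero_mem[OF A] by auto
  next
    case False
    then obtain P where P: "P \<in> S" by auto
    show ?thesis
    proof (cases "\<exists>Q\<in>S - {P}. Q \<subseteq> P")
      case True
      then obtain Q where Q: "Q \<in> S" "Q \<noteq> P" "Q \<subseteq> P" by auto
      then show ?thesis using IH[OF Q(1)] P by blast
    next
      case no: False
      obtain x where x: "x \<in> A" "\<forall>Q\<in>S - {P}. x \<notin> Q" using IH[OF P] by auto
      have primes: "primeideal Q R" if "Q \<in> S" for Q using psubset.prems that by auto
      have ids: "ideal Q R" if "Q \<in> S" for Q using primes[OF that] by (simp add: primeideal.axioms(1))
      show ?thesis
      proof (cases "x \<in> P")
        case False
        then show ?thesis using x by auto
      next
        case True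
        obtain y where y: "y \<in> A" "\<forall>Q\<in>S - {P}. y \<in> Q" "y \<notin> P"
        proof -
          have "\<exists>y\<in>A. (\<forall>Q\<in>S - {P}. y \<in> Q) \<and> y \<notin> P"
          proof (rule mem_ideal_avoiding_prime[OF primes[OF P] A psubset.prems(2)[OF P]])
            show "finite (S - {P})" using psubset.hyps by simp
            show "ideal Q R \<and> \<not> Q \<subseteq> P" if "Q \<in> S - {P}" for Q using ids no that by blast
          qed
          then show ?thesis using that by blast
        qed
        have car: "x \<in> carrier R" "y \<in> carrier R" using x y ideal_carr[OF A] by auto
        have "x \<oplus> y \<notin> P"
          using ideal_minus_mem[OF ids[OF P], of "x \<oplus> y" x] add_minus_cancel[OF car] True y by auto
        moreover have "x \<oplus> y \<notin> Q" if Q: "Q \<in> S - {P}" for Q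
          using ideal_minus_mem[OF ids, of Q "y \<oplus> x" y] add_minus_cancel[OF car(2,1)] a_comm[OF car] x y Q
          by auto
        ultimately show ?thesis using ideal_add_mem[OF A x(1) y(1)] by (intro bexI[of _ "x \<oplus> y"]) auto
      qed
    qed
  qed
qed

end

context noetherian_cring
begin

text \<open>Zorn's lemma on the counterexamples, since a nonempty chain of ideals contains its own
  union.\<close>

lemma noetherian_induct [consumes 1, case_names larger]:
  assumes "ideal I R" and step: "\<And>I. ideal I R \<Longrightarrow> (\<And>J. ideal J R \<Longrightarrow> I \<subset> J \<Longrightarrow> P J) \<Longrightarrow> P I"
  shows "P I"
proof (rule ccontr)
  assume "\<not> P I"
  define S where "S = {I. ideal I R \<and> \<not> P I}"
  have "S \<noteq> {}" using assms(1) \<open>\<not> P I\<close> by (auto simp: S_def)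
  moreover have "\<Union>C \<in> S" if "C \<noteq> {}" "subset.chain S C" for C
  proof -
    have "subset.chain {I. ideal I R} C" using that by (auto simp: S_def pred_on.chain_def)
    then show ?thesis using ideal_chain_is_trivial[OF that(1)] that by (auto simp: pred_on.chain_def)
  qed
  ultimately obtain M where M: "M \<in> S" "\<forall>X\<in>S. M \<subseteq> X \<longrightarrow> X = M"
    using subset_Zorn_nonempty[of S] by blast
  have "P M"
  proof (rule step)
    show "ideal M R" using M by (simp add: S_def)
    show "P J" if "ideal J R" "M \<subset> J" for J using M that unfolding S_def by blast
  qed
  then show False using M by (simp add: S_def)
qed

lemma ascending_chain_stabilizes:
  assumes "\<And>k::nat. ideal (f k) R" "\<And>k. f k \<subseteq> f (Suc k)"
  shows "\<exists>K. \<forall>k\<ge>K. f k = f K"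
proof -
  have mono: "f i \<subseteq> f j" if "i \<le> j" for i j using lift_Suc_mono_le[of f, OF assms(2) that] .
  have "subset.chain {I. ideal I R} (range f)"
    using assms(1) mono nat_le_linear unfolding pred_on.chain_def by blast
  then have "\<Union>(range f) \<in> range f" by (intro ideal_chain_is_trivial) auto
  then obtain K where "\<Union>(range f) = f K" by auto
  then have "f k \<subseteq> f K" for k by auto
  then show ?thesis using mono by (metis subset_antisym)
qed

text \<open>If \<open>x \<otimes> y \<in> A\<close> with neither factor in \<open>A\<close>, every
  prime over \<open>A\<close> contains \<open>A + Rx\<close> or \<open>A + Ry\<close>, both strictly
  larger. The finite sets of the two are joined; members of \<open>S\<close> may fail to be
  minimal.\<close>

lemma finitely_many_minimal_primes:
  assumes "ideal A R"
  shows "\<exists>S. finite S \<and> (\<forall>Q\<in>S. primeideal Q R \<and> A \<subseteq> Q) \<and> (\<forall>P. primeideal P R \<longrightarrow> A \<subseteq> P \<longrightarrow> (\<exists>Q\<in>S. Q \<subseteq> P))"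
  using assms
proof (induction A rule: noetherian_induct)
  case (larger A)
  show ?case
  proof (cases "primeideal A R")
    case True
    then show ?thesis by (intro exI[of _ "{A}"]) auto
  next
    case False
    from ideal.primeidealCD[OF larger(1) is_cring this] show ?thesis
    proof (elim disjE exE conjE)
      assume A: "carrier R = A"
      have "\<not> A \<subseteq> P" if "primeideal P R" for P
        using primeideal.I_notcarr[OF that] ideal_carr[OF primeideal.axioms(1)[OF that]] A by blast
      then show ?thesis by (intro exI[of _ "{}"]) auto
    next
      fix x y assume xy: "x \<in> carrier R" "y \<in> carrier R" "x \<otimes> y \<in> A" "x \<notin> A" "y \<notin> A"
      have big: "ideal (A <+> PIdl w) R \<and> A \<subset> A <+> PIdl w" if "w \<in> carrier R" "w \<notin> A" for w
        using add_ideals[OF larger(1) cgenideal_ideal[OF that(1)]]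
          add_upper[OF larger(1) cgenideal_ideal[OF that(1)]] cgenideal_self[OF that(1)] that by blast
      from larger(2)[OF conjunct1[OF big[OF xy(1,4)]] conjunct2[OF big[OF xy(1,4)]]]
      obtain S where S: "finite S" "\<forall>Q\<in>S. primeideal Q R \<and> A <+> PIdl x \<subseteq> Q"
          "\<forall>P. primeideal P R \<longrightarrow> A <+> PIdl x \<subseteq> P \<longrightarrow> (\<exists>Q\<in>S. Q \<subseteq> P)"
        by (elim exE conjE) (rule that)
      from larger(2)[OF conjunct1[OF big[OF xy(2,5)]] conjunct2[OF big[OF xy(2,5)]]]
      obtain T where T: "finite T" "\<forall>Q\<in>T. primeideal Q R \<and> A <+> PIdl y \<subseteq> Q"
          "\<forall>P. primeideal P R \<longrightarrow> A <+> PIdl y \<subseteq> P \<longrightarrow> (\<exists>Q\<in>T. Q \<subseteq> P)"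
        by (elim exE conjE) (rule that)
      have "\<exists>Q\<in>S \<union> T. Q \<subseteq> P" if P: "primeideal P R" "A \<subseteq> P" for P
      proof -
        have idP: "ideal P R" using P(1) by (simp add: primeideal.axioms(1))
        have "x \<in> P \<or> y \<in> P" using primeideal.I_prime[OF P(1) xy(1,2)] xy(3) P(2) by blast
        then have "A <+> PIdl x \<subseteq> P \<or> A <+> PIdl y \<subseteq> P"
          using add_least[OF idP P(2)] cgenideal_minimal[OF idP] by blast
        then show ?thesis using S(3) T(3) P(1) by blast
      qed
      moreover have "\<forall>Q\<in>S \<union> T. primeideal Q R \<and> A \<subseteq> Q"
        using S(2) T(2) big[OF xy(1,4)] big[OF xy(2,5)] by blast
      ultimately show ?thesis using S(1) T(1) by (intro exI[of _ "S \<union> T"]) auto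
    qed
  qed
qed

lemma proper_ideal_in_maximal:
  assumes "ideal I R" "I \<noteq> carrier R" shows "\<exists>M. maximalideal M R \<and> I \<subseteq> M"
  using assms
proof (induction I rule: noetherian_induct)
  case (larger I)
  show ?case
  proof (cases "maximalideal I R")
    case False
    then obtain J where J: "ideal J R" "I \<subseteq> J" "J \<noteq> I" "J \<noteq> carrier R"
      using maximalidealI[OF larger(1)] larger(3) by metis
    then show ?thesis using larger(2)[of J] by blast
  qed auto
qed

end

locale noetherian_local_ring = noetherian_cring R for R (structure) +
  fixes m assumes maximal_m: "maximalideal m R" and unique_m: "\<And>M. maximalideal M R \<Longrightarrow> M = m"
begin

lemma ideal_m: "ideal m R"
  using maximal_m by (simp add: maximalideal.axioms(1))

lemma proper_ideal_le_m: "ideal I R \<Longrightarrow> I \<noteq> carrier R \<Longrightarrow> I \<subseteq> m"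
  using proper_ideal_in_maximal unique_m by blast

lemma unit_if_not_mem_m:
  assumes "x \<in> carrier R" "x \<notin> m" shows "PIdl x = carrier R"
  using proper_ideal_le_m[OF cgenideal_ideal[OF assms(1)]] cgenideal_self[OF assms(1)] assms(2) by blast

lemma primeideal_le_m: "primeideal P R \<Longrightarrow> P \<subseteq> m"
  using primeideal.I_notcarr proper_ideal_le_m primeideal.axioms(1) by blast

lemma one_not_mem_m: "\<one> \<notin> m"
  using maximalideal.I_notcarr[OF maximal_m] ideal.one_imp_carrier[OF ideal_m] by blast

section \<open>Nakayama's lemma and annihilation of quotients of finite length\<close>

text \<open>Noetherian induction replaces a choice of generators. Let \<open>C\<close> contain
  \<open>B\<close> but not \<open>A\<close>, while every larger ideal contains \<open>A\<close>. For
  \<open>x \<in> A\<close> outside \<open>C\<close> this gives \<open>A \<subseteq> C + Rx\<close>,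
  and \<open>y \<otimes> x \<in> C\<close> for all \<open>y \<in> q\<close>. Hence
  \<open>q \<cdot> A \<subseteq> C\<close>, which forces \<open>A \<subseteq> C\<close>.\<close>

lemma nakayama:
  assumes A: "ideal A R" and B: "ideal B R" and q: "ideal q R" "q \<subseteq> m" and le: "A \<subseteq> B <+> q \<cdot> A"
  shows "A \<subseteq> B"
proof -
  have "B \<subseteq> C \<longrightarrow> A \<subseteq> C" if "ideal C R" for C
    using that
  proof (induction C rule: noetherian_induct)
    case (larger C)
    show ?case
    proof (intro impI, rule ccontr)
      assume BC: "B \<subseteq> C" and "\<not> A \<subseteq> C"
      then obtain x where x: "x \<in> A" "x \<notin> C" by auto
      have big: "A \<subseteq> C <+> PIdl w" if "w \<in> carrier R" "w \<notin> C" for w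
      proof -
        have "ideal (C <+> PIdl w) R" "C \<subset> C <+> PIdl w"
          using add_ideals[OF larger(1) cgenideal_ideal[OF that(1)]]
            add_upper[OF larger(1) cgenideal_ideal[OF that(1)]] cgenideal_self[OF that(1)] that by blast+
        then show ?thesis using larger(2) BC by blast
      qed
      have xc: "x \<in> carrier R" using x ideal_carr[OF A] by auto
      have yx: "y \<otimes> x \<in> C" if y: "y \<in> q" for y
      proof (rule ccontr)
        assume "y \<otimes> x \<notin> C"
        have yc: "y \<in> carrier R" using y ideal_carr[OF q(1)] by auto
        obtain c s where cs: "c \<in> C" "s \<in> carrier R" "x = c \<oplus> s \<otimes> (y \<otimes> x)"
          using big[of "y \<otimes> x"] \<open>y \<otimes> x \<notin> C\<close> yc xc x(1) mem_add_cgenideal by blast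
        have cc: "c \<in> carrier R" using cs ideal_carr[OF larger(1)] by auto
        \<comment> \<open>From \<open>x = c + syx\<close> follows \<open>wx = c \<in> C\<close>. As
          \<open>sy\<close> lies in \<open>m\<close>, \<open>w\<close> is a unit, so
          \<open>x\<close> itself would lie in \<open>C\<close>.\<close>
        define w where "w = \<one> \<ominus> s \<otimes> y"
        have wc: "w \<in> carrier R" using cs yc by (simp add: w_def)
        have "c = x \<ominus> s \<otimes> (y \<otimes> x)"
          using add_minus_cancel[of "s \<otimes> (y \<otimes> x)" c] cs cc yc xc a_comm[of c "s \<otimes> (y \<otimes> x)"] by simp
        also have "\<dots> = w \<otimes> x"
          using cs yc xc by (simp add: w_def a_minus_def l_distr l_minus m_assoc)
        finally have wx: "w \<otimes> x \<in> C" using cs by simp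
        have "s \<otimes> y \<in> m" using ideal_mult_mem[OF ideal_m] y q(2) cs by blast
        then have "w \<notin> m"
          using ideal_add_mem[OF ideal_m, of w "s \<otimes> y"] one_not_mem_m cs yc
          by (auto simp: w_def a_minus_def a_assoc l_neg)
        then have "\<one> \<in> PIdl w" using unit_if_not_mem_m[OF wc] by simp
        then obtain t where t: "t \<in> carrier R" "\<one> = t \<otimes> w" by (auto simp: cgenideal_def)
        have "x = t \<otimes> (w \<otimes> x)" using t wc xc by (metis l_one m_assoc)
        then show False using ideal_mult_mem[OF larger(1) wx t(1)] x(2) by simp
      qed
      have "q \<cdot> A \<subseteq> C"
      proof (rule ideal_prod_least[OF larger(1)])
        fix y a assume y: "y \<in> q" and a: "a \<in> A"
        have yc: "y \<in> carrier R" using y ideal_carr[OF q(1)] by auto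
        obtain c s where cs: "c \<in> C" "s \<in> carrier R" "a = c \<oplus> s \<otimes> x"
          using big[OF xc x(2)] a mem_add_cgenideal by blast
        have cc: "c \<in> carrier R" using cs ideal_carr[OF larger(1)] by auto
        have "y \<otimes> a = y \<otimes> c \<oplus> s \<otimes> (y \<otimes> x)"
          using cs cc yc xc by (simp add: r_distr m_lcomm)
        then show "y \<otimes> a \<in> C"
          using ideal_add_mem[OF larger(1)] ideal_mult_mem[OF larger(1)] cs yc yx[OF y] by simp
      qed
      then have "B <+> q \<cdot> A \<subseteq> C" using add_least[OF larger(1) BC] by blast
      then show False using le x by blast
    qed
  qed
  then show ?thesis using B by blast
qed

text \<open>The ideals \<open>I + q^k J\<close> descend between \<open>J\<close> and
  \<open>I\<close>, so they must repeat within the length of \<open>J / I\<close>. At a repetition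
  Nakayama's lemma gives \<open>q^k J \<subseteq> I\<close>.\<close>

lemma finite_length_imp_pow_le:
  assumes I: "ideal I R" and J: "ideal J R" and sub: "I \<subseteq> J" and fin: "finite_length R I J"
    and q: "ideal q R" "q \<subseteq> m"
  shows "\<exists>c. ideal_pow R q c \<cdot> J \<subseteq> I"
proof -
  obtain b where b: "len_le R I J b" using fin by (auto simp: finite_length_iff_len_le)
  define D where "D k = I <+> ideal_pow R q k \<cdot> J" for k
  have idp: "ideal (ideal_pow R q k) R" "ideal (ideal_pow R q k \<cdot> J) R" for k
    using ideal_pow_ideal[OF q(1)] ideal_prod_is_ideal[OF _ J] by auto
  have idD: "ideal (D k) R" for k unfolding D_def using add_ideals[OF I] idp by blast
  have dec: "D (Suc k) \<subseteq> D k" for k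
    unfolding D_def using ideal_pow_antimono[OF q(1), of k "Suc k"]
    by (intro add_mono_ideal ideal_prod_mono) auto
  have DJ: "D k \<subseteq> J" for k
    unfolding D_def using add_least[OF J sub] ideal_prod_lower(2)[OF idp(1) J] by blast
  have ID: "I \<subseteq> D k" for k unfolding D_def using add_upper[OF I idp(2)] by blast
  have "\<exists>k. D k = D (Suc k)"
  proof (rule ccontr)
    assume "\<nexists>k. D k = D (Suc k)"
    then have ne: "D k \<noteq> D (Suc k)" for k by blast
    have "ideal_chain R (D (Suc b)) (D 0) (\<lambda>i. D (Suc b - i)) (Suc b)"
      unfolding ideal_chain_def
    proof (intro conjI allI impI)
      fix i assume "i < Suc b"
      then have "Suc b - i = Suc (Suc b - Suc i)" by simp
      then show "D (Suc b - i) \<subset> D (Suc b - Suc i)" using dec[of "Suc b - Suc i"] ne[of "Suc b - Suc i"] by auto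
    qed (use idD in auto)
    moreover have "len_le R (D (Suc b)) (D 0) b" using len_le_sub[OF b I J ID DJ] .
    ultimately show False unfolding len_le_def by fastforce
  qed
  then obtain k where k: "D k = D (Suc k)" by blast
  have "ideal_pow R q k \<cdot> J \<subseteq> D k" unfolding D_def using add_upper[OF I idp(2)] by blast
  also have "D k = D (Suc k)" by (rule k)
  also have "\<dots> = I <+> q \<cdot> (ideal_pow R q k \<cdot> J)"
    unfolding D_def ideal_pow_Suc ideal_prod_assoc[OF q(1) idp(1) J] ..
  finally have "ideal_pow R q k \<cdot> J \<subseteq> I" by (rule nakayama[OF idp(2) I q])
  then show ?thesis by blast
qed

section \<open>Systems of parameters and parameter ideals\<close>

lemma prime_chain_shift:
  assumes "prime_chain R P n" "primeideal Q R" "Q \<subset> P 0"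
  shows "prime_chain R (\<lambda>i. if i = 0 then Q else P (i - 1)) (Suc n)"
proof -
  have "(if i = 0 then Q else P (i - 1)) \<subset> (if Suc i = 0 then Q else P (Suc i - 1))" if "i < Suc n" for i
    using assms(1,3) that by (cases i) (auto simp: prime_chain_def)
  moreover have "primeideal (if i = 0 then Q else P (i - 1)) R" if "i \<le> Suc n" for i
    using assms(1,2) that by (cases i) (auto simp: prime_chain_def)
  ultimately show ?thesis unfolding prime_chain_def by blast
qed

text \<open>The next parameter avoids all primes \<open>Q \<noteq> m\<close> in a finite set that
  meets every prime over the previous parameters from below. A chain of primes over the enlarged
  ideal that starts below \<open>m\<close> can then be prolonged downwards by such a
  \<open>Q\<close>, so the admissible length drops by one.\<close>

lemma system_of_parameters_aux:
  assumes dim: "\<And>P n. prime_chain R P n \<Longrightarrow> n \<le> d"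
  shows "i \<le> d \<Longrightarrow> \<exists>z. (\<forall>j<i. z j \<in> m) \<and> (\<forall>P n. prime_chain R P n \<longrightarrow> gensum {\<zero>} z i \<subseteq> P 0 \<longrightarrow> n + i \<le> d)"
proof (induction i)
  case 0
  then show ?case using dim by auto
next
  case (Suc i)
  then obtain z where z: "\<forall>j<i. z j \<in> m"
      "\<And>P n. prime_chain R P n \<Longrightarrow> gensum {\<zero>} z i \<subseteq> P 0 \<Longrightarrow> n + i \<le> d" by auto
  have idg: "ideal (gensum {\<zero>} z i) R"
    using z(1) ideal_carr[OF ideal_m] by (intro gensum_ideal zeroideal) auto
  obtain S where S: "finite S" "\<And>Q. Q \<in> S \<Longrightarrow> primeideal Q R \<and> gensum {\<zero>} z i \<subseteq> Q"
      "\<And>P. primeideal P R \<Longrightarrow> gensum {\<zero>} z i \<subseteq> P \<Longrightarrow> \<exists>Q\<in>S. Q \<subseteq> P"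
    using finitely_many_minimal_primes[OF idg] by blast
  \<comment> \<open>An element of \<open>m\<close> cannot avoid \<open>m\<close>, so
    \<open>m\<close> is left out of \<open>S\<close>. A chain starting at \<open>m\<close> has
    length 0, and for it \<open>Suc i \<le> d\<close> suffices.\<close>
  have nle: "\<not> m \<subseteq> P" if "P \<in> S - {m}" for P
    using primeideal_le_m[of P] S(2)[of P] that by blast
  have "\<exists>x\<in>m. \<forall>P\<in>S - {m}. x \<notin> P"
    using S nle by (intro prime_avoidance[OF ideal_m]) auto
  then obtain x where x: "x \<in> m" "\<And>P. P \<in> S \<Longrightarrow> P \<noteq> m \<Longrightarrow> x \<notin> P" by blast
  have xc: "x \<in> carrier R" using x ideal_carr[OF ideal_m] by auto
  define w where "w = z(i := x)"
  have "gensum {\<zero>} w k = gensum {\<zero>} z k" if "k \<le> i" for k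
    using that by (induction k) (auto simp: w_def)
  then have g: "gensum {\<zero>} w (Suc i) = gensum {\<zero>} z i <+> PIdl x" by (simp add: w_def)
  have "n + Suc i \<le> d" if P: "prime_chain R P n" "gensum {\<zero>} w (Suc i) \<subseteq> P 0" for P n
  proof (cases "P 0 = m")
    case True
    have "n = 0"
    proof (rule ccontr)
      assume "n \<noteq> 0"
      then have "P 0 \<subset> P 1" "primeideal (P 1) R" using P by (auto simp: prime_chain_def)
      then show False using True primeideal_le_m by blast
    qed
    then show ?thesis using Suc.prems by simp
  next
    case False
    have P0: "primeideal (P 0) R" using P by (simp add: prime_chain_def)
    have gz: "gensum {\<zero>} z i \<subseteq> P 0" and xP: "x \<in> P 0"
      using add_upper[OF idg cgenideal_ideal[OF xc]] cgenideal_self[OF xc] P(2) g by blast+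
    obtain Q where Q: "Q \<in> S" "Q \<subseteq> P 0" using S(3)[OF P0 gz] by blast
    have "Q \<noteq> m" using Q False primeideal_le_m[OF P0] by blast
    then have "Q \<subset> P 0" using x(2)[OF Q(1)] xP Q by blast
    from prime_chain_shift[OF P(1) _ this] have "Suc n + i \<le> d"
      using z(2) S(2)[OF Q(1)] by fastforce
    then show ?thesis by simp
  qed
  moreover have "\<forall>j<Suc i. w j \<in> m" using z(1) x(1) by (auto simp: w_def less_Suc_eq)
  ultimately show ?case by blast
qed

text \<open>If \<open>x \<otimes> y \<in> A\<close> violates primality, \<open>R / A\<close> is an
  extension of \<open>R / (A + Rx)\<close> by \<open>R / (A : x)\<close>, and both ideals are larger
  than \<open>A\<close>. If \<open>A\<close> is prime it equals \<open>m\<close>.\<close>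

lemma finite_length_if_only_prime_m:
  assumes "ideal A R" "\<And>P. primeideal P R \<Longrightarrow> A \<subseteq> P \<Longrightarrow> P = m"
  shows "finite_length R A (carrier R)"
  using assms
proof (induction A rule: noetherian_induct)
  case (larger A)
  show ?case
  proof (cases "primeideal A R")
    case True
    then have "A = m" using larger(3) by blast
    have "len_le R m (carrier R) 1"
      unfolding len_le_def
    proof (intro allI impI, rule ccontr)
      fix K n assume K: "ideal_chain R m (carrier R) K n" and "\<not> n \<le> 1"
      then have "ideal (K 1) R" "K 0 \<subset> K 1" "K 1 \<subset> K (Suc 1)" "K (Suc 1) \<subseteq> carrier R" "K 0 = m"
        using ideal_chain_between[OF K, of 1] ideal_chain_between[OF K, of "Suc 1"] K
        unfolding ideal_chain_def by auto
      then show False using proper_ideal_le_m[of "K 1"] by blast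
    qed
    then show ?thesis using \<open>A = m\<close> finite_length_iff_len_le by blast
  next
    case False
    from ideal.primeidealCD[OF larger(1) is_cring this] show ?thesis
    proof (elim disjE exE conjE)
      assume "carrier R = A"
      then show ?thesis using len_le_refl finite_length_iff_len_le by metis
    next
      fix x y assume xy: "x \<in> carrier R" "y \<in> carrier R" "x \<otimes> y \<in> A" "x \<notin> A" "y \<notin> A"
      have idx: "ideal (A <+> PIdl x) R" "ideal (colon R A x) R"
        using add_ideals[OF larger(1) cgenideal_ideal[OF xy(1)]] colon_ideal[OF larger(1) xy(1)] by auto
      have 1: "A \<subset> A <+> PIdl x"
        using add_upper[OF larger(1) cgenideal_ideal[OF xy(1)]] cgenideal_self[OF xy(1)] xy by blast
      have "y \<in> colon R A x" using xy m_comm by (simp add: colon_def)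
      moreover have "A \<subseteq> colon R A x"
        using ideal_mult_mem[OF larger(1) _ xy(1)] m_comm[OF _ xy(1)] ideal_carr[OF larger(1)]
        by (auto simp: colon_def subset_iff)
      ultimately have 2: "A \<subset> colon R A x" using xy by blast
      obtain b1 where "len_le R (A <+> PIdl x) (carrier R) b1"
        using larger(2)[OF idx(1) 1] larger(3) 1 unfolding finite_length_iff_len_le by blast
      moreover obtain b2 where "len_le R (colon R A x) (carrier R) b2"
        using larger(2)[OF idx(2) 2] larger(3) 2 unfolding finite_length_iff_len_le by blast
      then have "len_le R A (A <+> PIdl x) b2" using cyclic_quotient_len[OF larger(1) xy(1)] by blast
      ultimately have "len_le R A (carrier R) (b2 + b1)"
        using len_le_add[OF larger(1) idx(1) oneideal] 1 ideal_carr[OF idx(1)] by blast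
      then show ?thesis using finite_length_iff_len_le by blast
    qed
  qed
qed

text \<open>The ideal \<open>q ^ k\<close> contains the \<open>k\<close>-th powers of the
  \<open>d\<close> parameters, so the bound for the ideal generated by these powers carries over to
  it.\<close>

theorem parameter_ideal:
  assumes dim: "\<And>P n. prime_chain R P n \<Longrightarrow> n \<le> d"
  shows "\<exists>q b. ideal q R \<and> q \<subseteq> m \<and> (\<forall>k. len_le R (ideal_pow R q k) (carrier R) (k ^ d * b))"
proof -
  obtain z where z: "\<And>j. j < d \<Longrightarrow> z j \<in> m"
      "\<And>P n. prime_chain R P n \<Longrightarrow> gensum {\<zero>} z d \<subseteq> P 0 \<Longrightarrow> n + d \<le> d"
    using system_of_parameters_aux[of d d] dim by blast
  have zc: "z j \<in> carrier R" if "j < d" for j using z(1)[OF that] ideal_carr[OF ideal_m] by auto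
  define q where "q = gensum {\<zero>} z d"
  have idq: "ideal q R" unfolding q_def by (rule gensum_ideal[OF zeroideal zc])
  have zq: "z j \<in> gensum {\<zero>} z k" if "j < k" "k \<le> d" for j k
    using that
  proof (induction k)
    case (Suc k)
    then have "ideal (gensum {\<zero>} z k) R" "z k \<in> carrier R" using gensum_ideal[OF zeroideal] zc by auto
    then show ?case
      using add_upper[of "gensum {\<zero>} z k" "PIdl (z k)"] cgenideal_ideal[of "z k"] cgenideal_self[of "z k"] Suc
      by (cases "j = k") auto
  qed simp
  have gle: "gensum {\<zero>} w k \<subseteq> C" if "ideal C R" "\<And>j. j < k \<Longrightarrow> w j \<in> C" for w k C
    using that(2)
  proof (induction k)
    case 0 then show ?case using ideal_zero_mem[OF that(1)] by simp
  next
    case (Suc k)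
    then show ?case using add_least[OF that(1)] cgenideal_minimal[OF that(1)] by simp
  qed
  have qm: "q \<subseteq> m" unfolding q_def by (rule gle[OF ideal_m z(1)])
  \<comment> \<open>A prime over \<open>q\<close> different from \<open>m\<close> would start the
    chain \<open>P \<subset> m\<close> of length 1, while \<open>n + d \<le> d\<close> allows only
    length 0.\<close>
  have "P = m" if P: "primeideal P R" "q \<subseteq> P" for P
  proof (rule ccontr)
    assume "P \<noteq> m"
    then have "P \<subset> m" using primeideal_le_m[OF P(1)] by blast
    then have "prime_chain R (\<lambda>i. if i = 0 then P else m) 1"
      using P(1) maximalideal_prime[OF maximal_m] by (simp add: prime_chain_def)
    then show False using z(2) P(2) unfolding q_def by fastforce
  qed
  then obtain b where b: "len_le R q (carrier R) b"
    using finite_length_if_only_prime_m[OF idq] finite_length_iff_len_le by blast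
  have "len_le R (ideal_pow R q k) (carrier R) (k ^ d * b)" for k
  proof (rule len_le_sub)
    show "len_le R (gensum {\<zero>} (\<lambda>i. z i [^] k) d) (carrier R) (k ^ d * b)"
      using len_le_gensum_power[OF zeroideal, of d z b k] zc b unfolding q_def by blast
    show "ideal (gensum {\<zero>} (\<lambda>i. z i [^] k) d) R" using zc by (intro gensum_ideal zeroideal) auto
    show "gensum {\<zero>} (\<lambda>i. z i [^] k) d \<subseteq> ideal_pow R q k"
      using power_mem_ideal_pow[OF idq] zq[of _ d] by (intro gle ideal_pow_ideal idq) (auto simp: q_def)
  qed (use oneideal in auto)
  then show ?thesis using idq qm by blast
qed

end

section \<open>Monomials in the generators and Artin-Rees\<close>

definition lex_less :: "(nat \<Rightarrow> nat) \<Rightarrow> (nat \<Rightarrow> nat) \<Rightarrow> bool" where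
  "lex_less u v \<longleftrightarrow> (\<exists>j. u j < v j \<and> (\<forall>i<j. u i = v i))"

text \<open>On exponent vectors this is multiplication of the monomial by \<open>g j\<close>; on
  multidegrees it is the corresponding unit step.\<close>

definition bump :: "nat \<Rightarrow> (nat \<Rightarrow> nat) \<Rightarrow> nat \<Rightarrow> nat" where
  "bump j u = u(j := Suc (u j))"

lemma lex_less_irrefl: "\<not> lex_less u u"
  by (simp add: lex_less_def)

lemma lex_less_trans:
  assumes "lex_less u v" "lex_less v w" shows "lex_less u w"
proof -
  obtain j where j: "u j < v j" "\<forall>i<j. u i = v i" using assms(1) by (auto simp: lex_less_def)
  obtain k where k: "v k < w k" "\<forall>i<k. v i = w i" using assms(2) by (auto simp: lex_less_def)
  have "u (min j k) < w (min j k)" using j k by (cases j k rule: linorder_cases) (auto simp: min_def)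
  moreover have "\<forall>i<min j k. u i = w i" using j k by simp
  ultimately show ?thesis by (auto simp: lex_less_def)
qed

lemma lex_less_total:
  assumes "u \<noteq> v" shows "lex_less u v \<or> lex_less v u"
proof -
  define j where "j = (LEAST j. u j \<noteq> v j)"
  have "\<exists>j. u j \<noteq> v j" using assms by auto
  then have "u j \<noteq> v j" unfolding j_def by (rule LeastI_ex)
  moreover have "\<forall>i<j. u i = v i" unfolding j_def using not_less_Least by blast
  ultimately show ?thesis unfolding lex_less_def by (metis linorder_neqE_nat)
qed

lemma lex_less_bump: "lex_less u v \<Longrightarrow> lex_less (bump j u) (bump j v)"
  unfolding lex_less_def bump_def by (metis fun_upd_other fun_upd_same Suc_less_eq)

text \<open>A nonempty initial segment of a finite set is its largest element together with the
  smaller initial segment below it.\<close>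

lemma lex_less_initial_segment_induct [consumes 1, case_names empty step]:
  assumes "finite M" "Q {}"
    and step: "\<And>u S. u \<in> M \<Longrightarrow> S = {v \<in> M. lex_less v u} \<Longrightarrow> Q S \<Longrightarrow> Q (insert u S)"
  shows "Q M"
proof -
  have "Q S" if "S \<subseteq> M" "\<And>u v. u \<in> S \<Longrightarrow> v \<in> M \<Longrightarrow> lex_less v u \<Longrightarrow> v \<in> S" for S
    using finite_subset[OF that(1) assms(1)] that
  proof (induction S rule: finite_psubset_induct)
    case (psubset S)
    show ?case
    proof (cases "S = {}")
      case False
      have "asymp_on S lex_less" "transp_on S lex_less"
        using lex_less_trans lex_less_irrefl by (auto simp: asymp_on_def transp_on_def)
      then obtain u where u: "u \<in> S" "\<forall>x\<in>S. x \<noteq> u \<longrightarrow> \<not> lex_less u x"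
        using Finite_Set.bex_max_element[OF psubset.hyps(1) _ _ False, of lex_less] by blast
      define T where "T = {v \<in> M. lex_less v u}"
      have S: "S = insert u T"
        unfolding T_def using u lex_less_total psubset.prems by blast
      have "u \<notin> T" using lex_less_irrefl by (auto simp: T_def)
      moreover have "Q T"
      proof (rule psubset.IH)
        show "T \<subset> S" using S \<open>u \<notin> T\<close> by blast
        show "T \<subseteq> M" by (auto simp: T_def)
        show "v \<in> T" if "w \<in> T" "v \<in> M" "lex_less v w" for v w using that lex_less_trans by (auto simp: T_def)
      qed
      ultimately show ?thesis using step[OF _ T_def] S u(1) psubset.prems(1) by blast
    qed (use assms in simp)
  qed
  then show ?thesis by blast
qed

lemma bump_expo: "u \<in> expo V \<Longrightarrow> j \<in> V \<Longrightarrow> bump j u \<in> expo V"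
  by (auto simp: expo_def bump_def)

lemma gdeg_bump:
  assumes "finite V" "j \<in> V"
  shows "gdeg V h (bump j u) = bump (h j) (gdeg V h u)"
proof
  fix i
  show "gdeg V h (bump j u) i = bump (h j) (gdeg V h u) i"
  proof (cases "i = h j")
    case True
    have "(\<Sum>k\<in>{k. k \<in> V \<and> h k = i} - {j}. bump j u k) = (\<Sum>k\<in>{k. k \<in> V \<and> h k = i} - {j}. u k)"
      by (intro sum.cong) (auto simp: bump_def)
    moreover have "finite {k. k \<in> V \<and> h k = i}" "j \<in> {k. k \<in> V \<and> h k = i}" using assms True by auto
    ultimately have "(\<Sum>k | k \<in> V \<and> h k = i. bump j u k) = Suc (\<Sum>k | k \<in> V \<and> h k = i. u k)"
      by (simp only: sum.remove) (simp add: bump_def)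
    then show ?thesis using True by (simp add: gdeg_def bump_def)
  next
    case False
    have "(\<Sum>k | k \<in> V \<and> h k = i. bump j u k) = (\<Sum>k | k \<in> V \<and> h k = i. u k)"
      using False by (intro sum.cong) (auto simp: bump_def)
    then show ?thesis using False by (simp add: gdeg_def bump_def)
  qed
qed

lemma mons_bump: "finite V \<Longrightarrow> j \<in> V \<Longrightarrow> u \<in> mons V h n \<Longrightarrow> bump j u \<in> mons V h (bump (h j) n)"
  by (simp add: mons_def gdeg_bump bump_expo)

lemma mons_unbump:
  assumes "finite V" "j \<in> V" "u \<in> mons V h (bump (h j) n)" "u j > 0"
  shows "\<exists>v \<in> mons V h n. u = bump j v"
proof -
  define v where "v = u(j := u j - 1)"
  have u: "u = bump j v" using assms(4) by (auto simp: v_def bump_def)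
  have "v \<in> expo V" using assms(2,3) by (auto simp: mons_def expo_def v_def)
  moreover have "bump (h j) (gdeg V h v) = bump (h j) n"
    using assms gdeg_bump[OF assms(1,2), of h v] u by (simp add: mons_def)
  then have "gdeg V h v i = n i" for i by (cases "i = h j") (auto simp: bump_def fun_eq_iff split: if_splits)
  ultimately show ?thesis using u by (auto simp: mons_def)
qed

lemma mono_by_bump:
  fixes L :: "(nat \<Rightarrow> nat) \<Rightarrow> 'a set"
  assumes V: "finite V" and step: "\<And>u j. u \<in> expo V \<Longrightarrow> j \<in> V \<Longrightarrow> L u \<subseteq> L (bump j u)"
    and "u \<in> expo V" "v \<in> expo V" "u \<le> v"
  shows "L u \<subseteq> L v"
  using assms(3-5)
proof (induction "\<Sum>j\<in>V. v j - u j" arbitrary: u)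
  case 0
  then have "v j \<le> u j" for j using V by (cases "j \<in> V") (auto simp: expo_def)
  then have "u = v" using 0 by (auto simp: le_fun_def intro!: antisym)
  then show ?case by simp
next
  case (Suc k)
  then have "(\<Sum>j\<in>V. v j - u j) \<noteq> 0" by simp
  then obtain j where j: "j \<in> V" "v j - u j \<noteq> 0" using V by auto
  have eq: "(\<Sum>i\<in>V - {j}. v i - bump j u i) = (\<Sum>i\<in>V - {j}. v i - u i)"
    by (intro sum.cong) (auto simp: bump_def)
  have "L (bump j u) \<subseteq> L v"
  proof (rule Suc.hyps(1))
    show "k = (\<Sum>i\<in>V. v i - bump j u i)"
      using Suc.hyps(2) j V eq by (simp add: sum.remove[of V j] bump_def)
    show "bump j u \<in> expo V" using bump_expo Suc.prems j by simp
    show "bump j u \<le> v" using Suc.prems(3) j by (auto simp: bump_def le_fun_def)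
  qed (use Suc.prems in auto)
  then show ?case using step[OF Suc.prems(1) j(1)] by blast
qed

context cring
begin

lemma Idl_insert:
  assumes "A \<subseteq> carrier R" "x \<in> carrier R"
  shows "Idl (insert x A) = Idl A <+> PIdl x"
proof
  have id: "ideal (Idl A) R" "ideal (PIdl x) R" using genideal_ideal[OF assms(1)] cgenideal_ideal[OF assms(2)] .
  show "Idl (insert x A) \<subseteq> Idl A <+> PIdl x"
    using genideal_minimal[OF add_ideals[OF id]] add_upper[OF id] genideal_self[OF assms(1)] cgenideal_self[OF assms(2)]
    by blast
  have "ideal (Idl (insert x A)) R" using genideal_ideal assms by auto
  moreover have "x \<in> Idl (insert x A)" "Idl A \<subseteq> Idl (insert x A)"
    using genideal_self[of "insert x A"] subset_Idl_subset[of "insert x A" A] assms by auto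
  ultimately show "Idl A <+> PIdl x \<subseteq> Idl (insert x A)"
    using add_least cgenideal_minimal by blast
qed

text \<open>The elements that \<open>y\<close> multiplies into \<open>C\<close> form the ideal
  \<open>(C : y)\<close>, so it is enough to test generators.\<close>

lemma Idl_mult_mem:
  assumes "A \<subseteq> carrier R" "ideal C R" "y \<in> carrier R" "\<And>a. a \<in> A \<Longrightarrow> a \<otimes> y \<in> C" "x \<in> Idl A"
  shows "x \<otimes> y \<in> C"
proof -
  have "A \<subseteq> colon R C y" using assms by (auto simp: colon_def)
  then have "Idl A \<subseteq> colon R C y" using genideal_minimal[OF colon_ideal[OF assms(2,3)]] by blast
  then show ?thesis using assms(5) by (auto simp: colon_def)
qed

lemma Idl_prod_Idl_le:
  assumes A: "A \<subseteq> carrier R" and B: "B \<subseteq> carrier R" and C: "ideal C R"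
    and ab: "\<And>a b. a \<in> A \<Longrightarrow> b \<in> B \<Longrightarrow> a \<otimes> b \<in> C"
  shows "(Idl A) \<cdot> (Idl B) \<subseteq> C"
proof (rule ideal_prod_least[OF C])
  fix x y assume x: "x \<in> Idl A" and y: "y \<in> Idl B"
  have xc: "x \<in> carrier R" using x ideal_carr[OF genideal_ideal[OF A]] by blast
  have yc: "y \<in> carrier R" using y ideal_carr[OF genideal_ideal[OF B]] by blast
  have "b \<otimes> x \<in> C" if b: "b \<in> B" for b
  proof -
    have "b \<in> carrier R" using B b by blast
    moreover have "x \<otimes> b \<in> C" using Idl_mult_mem[OF A C _ ab x] b B by blast
    ultimately show ?thesis using m_comm xc by metis
  qed
  then have "y \<otimes> x \<in> C" using Idl_mult_mem[OF B C xc _ y] by blast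
  then show "x \<otimes> y \<in> C" using m_comm xc yc by metis
qed

section \<open>Ideals generated by monomials and their leading coefficients\<close>

definition mon :: "nat set \<Rightarrow> (nat \<Rightarrow> 'a) \<Rightarrow> (nat \<Rightarrow> nat) \<Rightarrow> 'a" where
  "mon V g u = (\<Otimes>j\<in>V. g j [^] u j)"

lemma mon_closed: "g ` V \<subseteq> carrier R \<Longrightarrow> mon V g u \<in> carrier R"
  unfolding mon_def by (intro finprod_closed) auto

lemma mon_zero: "mon V g (\<lambda>_. 0) = \<one>"
  by (simp add: mon_def)

lemma mon_bump:
  assumes "finite V" "g ` V \<subseteq> carrier R" "j \<in> V"
  shows "mon V g (bump j u) = g j \<otimes> mon V g u"
proof -
  have gc: "g k \<in> carrier R" if "k \<in> V" for k using assms(2) that by blast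
  have gj: "g j \<in> carrier R" using gc assms(3) .
  have V: "V = insert j (V - {j})" using assms by auto
  have c: "(\<lambda>k. g k [^] w k) \<in> V - {j} \<rightarrow> carrier R" for w :: "nat \<Rightarrow> nat" using gc by auto
  have split: "mon V g w = g j [^] w j \<otimes> (\<Otimes>k\<in>V - {j}. g k [^] w k)" for w
    unfolding mon_def by (subst V, rule finprod_insert) (use assms(1) c gj in auto)
  have "(\<Otimes>k\<in>V - {j}. g k [^] bump j u k) = (\<Otimes>k\<in>V - {j}. g k [^] u k)"
    by (rule finprod_cong') (use c in \<open>auto simp: bump_def\<close>)
  moreover have "(\<Otimes>k\<in>V - {j}. g k [^] u k) \<in> carrier R" using c by (rule finprod_closed)
  ultimately show ?thesis
    unfolding split using gj nat_pow_Suc2[OF gj, of "u j"] by (simp add: bump_def m_assoc)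
qed

lemma mon_subset:
  assumes "finite V" "g ` V \<subseteq> carrier R" "X \<subseteq> V" "u \<in> expo X"
  shows "mon V g u = mon X g u"
  unfolding mon_def
  by (rule finprod_mono_neutral_cong_right) (use assms in \<open>auto simp: expo_def\<close>)

definition monid :: "nat set \<Rightarrow> (nat \<Rightarrow> 'a) \<Rightarrow> (nat \<Rightarrow> nat) set \<Rightarrow> 'a set" where
  "monid V g S = Idl (mon V g ` S)"

lemma monid_ideal: "g ` V \<subseteq> carrier R \<Longrightarrow> ideal (monid V g S) R"
  unfolding monid_def using mon_closed by (intro genideal_ideal) auto

lemma monid_mem:
  assumes "g ` V \<subseteq> carrier R" "u \<in> S" shows "mon V g u \<in> monid V g S"
proof -
  have "mon V g ` S \<subseteq> carrier R" using mon_closed[OF assms(1)] by auto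
  from genideal_self[OF this] show ?thesis unfolding monid_def using assms(2) by blast
qed

lemma monid_mono: "g ` V \<subseteq> carrier R \<Longrightarrow> S \<subseteq> T \<Longrightarrow> monid V g S \<subseteq> monid V g T"
  unfolding monid_def using mon_closed by (intro subset_Idl_subset) auto

lemma monid_insert: "g ` V \<subseteq> carrier R \<Longrightarrow> monid V g (insert u S) = monid V g S <+> PIdl (mon V g u)"
  unfolding monid_def image_insert by (intro Idl_insert) (use mon_closed in auto)

text \<open>These exponents generate the ideal K_{<u}; only vectors of the multidegree of
  \<open>u\<close> are compared with it.\<close>

definition below :: "nat set \<Rightarrow> (nat \<Rightarrow> nat) \<Rightarrow> (nat \<Rightarrow> nat) \<Rightarrow> (nat \<Rightarrow> nat) set" where
  "below V h u = {v \<in> mons V h (gdeg V h u). lex_less v u}"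

lemma mult_below:
  assumes "finite V" "g ` V \<subseteq> carrier R" "j \<in> V" "x \<in> monid V g (below V h u)"
  shows "g j \<otimes> x \<in> monid V g (below V h (bump j u))"
proof -
  have gj: "g j \<in> carrier R" using assms by auto
  have mc: "mon V g v \<in> carrier R" for v using mon_closed assms by simp
  have "x \<otimes> g j \<in> monid V g (below V h (bump j u))"
  proof (rule Idl_mult_mem[OF _ monid_ideal[OF assms(2)] gj])
    show "x \<in> Idl (mon V g ` below V h u)" using assms(4) by (simp add: monid_def)
    fix a assume "a \<in> mon V g ` below V h u"
    then obtain v where v: "v \<in> below V h u" "a = mon V g v" by auto
    then have "bump j v \<in> below V h (bump j u)"
      using mons_bump[OF assms(1,3)] lex_less_bump gdeg_bump[OF assms(1,3)] by (simp add: below_def)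
    then have "mon V g (bump j v) \<in> monid V g (below V h (bump j u))" using monid_mem assms by blast
    then show "a \<otimes> g j \<in> monid V g (below V h (bump j u))"
      using mon_bump[OF assms(1-3)] v m_comm[OF mc gj] by simp
  qed (use mc in auto)
  moreover have "x \<in> carrier R" using assms(4) ideal_carr[OF monid_ideal[OF assms(2)]] by blast
  ultimately show ?thesis using m_comm gj by metis
qed

end

text \<open>Here \<open>L u\<close> is the ideal of leading coefficients at \<open>u\<close>, where the leading monomial is the
  lexicographically largest one. For \<open>W = 0\<close> it is the annihilator of the cyclic quotient at \<open>u\<close>.\<close>

lemma (in noetherian_cring) leading_coefficients_cap:
  assumes V: "finite V" and g: "g ` V \<subseteq> carrier R"
    and W: "\<And>n. ideal (W n) R" "\<And>n j w. j \<in> V \<Longrightarrow> w \<in> W n \<Longrightarrow> g j \<otimes> w \<in> W (bump (h j) n)"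
  defines "L \<equiv> \<lambda>u. colon R (W (gdeg V h u) <+> monid V g (below V h u)) (mon V g u)"
  shows "\<exists>c. \<forall>c'\<ge>c. \<forall>u\<in>expo V. L u = L (cap c' u)"
proof (rule monotone_map_determined_by_cap[OF V, where S="{I. ideal I R}"])
  have idB: "ideal (monid V g S) R" for S using monid_ideal[OF g] .
  have mc: "mon V g u \<in> carrier R" for u using mon_closed[OF g] .
  have idL: "ideal (L u) R" for u unfolding L_def by (intro colon_ideal add_ideals W idB mc)
  then show "L u \<in> {I. ideal I R}" for u by simp
  show "\<exists>K. \<forall>k\<ge>K. f k = f K" if "\<And>k::nat. f k \<in> {I. ideal I R}" "\<And>k. f k \<subseteq> f (Suc k)" for f
    using ascending_chain_stabilizes that by blast
  have step: "L u \<subseteq> L (bump j u)" if u: "u \<in> expo V" and j: "j \<in> V" for u j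
  proof
    fix x assume "x \<in> L u"
    then have x: "x \<in> carrier R" "x \<otimes> mon V g u \<in> W (gdeg V h u) <+> monid V g (below V h u)"
      by (auto simp: L_def colon_def)
    then obtain w b where wb: "w \<in> W (gdeg V h u)" "b \<in> monid V g (below V h u)" "x \<otimes> mon V g u = w \<oplus> b"
      unfolding set_add_iff by blast
    have car: "g j \<in> carrier R" "w \<in> carrier R" "b \<in> carrier R"
      using j g wb ideal_carr[OF W(1)] ideal_carr[OF idB] by blast+
    have "x \<otimes> mon V g (bump j u) = g j \<otimes> (x \<otimes> mon V g u)"
      using mon_bump[OF V g j] x(1) car mc m_lcomm by simp
    also have "\<dots> = g j \<otimes> w \<oplus> g j \<otimes> b" using wb(3) car by (simp add: r_distr)
    finally have "x \<otimes> mon V g (bump j u) = g j \<otimes> w \<oplus> g j \<otimes> b" .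
    moreover have "g j \<otimes> w \<in> W (gdeg V h (bump j u))" using W(2)[OF j wb(1)] gdeg_bump[OF V j] by simp
    moreover have "g j \<otimes> b \<in> monid V g (below V h (bump j u))" using mult_below[OF V g j wb(2)] .
    ultimately show "x \<in> L (bump j u)" using x(1) unfolding L_def colon_def set_add_iff by blast
  qed
  show "L u \<subseteq> L v" if "u \<in> expo V" "v \<in> expo V" "u \<le> v" for u v
    using mono_by_bump[OF V step that] by blast
qed

text \<open>\<open>W\<close> is a graded submodule of the multigraded Rees algebra, and the claim
  bounds the degrees of its generators in each direction. It is proved as in Groebner basis theory:
  elements of \<open>W (bump i n)\<close> are reduced along initial segments of monomials,
  cancelling one leading term at a time.\<close>

lemma (in noetherian_cring) multigraded_artin_rees_generators:
  assumes V: "finite V" and g: "g ` V \<subseteq> carrier R"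
    and W: "\<And>n. ideal (W n) R" "\<And>n j w. j \<in> V \<Longrightarrow> w \<in> W n \<Longrightarrow> g j \<otimes> w \<in> W (bump (h j) n)"
      "\<And>n. (\<forall>i\<ge>r. n i = 0) \<Longrightarrow> W n \<subseteq> monid V g (mons V h n)"
  shows "\<exists>N. \<forall>n i. i < r \<longrightarrow> (\<forall>i<r. N \<le> n i) \<longrightarrow> (\<forall>i\<ge>r. n i = 0) \<longrightarrow>
     W (bump i n) \<subseteq> (Idl (g ` {j \<in> V. h j = i})) \<cdot> W n"
proof -
  have idB: "ideal (monid V g S) R" for S using monid_ideal[OF g] .
  have mc: "mon V g u \<in> carrier R" for u using mon_closed[OF g] .
  define L where "L u = colon R (W (gdeg V h u) <+> monid V g (below V h u)) (mon V g u)" for u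
  obtain c where c: "\<And>u. u \<in> expo V \<Longrightarrow> L u = L (cap c u)"
    using leading_coefficients_cap[OF V g W(1,2)] unfolding L_def by blast
  have "W (bump i n) \<subseteq> (Idl (g ` {j \<in> V. h j = i})) \<cdot> W n"
    if i: "i < r" and n: "\<forall>i<r. c * card V \<le> n i" "\<forall>i\<ge>r. n i = 0" for n i
  proof -
    let ?J = "Idl (g ` {j \<in> V. h j = i})" and ?n = "bump i n"
    have gJ: "g ` {j \<in> V. h j = i} \<subseteq> carrier R" using g by auto
    have idJ: "ideal ?J R" using genideal_ideal[OF gJ] .
    have idT: "ideal (?J \<cdot> W n) R" using ideal_prod_is_ideal[OF idJ W(1)] .
    have "W ?n \<inter> monid V g (mons V h ?n) \<subseteq> ?J \<cdot> W n"
      using finite_mons[OF V, of h ?n]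
    proof (induction rule: lex_less_initial_segment_induct)
      case empty
      have "monid V g {} = {\<zero>}" unfolding monid_def
        using genideal_minimal[OF zeroideal, of "{}"] ideal_zero_mem[OF genideal_ideal[of "{}"]] by auto
      then show ?case using ideal_zero_mem[OF idT] by auto
    next
      case (step u S)
      have ue: "u \<in> expo V" and gu: "gdeg V h u = ?n" using step(1) by (auto simp: mons_def)
      have S: "S = below V h u" using step(2) gu by (simp add: below_def)
      \<comment> \<open>An exponent beyond the cap can be lowered without changing the ideal of leading
        coefficients, so the leading term of an element of \<open>W ?n\<close> is cancelled by \<open>J\<^sub>i W n\<close>.\<close>
      have "\<exists>j\<in>V. h j = i \<and> u j > c"
      proof (rule ccontr)
        assume "\<not> ?thesis"
        then have "gdeg V h u i \<le> (\<Sum>j | j \<in> V \<and> h j = i. c)"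
          unfolding gdeg_def by (intro sum_mono) (auto simp: not_less)
        also have "\<dots> \<le> c * card V" using V by (auto intro: card_mono)
        finally show False using n(1) i gu by (auto simp: bump_def)
      qed
      then obtain j where j: "j \<in> V" "h j = i" "u j > c" by blast
      obtain v where v: "v \<in> mons V h n" "u = bump j v"
        using mons_unbump[OF V j(1), of u h n] step(1) j by auto
      have gj: "g j \<in> carrier R" using g j by auto
      have ve: "v \<in> expo V" and gv: "gdeg V h v = n" using v by (auto simp: mons_def)
      have "cap c u = cap c v" using j(3) v(2) by (auto simp: cap_def bump_def)
      then have Luv: "L u = L v" using c[OF ue] c[OF ve] by simp
      show ?case
      proof
        fix x assume "x \<in> W ?n \<inter> monid V g (insert u S)"
        then have xW: "x \<in> W ?n" and "x \<in> monid V g S <+> PIdl (mon V g u)"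
          using monid_insert[OF g] by auto
        then obtain b s where bs: "b \<in> monid V g S" "s \<in> carrier R" "x = b \<oplus> s \<otimes> mon V g u"
          unfolding mem_add_cgenideal by blast
        have bc: "b \<in> carrier R" and xc: "x \<in> carrier R"
          using bs(1) ideal_carr[OF idB] xW ideal_carr[OF W(1)] by blast+
        have "s \<otimes> mon V g u = x \<ominus> b" using bs bc mc add_minus_cancel[of b "s \<otimes> mon V g u"] by simp
        also have "\<dots> = x \<oplus> \<ominus> b" by (simp add: a_minus_def)
        finally have "s \<otimes> mon V g u = x \<oplus> \<ominus> b" .
        moreover have "\<ominus> b \<in> monid V g S"
          using ideal_minus_mem[OF idB ideal_zero_mem[OF idB] bs(1)] bc by (simp add: a_minus_def)
        \<comment> \<open>The leading coefficient \<open>s\<close> of \<open>x\<close> is in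
          \<open>L u\<close> because its leading term is \<open>x \<ominus> b\<close>, with
          \<open>x \<in> W ?n\<close> and \<open>b\<close> built from smaller monomials.\<close>
        ultimately have "s \<in> L u" unfolding L_def colon_def set_add_iff using xW bs(2) gu S by auto
        then have "s \<otimes> mon V g v \<in> W n <+> monid V g (below V h v)"
          unfolding Luv by (simp add: L_def colon_def gv)
        then obtain w b' where wb: "w \<in> W n" "b' \<in> monid V g (below V h v)" "s \<otimes> mon V g v = w \<oplus> b'"
          unfolding set_add_iff by blast
        have wc: "w \<in> carrier R" "b' \<in> carrier R" using wb ideal_carr[OF W(1)] ideal_carr[OF idB] by blast+
        have gb: "g j \<otimes> b' \<in> monid V g S" using mult_below[OF V g j(1) wb(2)] v(2) S by simp
        have gw: "g j \<otimes> w \<in> W ?n" using W(2)[OF j(1) wb(1)] j(2) by simp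
        have "s \<otimes> mon V g u = g j \<otimes> (s \<otimes> mon V g v)"
          using mon_bump[OF V g j(1)] v(2) bs(2) gj mc m_lcomm by simp
        also have "\<dots> = g j \<otimes> w \<oplus> g j \<otimes> b'" using wb(3) gj wc by (simp add: r_distr)
        finally have "x = g j \<otimes> w \<oplus> (b \<oplus> g j \<otimes> b')" using bs(3) gj wc bc by (simp add: a_ac)
        \<comment> \<open>The remainder \<open>y = x \<ominus> g j \<otimes> w\<close> is still in
          \<open>W ?n\<close> and involves only monomials from \<open>S\<close>, so the induction
          hypothesis applies to it.\<close>
        moreover define y where "y = b \<oplus> g j \<otimes> b'"
        ultimately have xy: "x = g j \<otimes> w \<oplus> y" by simp
        have yc: "y \<in> carrier R" unfolding y_def using gj wc bc by simp
        have "y = x \<ominus> g j \<otimes> w" using add_minus_cancel[of "g j \<otimes> w" y] xy yc gj wc by simp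
        then have "y \<in> W ?n" using ideal_minus_mem[OF W(1) xW gw] by simp
        moreover have "y \<in> monid V g S" unfolding y_def using ideal_add_mem[OF idB bs(1) gb] .
        ultimately have "y \<in> ?J \<cdot> W n" using step(3) by blast
        moreover have "g j \<in> ?J" using genideal_self[OF gJ] j by blast
        then have "g j \<otimes> w \<in> ?J \<cdot> W n" using ideal_prod_mem wb(1) by blast
        ultimately show "x \<in> ?J \<cdot> W n" using xy ideal_add_mem[OF idT] by simp
      qed
    qed
    moreover have "W ?n \<subseteq> monid V g (mons V h ?n)" using W(3)[of ?n] n(2) i by (simp add: bump_def)
    ultimately show ?thesis by blast
  qed
  then show ?thesis by blast
qed

context cring
begin

section \<open>Products of powers of several ideals\<close>

lemma multi_pow_ideal:
  assumes "\<And>i. i < r \<Longrightarrow> ideal (J i) R" shows "ideal (ideal_multi_pow R r J n) R"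
proof -
  have "ideal (foldr (\<lambda>i A. ideal_pow R (J i) (n i) \<cdot> A) xs (carrier R)) R" if "set xs \<subseteq> {..<r}" for xs
    using that by (induction xs) (auto simp: oneideal intro!: ideal_prod_is_ideal ideal_pow_ideal assms)
  then show ?thesis unfolding ideal_multi_pow_def by (simp add: lessThan_atLeast0)
qed

lemma multi_pow_cong:
  assumes "\<And>i. i < r \<Longrightarrow> J i = J' i" "\<And>i. i < r \<Longrightarrow> n i = n' i"
  shows "ideal_multi_pow R r J n = ideal_multi_pow R r J' n'"
  unfolding ideal_multi_pow_def using assms by (intro foldr_cong) auto

lemma multi_pow_bump:
  assumes J: "\<And>i. i < r \<Longrightarrow> ideal (J i) R" and i: "i < r"
  shows "ideal_multi_pow R r J (bump i n) = J i \<cdot> ideal_multi_pow R r J n"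
proof -
  let ?F = "\<lambda>n xs. foldr (\<lambda>i A. ideal_pow R (J i) (n i) \<cdot> A) xs (carrier R)"
  have id: "ideal (?F n xs) R" if "set xs \<subseteq> {..<r}" for xs n
    using that by (induction xs) (auto simp: oneideal intro!: ideal_prod_is_ideal ideal_pow_ideal J)
  have 1: "?F (bump i n) xs = ?F n xs" if "i \<notin> set xs" for xs
    using that by (intro foldr_cong) (auto simp: bump_def)
  have "?F (bump i n) xs = J i \<cdot> ?F n xs" if "distinct xs" "i \<in> set xs" "set xs \<subseteq> {..<r}" for xs
    using that
  proof (induction xs)
    case (Cons k xs)
    have ids: "ideal (J i) R" "ideal (ideal_pow R (J k) (n k)) R" "ideal (?F n xs) R"
      using J[OF i] ideal_pow_ideal[OF J] id[of xs] Cons.prems by auto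
    show ?case
    proof (cases "k = i")
      case True
      then have "?F (bump i n) xs = ?F n xs" using 1 Cons.prems by simp
      then show ?thesis using True ideal_prod_assoc[OF ids] by (simp add: bump_def ideal_pow_Suc)
    next
      case False
      then have "?F (bump i n) xs = J i \<cdot> ?F n xs" using Cons by auto
      then show ?thesis using False ideal_prod_left_commute[OF ids(2,1,3)] by (simp add: bump_def)
    qed
  qed simp
  then show ?thesis unfolding ideal_multi_pow_def using i by (simp add: lessThan_atLeast0)
qed

lemma multi_pow_zero:
  assumes "\<And>i. i < r \<Longrightarrow> n i = 0"
  shows "ideal_multi_pow R r J n = carrier R"
proof -
  have "foldr (\<lambda>i A. ideal_pow R (J i) (n i) \<cdot> A) xs (carrier R) = carrier R" if "set xs \<subseteq> {..<r}" for xs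
    using that assms by (induction xs) (auto simp: ideal_pow_0 ideal_prod_one oneideal)
  then show ?thesis unfolding ideal_multi_pow_def by (simp add: lessThan_atLeast0)
qed

lemma multi_pow_bump_le:
  assumes "\<And>i. i < r \<Longrightarrow> ideal (J i) R" "i < r"
  shows "ideal_multi_pow R r J (bump i n) \<subseteq> ideal_multi_pow R r J n"
proof -
  have "ideal (J i) R" "ideal (ideal_multi_pow R r J n) R" using assms multi_pow_ideal[of r J n] by auto
  then show ?thesis using multi_pow_bump[of r J i n] assms ideal_prod_lower(2) by auto
qed

lemma exponent_induct [case_names zero bump]:
  assumes "\<And>n. (\<And>i. i < r \<Longrightarrow> n i = 0) \<Longrightarrow> Q n" "\<And>n i. i < r \<Longrightarrow> Q n \<Longrightarrow> Q (bump i n)"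
  shows "Q n"
proof (induction "\<Sum>i<r. n i" arbitrary: n)
  case 0
  then show ?case using assms(1) by auto
next
  case (Suc k)
  then have "(\<Sum>i<r. n i) \<noteq> 0" by linarith
  then obtain i where i: "i < r" "n i \<noteq> 0" by (metis lessThan_iff sum.neutral)
  define n' where "n' = n(i := n i - 1)"
  have n: "n = bump i n'" using i by (auto simp: n'_def bump_def)
  have "(\<Sum>j\<in>{..<r} - {i}. n' j) = (\<Sum>j\<in>{..<r} - {i}. n j)"
    by (intro sum.cong) (auto simp: n'_def)
  then have "k = (\<Sum>i<r. n' i)" using Suc.hyps(2) i by (simp add: sum.remove[of "{..<r}" i] n'_def)
  then show ?case using Suc.hyps(1) assms(2)[OF i(1)] n by metis
qed

text \<open>\<open>mons\<close> compares multidegrees at every index while the powers only see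
  indices below \<open>r\<close>, hence the condition that \<open>n\<close> vanishes from
  \<open>r\<close> on.\<close>

lemma multi_pow_eq_monid:
  assumes V: "finite V" and g: "g ` V \<subseteq> carrier R" and h: "h ` V \<subseteq> {..<r}"
    and J: "\<And>i. i < r \<Longrightarrow> J i = Idl (g ` {j \<in> V. h j = i})"
  shows "(\<forall>i\<ge>r. n i = 0) \<Longrightarrow> ideal_multi_pow R r J n = monid V g (mons V h n)"
proof (induction n rule: exponent_induct[where r=r])
  case (zero n)
  then have n: "n = (\<lambda>_. 0)" by (auto simp: fun_eq_iff) (metis not_le)
  have "mons V h n = {\<lambda>_. 0}"
  proof (intro equalityI subsetI)
    fix u assume u: "u \<in> mons V h n"
    have "u j = 0" for j
    proof (cases "j \<in> V")
      case True
      have "gdeg V h u (h j) = 0" using u n by (simp add: mons_def)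
      then show ?thesis using True V by (simp add: gdeg_def)
    qed (use u in \<open>simp add: mons_def expo_def\<close>)
    then show "u \<in> {\<lambda>_. 0}" by auto
  qed (auto simp: n mons_def expo_def gdeg_def)
  then show ?case using zero(1) by (simp add: multi_pow_zero monid_def mon_zero genideal_one)
next
  case (bump n i)
  have idJ: "\<And>i. i < r \<Longrightarrow> ideal (J i) R" using J g by (auto intro!: genideal_ideal)
  have n: "\<forall>i\<ge>r. n i = 0" using bump by (auto simp: bump_def split: if_splits)
  have mc: "mon V g u \<in> carrier R" for u using mon_closed[OF g] .
  have gi: "g ` {j \<in> V. h j = i} \<subseteq> carrier R" using g by auto
  have "J i \<cdot> monid V g (mons V h n) = monid V g (mons V h (bump i n))"
  proof
    show "J i \<cdot> monid V g (mons V h n) \<subseteq> monid V g (mons V h (bump i n))"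
      unfolding J[OF bump(1)] monid_def[of V g "mons V h n"]
    proof (rule Idl_prod_Idl_le[OF gi _ monid_ideal[OF g]])
      fix a b assume "a \<in> g ` {j \<in> V. h j = i}" "b \<in> mon V g ` mons V h n"
      then obtain j u where "j \<in> V" "h j = i" "a = g j" "u \<in> mons V h n" "b = mon V g u" by auto
      then show "a \<otimes> b \<in> monid V g (mons V h (bump i n))"
        using mon_bump[OF V g, of j u] monid_mem[OF g mons_bump[OF V, of j u h n]] by simp
    qed (use mc in auto)
    have idp: "ideal (J i \<cdot> monid V g (mons V h n)) R" using ideal_prod_is_ideal[OF idJ[OF bump(1)] monid_ideal[OF g]] .
    show "monid V g (mons V h (bump i n)) \<subseteq> J i \<cdot> monid V g (mons V h n)"
      unfolding monid_def[of V g "mons V h (bump i n)"]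
    proof (rule genideal_minimal[OF idp], rule image_subsetI)
      fix u assume u: "u \<in> mons V h (bump i n)"
      have "gdeg V h u i = Suc (n i)" using u by (simp add: mons_def bump_def)
      then have "(\<Sum>j | j \<in> V \<and> h j = i. u j) \<noteq> 0" by (simp only: gdeg_def)
      then have "\<exists>j\<in>{j. j \<in> V \<and> h j = i}. u j \<noteq> 0" by (meson sum.neutral)
      then obtain j where j: "j \<in> V" "h j = i" "u j \<noteq> 0" by blast
      obtain v where v: "v \<in> mons V h n" "u = bump j v"
        using mons_unbump[OF V j(1), of u h n] u j by auto
      have "g j \<in> J i" using genideal_self[OF gi] j J[OF bump(1)] by blast
      then show "mon V g u \<in> J i \<cdot> monid V g (mons V h n)"
        unfolding v(2) mon_bump[OF V g j(1)] using ideal_prod_mem monid_mem[OF g v(1)] by blast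
    qed
  qed
  then show ?case using multi_pow_bump[of r J i n] idJ bump(1,2) n by simp
qed

end

lemma (in noetherian_cring) finite_generator_family:
  fixes r :: nat
  assumes "\<And>i. i < r \<Longrightarrow> ideal (J i) R"
  shows "\<exists>p g h. g ` {..<p} \<subseteq> carrier R \<and> h ` {..<p} \<subseteq> {..<r} \<and> (\<forall>i<r. J i = Idl (g ` {j \<in> {..<p::nat}. h j = i}))"
proof -
  have "\<exists>A. i < r \<longrightarrow> A \<subseteq> carrier R \<and> finite A \<and> J i = Idl A" for i
    using finetely_gen[of "J i"] assms[of i] by blast
  then obtain A where A: "\<And>i. i < r \<Longrightarrow> A i \<subseteq> carrier R \<and> finite (A i) \<and> J i = Idl (A i)" by metis
  define X where "X = Sigma {..<r} A"
  have Af: "finite (A i)" "A i \<subseteq> carrier R" if "i < r" for i using A[OF that] by auto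
  have "finite X" unfolding X_def using Af by (intro finite_SigmaI) auto
  then obtain b where b: "bij_betw b {0..<card X} X" using ex_bij_betw_nat_finite by blast
  then have bX: "b ` {..<card X} = X" by (simp add: bij_betw_def lessThan_atLeast0)
  have "(snd \<circ> b) ` {j \<in> {..<card X}. (fst \<circ> b) j = i} = A i" if "i < r" for i
  proof (intro equalityI subsetI)
    fix a assume "a \<in> A i"
    then have "(i, a) \<in> b ` {..<card X}" using that bX by (auto simp: X_def)
    then obtain j where "j < card X" "b j = (i, a)" by auto
    then show "a \<in> (snd \<circ> b) ` {j \<in> {..<card X}. (fst \<circ> b) j = i}" by force
  next
    fix a assume "a \<in> (snd \<circ> b) ` {j \<in> {..<card X}. (fst \<circ> b) j = i}"
    then obtain j where "j < card X" "fst (b j) = i" "a = snd (b j)" by auto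
    then have "(i, a) \<in> X" using bX by (metis imageI lessThan_iff prod.collapse)
    then show "a \<in> A i" by (simp add: X_def)
  qed
  moreover have "fst x < r" "snd x \<in> carrier R" if "x \<in> X" for x
    using that Af(2)[of "fst x"] by (auto simp: X_def)
  then have "(snd \<circ> b) ` {..<card X} \<subseteq> carrier R" "(fst \<circ> b) ` {..<card X} \<subseteq> {..<r}"
    unfolding image_comp[symmetric] bX by auto
  ultimately show ?thesis
    using A by (intro exI[of _ "card X"] exI[of _ "snd \<circ> b"] exI[of _ "fst \<circ> b"]) auto
qed

text \<open>Removing the generators from the statement allows a further ideal to be adjoined to the
  family later on.\<close>

theorem (in noetherian_cring) multigraded_artin_rees:
  assumes J: "\<And>i. i < r \<Longrightarrow> ideal (J i) R"
    and W: "\<And>n. ideal (W n) R" "\<And>n. W n \<subseteq> ideal_multi_pow R r J n"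
      "\<And>n i. i < r \<Longrightarrow> J i \<cdot> W n \<subseteq> W (bump i n)"
  shows "\<exists>N. \<forall>n i. i < r \<longrightarrow> (\<forall>i<r. N \<le> n i) \<longrightarrow> (\<forall>i\<ge>r. n i = 0) \<longrightarrow> W (bump i n) \<subseteq> J i \<cdot> W n"
proof -
  have ex: "\<exists>p g h. g ` {..<p::nat} \<subseteq> carrier R \<and> h ` {..<p} \<subseteq> {..<r} \<and>
      (\<forall>i<r. J i = Idl (g ` {j \<in> {..<p}. h j = i}))"
    by (rule finite_generator_family) (rule J)
  obtain p g h where gh: "g ` {..<p::nat} \<subseteq> carrier R \<and> h ` {..<p} \<subseteq> {..<r} \<and>
      (\<forall>i<r. J i = Idl (g ` {j \<in> {..<p}. h j = i}))"
    using ex by (elim exE) (rule that)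
  then have g: "g ` {..<p} \<subseteq> carrier R" and h: "h ` {..<p} \<subseteq> {..<r}"
    and Jg: "\<And>i. i < r \<Longrightarrow> J i = Idl (g ` {j \<in> {..<p}. h j = i})" by auto
  have "\<exists>N. \<forall>n i. i < r \<longrightarrow> (\<forall>i<r. N \<le> n i) \<longrightarrow> (\<forall>i\<ge>r. n i = 0) \<longrightarrow>
     W (bump i n) \<subseteq> (Idl (g ` {j \<in> {..<p}. h j = i})) \<cdot> W n"
  proof (rule multigraded_artin_rees_generators[OF finite_lessThan g W(1)])
    fix n j w assume j: "j \<in> {..<p}" and w: "w \<in> W n"
    have "h j < r" using j h by auto
    moreover have "g j \<in> J (h j)"
      unfolding Jg[OF \<open>h j < r\<close>] using genideal_self[of "g ` {k \<in> {..<p}. h k = h j}"] g j by blast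
    ultimately show "g j \<otimes> w \<in> W (bump (h j) n)" using W(3) ideal_prod_mem w by blast
  next
    show "W n \<subseteq> monid {..<p} g (mons {..<p} h n)" if "\<forall>i\<ge>r. n i = 0" for n
      using W(2)[of n] multi_pow_eq_monid[OF finite_lessThan g h Jg that] by simp
  qed
  then show ?thesis using Jg by simp
qed

section \<open>The length of quotients of powers\<close>

context cring
begin

lemma multi_pow_Suc:
  assumes "\<And>i. i < Suc r \<Longrightarrow> ideal (J i) R"
  shows "ideal_multi_pow R (Suc r) J n = ideal_pow R (J r) (n r) \<cdot> ideal_multi_pow R r J n"
proof -
  have id: "ideal (ideal_pow R (J r) k) R" "ideal (ideal_multi_pow R r J m) R" for k m
    using assms ideal_pow_ideal multi_pow_ideal[of r J] by auto
  show ?thesis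
  proof (induction n rule: exponent_induct[where r="Suc r"])
    case (zero n)
    then show ?case by (simp add: multi_pow_zero ideal_pow_0 ideal_prod_one oneideal)
  next
    case (bump n i)
    have Ji: "ideal (J i) R" using assms bump by simp
    have "ideal_multi_pow R (Suc r) J (bump i n) = J i \<cdot> (ideal_pow R (J r) (n r) \<cdot> ideal_multi_pow R r J n)"
      using multi_pow_bump[of "Suc r" J i n] assms bump by simp
    also have "\<dots> = ideal_pow R (J r) (bump i n r) \<cdot> ideal_multi_pow R r J (bump i n)"
    proof (cases "i = r")
      case True
      have "ideal_multi_pow R r J (bump i n) = ideal_multi_pow R r J n"
        using True by (intro multi_pow_cong) (auto simp: bump_def)
      then show ?thesis using True ideal_prod_assoc[OF Ji id] by (simp add: bump_def ideal_pow_Suc)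
    next
      case False
      then have "ideal_multi_pow R r J (bump i n) = J i \<cdot> ideal_multi_pow R r J n"
        using multi_pow_bump[of r J i n] assms bump by simp
      then show ?thesis using False ideal_prod_left_commute[OF Ji id] by (simp add: bump_def)
    qed
    finally show ?case .
  qed
qed

lemma multi_pow_mono:
  assumes "\<And>i. i < r \<Longrightarrow> ideal (I i) R" "\<And>i. i < r \<Longrightarrow> ideal (J i) R" "\<And>i. i < r \<Longrightarrow> I i \<subseteq> J i"
  shows "ideal_multi_pow R r I n \<subseteq> ideal_multi_pow R r J n"
proof (induction n rule: exponent_induct[where r=r])
  case (zero n)
  then show ?case by (simp add: multi_pow_zero)
next
  case (bump n i)
  then show ?case
    using multi_pow_bump[of r I i n] multi_pow_bump[of r J i n] assms ideal_prod_mono[of "I i" "J i"] by simp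
qed

text \<open>Each factor \<open>J i\<close> uses up \<open>c\<close> powers of \<open>q\<close> to
  become a factor \<open>I i\<close>.\<close>

lemma pow_mult_multi_pow_le:
  assumes q: "ideal q R" and I: "\<And>i. i < r \<Longrightarrow> ideal (I i) R" and J: "\<And>i. i < r \<Longrightarrow> ideal (J i) R"
    and le: "\<And>i. i < r \<Longrightarrow> ideal_pow R q c \<cdot> J i \<subseteq> I i"
  shows "ideal_pow R q (c * (\<Sum>i<r. n i)) \<cdot> ideal_multi_pow R r J n \<subseteq> ideal_multi_pow R r I n"
proof (induction n rule: exponent_induct[where r=r])
  case (zero n)
  then show ?case by (simp add: multi_pow_zero ideal_pow_0 ideal_prod_one oneideal)
next
  case (bump n i)
  let ?s = "\<Sum>i<r. n i"
  have id: "ideal (ideal_pow R q k) R" "ideal (ideal_multi_pow R r J n) R" for k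
    using ideal_pow_ideal[OF q] multi_pow_ideal[of r J] J by auto
  have Ji: "ideal (J i) R" using J bump by simp
  have idm: "ideal (ideal_pow R q (c * ?s) \<cdot> ideal_multi_pow R r J n) R" using ideal_prod_is_ideal[OF id] .
  have "(\<Sum>j\<in>{..<r} - {i}. bump i n j) = (\<Sum>j\<in>{..<r} - {i}. n j)" by (intro sum.cong) (auto simp: bump_def)
  then have s: "(\<Sum>j<r. bump i n j) = Suc ?s"
    using bump(1) by (simp add: sum.remove[of "{..<r}" i] bump_def)
  have "ideal_pow R q (c * Suc ?s) \<cdot> ideal_multi_pow R r J (bump i n) =
      (ideal_pow R q c \<cdot> ideal_pow R q (c * ?s)) \<cdot> (J i \<cdot> ideal_multi_pow R r J n)"
    using multi_pow_bump[of r J i n] J bump ideal_pow_add[OF q, of c "c * ?s"] by simp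
  also have "\<dots> = ideal_pow R q c \<cdot> (J i \<cdot> (ideal_pow R q (c * ?s) \<cdot> ideal_multi_pow R r J n))"
    using ideal_prod_assoc[OF id(1) id(1) ideal_prod_is_ideal[OF Ji id(2)]]
      ideal_prod_left_commute[OF id(1) Ji id(2)] by simp
  also have "\<dots> = (ideal_pow R q c \<cdot> J i) \<cdot> (ideal_pow R q (c * ?s) \<cdot> ideal_multi_pow R r J n)"
    by (rule ideal_prod_assoc[OF id(1) Ji idm, symmetric])
  also have "\<dots> \<subseteq> I i \<cdot> ideal_multi_pow R r I n" by (rule ideal_prod_mono[OF le[OF bump(1)] bump(2)])
  also have "\<dots> = ideal_multi_pow R r I (bump i n)" using multi_pow_bump[of r I i n] I bump by simp
  finally show ?case unfolding s .
qed

text \<open>Add the generators one by one to \<open>a \<cdot> (Idl S)\<close>. Every step is a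
  cyclic quotient annihilated by \<open>a\<close>, so its length is at most
  \<open>b\<close>.\<close>

lemma len_le_mult_finitely_generated:
  assumes a: "ideal a R" "len_le R a (carrier R) b" and S: "finite S" "S \<subseteq> carrier R"
  shows "len_le R (a \<cdot> (Idl S)) (Idl S) (card S * b)"
proof -
  let ?E = "Idl S"
  have idE: "ideal ?E R" using genideal_ideal[OF S(2)] .
  have idaE: "ideal (a \<cdot> ?E) R" using ideal_prod_is_ideal[OF a(1) idE] .
  have "len_le R (a \<cdot> ?E) (a \<cdot> ?E <+> Idl T) (card T * b)" if "finite T" "T \<subseteq> S" for T
    using that
  proof (induction T rule: finite_induct)
    case empty
    have "Idl {} \<subseteq> a \<cdot> ?E" using genideal_minimal[OF idaE] by blast
    then have "a \<cdot> ?E <+> Idl {} = a \<cdot> ?E" using ideal_add_absorb[OF idaE genideal_ideal[of "{}"]] by simp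
    then show ?case using len_le_refl by simp
  next
    case (insert u T)
    have T: "T \<subseteq> carrier R" "T \<subseteq> S" and u: "u \<in> carrier R" "u \<in> ?E"
      using insert.prems S(2) genideal_self[OF S(2)] by auto
    let ?B = "a \<cdot> ?E <+> Idl T"
    have idT: "ideal (Idl T) R" using genideal_ideal[OF T(1)] .
    have idP: "ideal (PIdl u) R" using cgenideal_ideal[OF u(1)] .
    have idB: "ideal ?B R" using add_ideals[OF idaE idT] .
    have "len_le R ?B (?B <+> PIdl u) b"
    proof (rule len_le_colon_step[OF a(1) idB u(1) _ a(2)])
      fix x assume "x \<in> a"
      then show "x \<otimes> u \<in> ?B" using ideal_prod_mem[of x a u ?E] u add_upper[OF idaE idT] by blast
    qed
    then have "len_le R (a \<cdot> ?E) (?B <+> PIdl u) (card T * b + b)"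
      using insert.IH T(2) add_upper[OF idaE idT] add_upper[OF idB idP]
        len_le_add[OF idaE idB add_ideals[OF idB idP]] by blast
    moreover have "?B <+> PIdl u = a \<cdot> ?E <+> Idl (insert u T)"
      using Idl_insert[OF T(1) u(1)] ideal_add_assoc[OF idaE idT idP] by simp
    ultimately show ?case using insert.hyps by (simp add: add.commute)
  qed
  from this[OF S(1) order_refl] show ?thesis
    using ideal_add_commute[OF idaE idE] ideal_add_absorb[OF idE idaE ideal_prod_lower(2)[OF a(1) idE]] by simp
qed

end

context noetherian_cring
begin

section \<open>Artin-Rees with a parameter ideal and the growth bound\<close>

text \<open>Multigraded Artin-Rees is applied to the family enlarged by \<open>q\<close>. In the
  direction of \<open>q\<close> every step above \<open>N\<close> pulls one factor \<open>q\<close>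
  out of the intersection, and \<open>k\<close> such steps lead from exponent \<open>k + N\<close>
  to \<open>N\<close>.\<close>

lemma artin_rees_bump:
  assumes J: "\<And>i. i < r \<Longrightarrow> ideal (J i) R" and q: "ideal q R" and i: "i < r"
  shows "\<exists>N. \<forall>n k. (\<forall>i<r. N \<le> n i) \<longrightarrow>
     ideal_multi_pow R r J (bump i n) \<inter> (ideal_pow R q (k + N) \<cdot> ideal_multi_pow R r J n)
       \<subseteq> ideal_pow R q k \<cdot> ideal_multi_pow R r J (bump i n)"
proof -
  let ?P = "ideal_multi_pow R r J"
  \<comment> \<open>Coordinate \<open>r\<close> of the multidegree is the exponent of \<open>q\<close>.\<close>
  define J' where "J' = J(r := q)"
  have J': "ideal (J' i) R" if "i < Suc r" for i using that J q by (auto simp: J'_def)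
  have PJ': "ideal_multi_pow R r J' n = ?P n" for n by (intro multi_pow_cong) (auto simp: J'_def)
  have P': "ideal_multi_pow R (Suc r) J' n = ideal_pow R q (n r) \<cdot> ?P n" for n
    using multi_pow_Suc[of r J' n] J' PJ' by (simp add: J'_def)
  define W where "W n = ?P (bump i n) \<inter> ideal_multi_pow R (Suc r) J' n" for n
  have idP: "ideal (?P n) R" for n using multi_pow_ideal[of r J] J by blast
  have idP': "ideal (ideal_multi_pow R (Suc r) J' n) R" for n using multi_pow_ideal[of "Suc r" J'] J' by blast
  have idq: "ideal (ideal_pow R q k) R" for k using ideal_pow_ideal[OF q] .
  have idW: "ideal (W n) R" for n unfolding W_def using i_intersect[OF idP idP'] .
  have "\<exists>N. \<forall>n j. j < Suc r \<longrightarrow> (\<forall>i<Suc r. N \<le> n i) \<longrightarrow> (\<forall>i\<ge>Suc r. n i = 0) \<longrightarrow> W (bump j n) \<subseteq> J' j \<cdot> W n"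
  proof (rule multigraded_artin_rees[of "Suc r" J' W, OF J' idW])
    show "W n \<subseteq> ideal_multi_pow R (Suc r) J' n" for n by (simp add: W_def)
    fix n j assume j: "j < Suc r"
    have "J' j \<cdot> W n \<subseteq> J' j \<cdot> ?P (bump i n)" by (intro ideal_prod_mono) (auto simp: W_def)
    also have "\<dots> \<subseteq> ?P (bump i (bump j n))"
    proof (cases "j = r")
      case True
      then have "?P (bump i (bump j n)) = ?P (bump i n)" by (intro multi_pow_cong) (auto simp: bump_def)
      then show ?thesis using ideal_prod_lower(2)[OF J'[OF j] idP] by simp
    next
      case False
      then have "bump i (bump j n) = bump j (bump i n)" "J' j = J j" by (auto simp: bump_def J'_def)
      then show ?thesis using multi_pow_bump[of r J j "bump i n"] J False j by simp
    qed
    finally have 1: "J' j \<cdot> W n \<subseteq> ?P (bump i (bump j n))" .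
    have "J' j \<cdot> W n \<subseteq> J' j \<cdot> ideal_multi_pow R (Suc r) J' n" by (intro ideal_prod_mono) (auto simp: W_def)
    also have "\<dots> = ideal_multi_pow R (Suc r) J' (bump j n)" using multi_pow_bump[of "Suc r" J' j n] J' j by simp
    finally show "J' j \<cdot> W n \<subseteq> W (bump j n)" using 1 by (simp add: W_def)
  qed
  then obtain N where N': "\<forall>n j. j < Suc r \<longrightarrow> (\<forall>i<Suc r. N \<le> n i) \<longrightarrow> (\<forall>i\<ge>Suc r. n i = 0) \<longrightarrow> W (bump j n) \<subseteq> J' j \<cdot> W n"
    by (elim exE)
  have N: "W (bump r n) \<subseteq> q \<cdot> W n" if "\<forall>i<Suc r. N \<le> n i" "\<forall>i\<ge>Suc r. n i = 0" for n
    using spec[OF spec[OF N', of n], of r] that by (simp add: J'_def)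
  have main: "?P (bump i n) \<inter> (ideal_pow R q (k + N) \<cdot> ?P n) \<subseteq> ideal_pow R q k \<cdot> ?P (bump i n)"
    if n: "\<forall>i<r. N \<le> n i" for n k
  proof -
    \<comment> \<open>\<open>e l\<close> has exponent \<open>l\<close> at \<open>q\<close> and
      vanishes beyond, as Artin-Rees for \<open>Suc r\<close> ideals demands;
      \<open>l = k + N\<close> keeps every coordinate at least \<open>N\<close>.\<close>
    define e where "e l = (\<lambda>i. if i < r then n i else if i = r then l else 0)" for l
    have Pe: "?P (e l) = ?P n" "?P (bump i (e l)) = ?P (bump i n)" for l
      by (intro multi_pow_cong; simp add: e_def bump_def)+
    have We: "W (e l) = ?P (bump i n) \<inter> (ideal_pow R q l \<cdot> ?P n)" for l
      unfolding W_def P' Pe by (simp add: e_def)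
    have "W (e (k + N)) \<subseteq> ideal_pow R q k \<cdot> ?P (bump i n)"
    proof (induction k)
      case 0
      then show ?case unfolding We ideal_pow_0 ideal_prod_one_left[OF idP] by simp
    next
      case (Suc k)
      have "bump r (e (k + N)) = e (Suc k + N)" by (auto simp: bump_def e_def)
      then have "W (e (Suc k + N)) \<subseteq> q \<cdot> W (e (k + N))" using N[of "e (k + N)"] n by (auto simp: e_def)
      also have "\<dots> \<subseteq> q \<cdot> (ideal_pow R q k \<cdot> ?P (bump i n))" using Suc by (intro ideal_prod_mono) auto
      also have "\<dots> = ideal_pow R q (Suc k) \<cdot> ?P (bump i n)"
        unfolding ideal_pow_Suc ideal_prod_assoc[OF q idq idP] ..
      finally show ?case .
    qed
    then show ?thesis unfolding We .
  qed
  then show ?thesis by blast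
qed

text \<open>Walk from (N,...,N) to \<open>n\<close> by unit steps. Each of them costs
  \<open>N\<close> powers of \<open>q\<close> by \<open>artin_rees_bump\<close>, so the total loss
  is linear in the number of steps.\<close>

lemma linear_artin_rees:
  assumes J: "\<And>i. i < r \<Longrightarrow> ideal (J i) R" and q: "ideal q R"
  shows "\<exists>N. \<forall>n k. (\<forall>i<r. N \<le> n i) \<longrightarrow>
     ideal_multi_pow R r J n \<inter> (ideal_pow R q (k + N * (\<Sum>i<r. n i - N)) \<cdot> ideal_multi_pow R r J (\<lambda>_. N))
       \<subseteq> ideal_pow R q k \<cdot> ideal_multi_pow R r J n"
proof -
  let ?P = "ideal_multi_pow R r J"
  have "\<exists>N. i < r \<longrightarrow> (\<forall>n k. (\<forall>i<r. N \<le> n i) \<longrightarrow>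
     ?P (bump i n) \<inter> (ideal_pow R q (k + N) \<cdot> ?P n) \<subseteq> ideal_pow R q k \<cdot> ?P (bump i n))" for i
    using artin_rees_bump[of r J q i] J q by blast
  then obtain M where M: "\<And>i n k. i < r \<Longrightarrow> (\<forall>j<r. M i \<le> n j) \<Longrightarrow>
     ?P (bump i n) \<inter> (ideal_pow R q (k + M i) \<cdot> ?P n) \<subseteq> ideal_pow R q k \<cdot> ?P (bump i n)" by metis
  \<comment> \<open>The sum serves as a common upper bound of the constants of the \<open>r\<close>
    directions.\<close>
  define N where "N = (\<Sum>i<r. M i)"
  have MN: "M i \<le> N" if "i < r" for i unfolding N_def using that by (intro member_le_sum) auto
  have idP: "ideal (?P n) R" for n using multi_pow_ideal[of r J] J by blast
  have idq: "ideal (ideal_pow R q k) R" for k using ideal_pow_ideal[OF q] .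
  have step: "?P (bump i n) \<inter> (ideal_pow R q (k + N) \<cdot> ?P n) \<subseteq> ideal_pow R q k \<cdot> ?P (bump i n)"
    if "i < r" "\<forall>j<r. N \<le> n j" for i n k
  proof -
    have "ideal_pow R q (k + N) \<cdot> ?P n \<subseteq> ideal_pow R q (k + M i) \<cdot> ?P n"
      using MN[OF that(1)] by (intro ideal_prod_mono ideal_pow_antimono[OF q]) auto
    moreover have "\<forall>j<r. M i \<le> n j" using MN[OF that(1)] that(2) le_trans by blast
    ultimately show ?thesis using M[OF that(1), of n k] by blast
  qed
  have "?P (\<lambda>i. N + n i) \<inter> (ideal_pow R q (k + N * (\<Sum>i<r. n i)) \<cdot> ?P (\<lambda>_. N)) \<subseteq> ideal_pow R q k \<cdot> ?P (\<lambda>i. N + n i)"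
    for n k
  proof (induction n arbitrary: k rule: exponent_induct[where r=r])
    case (zero n)
    have "?P (\<lambda>i. N + n i) = ?P (\<lambda>_. N)" using zero by (intro multi_pow_cong) auto
    then show ?case using zero by simp
  next
    case (bump n i)
    let ?m = "\<lambda>i. N + n i"
    have m: "(\<lambda>j. N + bump i n j) = bump i ?m" by (auto simp: bump_def)
    have "(\<Sum>j\<in>{..<r} - {i}. bump i n j) = (\<Sum>j\<in>{..<r} - {i}. n j)" by (intro sum.cong) (auto simp: bump_def)
    then have s: "(\<Sum>j<r. bump i n j) = Suc (\<Sum>i<r. n i)"
      using bump(1) by (simp add: sum.remove[of "{..<r}" i] bump_def)
    have k: "k + N * Suc (\<Sum>i<r. n i) = (k + N) + N * (\<Sum>i<r. n i)" by simp
    have "?P (bump i ?m) \<subseteq> ?P ?m" using multi_pow_bump_le[of r J i] J bump(1) by blast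
    \<comment> \<open>An element of the smaller power also lies in the larger one, where the
      induction hypothesis with \<open>k + N\<close> applies; the last step then spends these
      \<open>N\<close> powers.\<close>
    then show ?case
      unfolding m s k using bump(2)[of "k + N"] step[OF bump(1), of ?m k] by auto
  qed
  note shifted = this
  have "?P n \<inter> (ideal_pow R q (k + N * (\<Sum>i<r. n i - N)) \<cdot> ?P (\<lambda>_. N)) \<subseteq> ideal_pow R q k \<cdot> ?P n"
    if n: "\<forall>i<r. N \<le> n i" for n k
  proof -
    have "?P (\<lambda>i. N + (n i - N)) = ?P n" using n by (intro multi_pow_cong) auto
    then show ?thesis using shifted[of "\<lambda>i. n i - N" k] by simp
  qed
  then show ?thesis by blast
qed

end

context noetherian_local_ring
begin

text \<open>The ideal \<open>a\<close>, a power of the parameter ideal, is returned with the growth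
  bound because the same \<open>a\<close> later shows that the cyclic quotients of the monomial
  filtration have finite length.\<close>

lemma quotient_growth:
  assumes dim: "\<And>P n. prime_chain R P n \<Longrightarrow> n \<le> d"
    and I: "\<And>i. i < r \<Longrightarrow> ideal (I i) R" and J: "\<And>i. i < r \<Longrightarrow> ideal (J i) R"
    and sub: "\<And>i. i < r \<Longrightarrow> I i \<subseteq> J i" and fin: "\<And>i. i < r \<Longrightarrow> finite_length R (I i) (J i)"
  shows "\<exists>a. ideal a R \<and> finite_length R a (carrier R) \<and> (\<forall>i<r. a \<cdot> J i \<subseteq> I i) \<and>
    (\<exists>N C. \<forall>t\<ge>N. len_le R (ideal_multi_pow R r I (\<lambda>_. t)) (ideal_multi_pow R r J (\<lambda>_. t)) (C * (t + 1) ^ d))"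
proof -
  let ?P = "ideal_multi_pow R r J"
  obtain q b where q: "ideal q R" "q \<subseteq> m" and b: "\<And>k. len_le R (ideal_pow R q k) (carrier R) (k ^ d * b)"
    using parameter_ideal[of d] dim by blast
  have idq: "ideal (ideal_pow R q k) R" for k using ideal_pow_ideal[OF q(1)] .
  have idP: "ideal (?P n) R" for n using multi_pow_ideal[of r J] J by blast
  have idPI: "ideal (ideal_multi_pow R r I n) R" for n using multi_pow_ideal[of r I] I by blast
  have "\<exists>c. i < r \<longrightarrow> ideal_pow R q c \<cdot> J i \<subseteq> I i" for i
    using finite_length_imp_pow_le[of "I i" "J i" q] I J sub fin q by blast
  then obtain c where c: "\<And>i. i < r \<Longrightarrow> ideal_pow R q (c i) \<cdot> J i \<subseteq> I i" by metis
  define e where "e = (\<Sum>i<r. c i)"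
  have e: "ideal_pow R q e \<cdot> J i \<subseteq> I i" if "i < r" for i
  proof -
    have "c i \<le> e" unfolding e_def using that by (intro member_le_sum) auto
    then have "ideal_pow R q e \<cdot> J i \<subseteq> ideal_pow R q (c i) \<cdot> J i"
      by (intro ideal_prod_mono ideal_pow_antimono[OF q(1)]) auto
    then show ?thesis using c[OF that] by blast
  qed
  have "finite_length R (ideal_pow R q e) (carrier R)" using b finite_length_iff_len_le by blast
  moreover obtain N where N: "\<And>n k. (\<forall>i<r. N \<le> n i) \<Longrightarrow>
      ?P n \<inter> (ideal_pow R q (k + N * (\<Sum>i<r. n i - N)) \<cdot> ?P (\<lambda>_. N)) \<subseteq> ideal_pow R q k \<cdot> ?P n"
    using linear_artin_rees[of r J q] J q(1) by blast
  obtain S where S: "S \<subseteq> carrier R" "finite S" "?P (\<lambda>_. N) = Idl S" using finetely_gen[OF idP] by blast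
  \<comment> \<open>The exponent \<open>?K\<close> below is at most
    \<open>(e + N) * r * (t + 1)\<close>, and the base ideal has \<open>card S\<close>
    generators.\<close>
  define C where "C = card S * ((e + N) * r) ^ d * b"
  have "len_le R (ideal_multi_pow R r I (\<lambda>_. t)) (?P (\<lambda>_. t)) (C * (t + 1) ^ d)" if t: "t \<ge> N" for t
  proof -
    \<comment> \<open>\<open>q ^ ?k\<close> multiplies the power of \<open>J\<close> into that of
      \<open>I\<close>; \<open>?K\<close> adds the Artin-Rees loss for the
      \<open>r * (t - N)\<close> unit steps from (N,...,N) to (t,...,t).\<close>
    let ?k = "e * (r * t)" and ?K = "e * (r * t) + N * (r * (t - N))"
    let ?E = "?P (\<lambda>_. N)"
    have EI: "len_le R (ideal_pow R q ?K \<cdot> ?E) ?E (card S * (?K ^ d * b))"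
      unfolding S(3) by (rule len_le_mult_finitely_generated[OF idq b S(2,1)])
    have PE: "?P (\<lambda>_. t) \<subseteq> ?E"
    proof -
      have "?P (\<lambda>i. N + n i) \<subseteq> ?E" for n
      proof (induction n rule: exponent_induct[where r=r])
        case (zero n)
        then have "?P (\<lambda>i. N + n i) = ?E" by (intro multi_pow_cong) auto
        then show ?case by simp
      next
        case (bump n i)
        have "(\<lambda>j. N + bump i n j) = bump i (\<lambda>i. N + n i)" by (auto simp: bump_def)
        then show ?case using multi_pow_bump_le[of r J i "\<lambda>i. N + n i"] J bump by auto
      qed
      from this[of "\<lambda>_. t - N"] show ?thesis using t by simp
    qed
    have "len_le R (ideal_pow R q ?k \<cdot> ?P (\<lambda>_. t)) (?P (\<lambda>_. t)) (card S * (?K ^ d * b))"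
    proof (rule len_le_second_iso[OF idP _ _ _ PE _ idP EI])
      show "?P (\<lambda>_. t) \<inter> (ideal_pow R q ?K \<cdot> ?E) \<subseteq> ideal_pow R q ?k \<cdot> ?P (\<lambda>_. t)"
        using N[of "\<lambda>_. t" ?k] t by simp
    qed (use ideal_prod_is_ideal[OF idq idP] ideal_prod_lower(2)[OF idq idP] in auto)
    moreover have "ideal_pow R q ?k \<cdot> ?P (\<lambda>_. t) \<subseteq> ideal_multi_pow R r I (\<lambda>_. t)"
      using pow_mult_multi_pow_le[of q r I J e "\<lambda>_. t"] q(1) I J e by simp
    ultimately have "len_le R (ideal_multi_pow R r I (\<lambda>_. t)) (?P (\<lambda>_. t)) (card S * (?K ^ d * b))"
      using len_le_sub[OF _ ideal_prod_is_ideal[OF idq idP] idP] by blast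
    moreover have "card S * (?K ^ d * b) \<le> C * (t + 1) ^ d"
    proof -
      have "?K \<le> e * (r * (t + 1)) + N * (r * (t + 1))" by (intro add_mono mult_le_mono) auto
      also have "\<dots> = ((e + N) * r) * (t + 1)" by (simp add: algebra_simps)
      finally have "?K ^ d \<le> (((e + N) * r) * (t + 1)) ^ d" by (rule power_mono) simp
      then have "card S * (?K ^ d * b) \<le> card S * ((((e + N) * r) * (t + 1)) ^ d * b)"
        by (intro mult_le_mono) auto
      also have "\<dots> = C * (t + 1) ^ d" unfolding C_def power_mult_distrib[of "(e + N) * r"] by (simp only: mult_ac)
      finally show ?thesis .
    qed
    ultimately show ?thesis by (rule len_le_mono)
  qed
  ultimately show ?thesis using idq e by blast
qed

end

section \<open>Length along the monomial filtration and the Hilbert function\<close>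

text \<open>Monomials are added in increasing order. As \<open>T\<close> is closed downwards, all
  monomials so far lie in \<open>T\<close> as long as the newest one does, and the quotient is zero.
  Afterwards the lower ideal stays fixed and each new monomial adds a cyclic quotient.\<close>

lemma (in cring) quot_length_monomial_filtration:
  assumes V: "finite V" and g: "g ` V \<subseteq> carrier R"
    and T: "\<And>u v. u \<in> T \<Longrightarrow> lex_less v u \<Longrightarrow> v \<in> mons V h n \<Longrightarrow> v \<in> T"
    and fin: "\<And>u. u \<in> mons V h n \<Longrightarrow> u \<notin> T \<Longrightarrow>
       finite_length R (colon R (monid V g (below V h u)) (mon V g u)) (carrier R)"
  shows "finite_length R (monid V g (mons V h n \<inter> T)) (monid V g (mons V h n)) \<and>
    quot_length R (monid V g (mons V h n \<inter> T)) (monid V g (mons V h n)) =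
      (\<Sum>u\<in>mons V h n. if u \<in> T then 0 else quot_length R (colon R (monid V g (below V h u)) (mon V g u)) (carrier R))"
  using finite_mons[OF V, of h n]
proof (induction rule: lex_less_initial_segment_induct)
  case empty
  then show ?case using quot_length_refl[OF monid_ideal[OF g, of "{}"]] by simp
next
  case (step u S)
  let ?l = "\<lambda>u. if u \<in> T then 0 else quot_length R (colon R (monid V g (below V h u)) (mon V g u)) (carrier R)"
  have idB: "ideal (monid V g S) R" for S using monid_ideal[OF g] .
  have mc: "mon V g u \<in> carrier R" using mon_closed[OF g] .
  have S: "S = below V h u" using step(1,2) by (simp add: below_def mons_def)
  have finS: "finite S" unfolding step(2) using finite_mons[OF V, of h n] by simp
  have uS: "u \<notin> S" using lex_less_irrefl step(2) by auto
  show ?case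
  proof (cases "u \<in> T")
    case True
    then have "insert u S \<subseteq> T" using T step(2) by auto
    then have "insert u S \<inter> T = insert u S" "(\<Sum>u\<in>insert u S. ?l u) = 0"
      by (blast, intro sum.neutral) auto
    then show ?thesis using quot_length_refl[OF idB[of "insert u S"]] by simp
  next
    case False
    then have T1: "insert u S \<inter> T = S \<inter> T" by auto
    have ins: "monid V g (insert u S) = monid V g S <+> PIdl (mon V g u)" by (rule monid_insert[OF g])
    have le1: "monid V g (S \<inter> T) \<subseteq> monid V g S" and le2: "monid V g S \<subseteq> monid V g (insert u S)"
      by (intro monid_mono[OF g]; blast)+
    have cyc: "len_le R (monid V g S) (monid V g (insert u S)) b \<longleftrightarrow>
       len_le R (colon R (monid V g (below V h u)) (mon V g u)) (carrier R) b" for b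
      unfolding ins using cyclic_quotient_len[OF idB mc] S by simp
    have idc: "ideal (colon R (monid V g (below V h u)) (mon V g u)) R" using colon_ideal[OF idB mc] .
    have f1: "finite_length R (colon R (monid V g (below V h u)) (mon V g u)) (carrier R)"
      using fin[OF step(1) False] .
    then have f2: "finite_length R (monid V g S) (monid V g (insert u S))"
      using cyc finite_length_iff_len_le by blast
    have "quot_length R (monid V g S) (monid V g (insert u S)) = ?l u"
      using quot_length_eqI[OF f2 idB idB le2 f1 idc oneideal ideal_carr[OF idc]] cyc False by simp
    then show ?thesis
      using quot_length_add[OF idB idB idB le1 le2 conjunct1[OF step(3)] f2] step(3) uS finS T1 by simp
  qed
qed

theorem (in noetherian_local_ring) hilbert_function_of_powers:
  assumes dim: "\<And>P n. prime_chain R P n \<Longrightarrow> n \<le> d"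
    and I: "\<And>i. i < r \<Longrightarrow> ideal (I i) R" and J: "\<And>i. i < r \<Longrightarrow> ideal (J i) R"
    and sub: "\<And>i. i < r \<Longrightarrow> I i \<subseteq> J i" and fin: "\<And>i. i < r \<Longrightarrow> finite_length R (I i) (J i)"
  shows "\<exists>A c. mpoly_repr r d A \<and> numerical r A c \<and>
           (\<exists>N. \<forall>n::nat \<Rightarrow> nat. (\<forall>i<r. N \<le> n i) \<longrightarrow>
              finite_length R (ideal_multi_pow R r I n) (ideal_multi_pow R r J n) \<and>
              of_nat (quot_length R (ideal_multi_pow R r I n) (ideal_multi_pow R r J n))
                = mpoly_eval r A c (\<lambda>i. int (n i)))"
proof -
  obtain a N0 C where a: "ideal a R" "finite_length R a (carrier R)" "\<And>i. i < r \<Longrightarrow> a \<cdot> J i \<subseteq> I i"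
    and growth: "\<And>t. t \<ge> N0 \<Longrightarrow> len_le R (ideal_multi_pow R r I (\<lambda>_. t)) (ideal_multi_pow R r J (\<lambda>_. t)) (C * (t + 1) ^ d)"
    using quotient_growth[of d r I J] dim I J sub fin by blast
  have genJ: "\<exists>p g h. g ` {..<p::nat} \<subseteq> carrier R \<and> h ` {..<p} \<subseteq> {..<r} \<and>
      (\<forall>i<r. J i = Idl (g ` {j \<in> {..<p}. h j = i}))"
    by (rule finite_generator_family) (rule J)
  have genI: "\<exists>p g h. g ` {..<p::nat} \<subseteq> carrier R \<and> h ` {..<p} \<subseteq> {..<r} \<and>
      (\<forall>i<r. I i = Idl (g ` {j \<in> {..<p}. h j = i}))"
    by (rule finite_generator_family) (rule I)
  obtain p g1 h1 where 1: "g1 ` {..<p::nat} \<subseteq> carrier R \<and> h1 ` {..<p} \<subseteq> {..<r} \<and>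
      (\<forall>i<r. J i = Idl (g1 ` {j \<in> {..<p}. h1 j = i}))"
    using genJ by (elim exE) (rule that)
  obtain s g2 h2 where 2: "g2 ` {..<s::nat} \<subseteq> carrier R \<and> h2 ` {..<s} \<subseteq> {..<r} \<and>
      (\<forall>i<r. I i = Idl (g2 ` {j \<in> {..<s}. h2 j = i}))"
    using genI by (elim exE) (rule that)
  \<comment> \<open>Generators of \<open>J\<close> precede those of \<open>I\<close>, so that exponents involving only the latter
    (the set \<open>T\<close> below) are lexicographically smaller than all others.\<close>
  define V where "V = {..<p + s}"
  define X where "X = {p..<p + s}"
  define g where "g j = (if j < p then g1 j else g2 (j - p))" for j
  define h where "h j = (if j < p then h1 j else h2 (j - p))" for j
  have V: "finite V" and X: "finite X" "X \<subseteq> V" by (auto simp: V_def X_def)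
  have gV: "g ` V \<subseteq> carrier R"
  proof (rule image_subsetI)
    fix j assume "j \<in> V"
    then show "g j \<in> carrier R" using 1 2 by (cases "j < p") (auto simp: g_def V_def image_subset_iff)
  qed
  have hV: "h ` V \<subseteq> {..<r}"
  proof (rule image_subsetI)
    fix j assume "j \<in> V"
    then show "h j \<in> {..<r}" using 1 2 by (cases "j < p") (auto simp: h_def V_def image_subset_iff)
  qed
  have gX: "g ` X \<subseteq> carrier R" and hX: "h ` X \<subseteq> {..<r}" using gV hV X(2) by blast+
  have im2: "g ` {j \<in> X. h j = i} = g2 ` {j \<in> {..<s}. h2 j = i}" for i
  proof (intro equalityI subsetI)
    fix x assume "x \<in> g ` {j \<in> X. h j = i}"
    then obtain j where "j \<in> X" "h j = i" "x = g j" by auto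
    then show "x \<in> g2 ` {j \<in> {..<s}. h2 j = i}"
      by (intro image_eqI[of _ _ "j - p"]) (auto simp: X_def g_def h_def)
  next
    fix x assume "x \<in> g2 ` {j \<in> {..<s}. h2 j = i}"
    then obtain j where "j < s" "h2 j = i" "x = g2 j" by auto
    then show "x \<in> g ` {j \<in> X. h j = i}"
      by (intro image_eqI[of _ _ "j + p"]) (auto simp: X_def g_def h_def)
  qed
  have IX: "I i = Idl (g ` {j \<in> X. h j = i})" if "i < r" for i using 2 that im2 by simp
  have JV: "J i = Idl (g ` {j \<in> V. h j = i})" if i: "i < r" for i
  proof
    have sub1: "g1 ` {j \<in> {..<p}. h1 j = i} \<subseteq> g ` {j \<in> V. h j = i}"
    proof (rule image_subsetI)
      fix j assume "j \<in> {j \<in> {..<p}. h1 j = i}"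
      then show "g1 j \<in> g ` {j \<in> V. h j = i}"
        by (intro image_eqI[of _ _ j]) (auto simp: V_def g_def h_def)
    qed
    have gi: "g ` {j \<in> V. h j = i} \<subseteq> carrier R" using gV by auto
    show "J i \<subseteq> Idl (g ` {j \<in> V. h j = i})" using subset_Idl_subset[OF gi sub1] 1 i by simp
    have "g j \<in> J i" if j: "j \<in> V" "h j = i" for j
    proof (cases "j < p")
      case True
      have "g1 ` {j \<in> {..<p}. h1 j = i} \<subseteq> J i"
        using genideal_self[of "g1 ` {j \<in> {..<p}. h1 j = i}"] 1 i by auto
      then show ?thesis using True j by (auto simp: g_def h_def)
    next
      case False
      have "g ` {j \<in> X. h j = i} \<subseteq> I i"
        using genideal_self[of "g ` {j \<in> X. h j = i}"] gX IX[OF i] by auto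
      moreover have "j \<in> {j \<in> X. h j = i}" using False j by (auto simp: X_def V_def)
      ultimately show ?thesis using sub[OF i] by blast
    qed
    then show "Idl (g ` {j \<in> V. h j = i}) \<subseteq> J i" by (intro genideal_minimal J i) auto
  qed
  define T :: "(nat \<Rightarrow> nat) set" where "T = {u. \<forall>j<p. u j = 0}"
  have PJ: "ideal_multi_pow R r J n = monid V g (mons V h n)" if "\<forall>i\<ge>r. n i = 0" for n
    using multi_pow_eq_monid[OF V gV hV JV that] .
  have PI: "ideal_multi_pow R r I n = monid V g (mons V h n \<inter> T)" if "\<forall>i\<ge>r. n i = 0" for n
  proof -
    have eX: "u \<in> expo X \<longleftrightarrow> u \<in> expo V \<and> u \<in> T" for u by (auto simp: expo_def X_def V_def T_def)
    have gd: "gdeg X h u = gdeg V h u" if "u \<in> expo X" for u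
    proof
      fix i show "gdeg X h u i = gdeg V h u i"
        unfolding gdeg_def using X V that by (intro sum.mono_neutral_left) (auto simp: expo_def)
    qed
    have "mons X h n = mons V h n \<inter> T" using eX gd unfolding mons_def by auto
    moreover have "mon X g ` (mons X h n) = mon V g ` (mons X h n)"
      using mon_subset[OF V gV X(2)] by (intro image_cong) (auto simp: mons_def)
    ultimately show ?thesis using multi_pow_eq_monid[OF X(1) gX hX IX that] by (simp add: monid_def)
  qed
  define L where "L u = colon R (monid V g (below V h u)) (mon V g u)" for u
  define f where "f u = (if u \<in> T then 0 else quot_length R (L u) (carrier R))" for u
  have idB: "ideal (monid V g S) R" for S using monid_ideal[OF gV] .
  have mc: "mon V g u \<in> carrier R" for u using mon_closed[OF gV] .
  \<comment> \<open>Since \<open>u\<close> is outside \<open>T\<close>, it contains a generator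
    \<open>g j\<close> of \<open>J (h j)\<close>. For \<open>z \<in> a\<close> the product
    \<open>z \<otimes> g j\<close> is a combination of generators \<open>g k\<close> of
    \<open>I (h j)\<close> with \<open>k > j\<close>, and replacing \<open>j\<close> by
    \<open>k\<close> in \<open>u\<close> lowers it lexicographically. Hence
    \<open>a \<subseteq> L u\<close>.\<close>
  have finL: "finite_length R (L u) (carrier R)" if u: "u \<in> expo V" "u \<notin> T" for u
  proof -
    obtain j where j: "j < p" "u j > 0" using u(2) by (auto simp: T_def)
    have jV: "j \<in> V" using j by (simp add: V_def)
    then have hj: "h j < r" using hV by (auto simp: image_subset_iff)
    define n where "n = gdeg V h u"
    have nj: "n (h j) > 0" unfolding n_def gdeg_def using V jV j by (intro sum_pos2[of _ j]) auto
    have "u \<in> mons V h (bump (h j) (n(h j := n (h j) - 1)))" using u(1) nj by (auto simp: mons_def n_def bump_def)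
    from mons_unbump[OF V jV this j(2)] obtain v where v: "v \<in> expo V" "u = bump j v" by (auto simp: mons_def)
    have "a \<subseteq> L u"
    proof
      fix z assume z: "z \<in> a"
      have zc: "z \<in> carrier R" using z ideal_carr[OF a(1)] by blast
      have gj: "g j \<in> carrier R" using gV jV by auto
      have "g j \<in> J (h j)" unfolding JV[OF hj] using genideal_self[of "g ` {k \<in> V. h k = h j}"] gV jV by blast
      then have "z \<otimes> g j \<in> I (h j)" using a(3)[OF hj] ideal_prod_mem[OF z] by blast
      then have zI: "z \<otimes> g j \<in> Idl (g ` {k \<in> X. h k = h j})" using IX[OF hj] by simp
      have "z \<otimes> g j \<otimes> mon V g v \<in> monid V g (below V h u)"
      proof (rule Idl_mult_mem[OF _ idB mc _ zI])
        show "g ` {k \<in> X. h k = h j} \<subseteq> carrier R" using gX by auto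
        fix x assume "x \<in> g ` {k \<in> X. h k = h j}"
        then obtain k where k: "k \<in> X" "h k = h j" "x = g k" by auto
        have kV: "k \<in> V" and jk: "j < k" using k(1) X j(1) by (auto simp: X_def)
        have "lex_less (bump k v) u" unfolding v(2) lex_less_def using jk by (intro exI[of _ j]) (auto simp: bump_def)
        then have "bump k v \<in> below V h u"
          using gdeg_bump[OF V kV, of h v] gdeg_bump[OF V jV, of h v] bump_expo[OF v(1) kV] k(2) v(2)
          by (simp add: below_def mons_def)
        then have "mon V g (bump k v) \<in> monid V g (below V h u)" by (rule monid_mem[OF gV])
        then show "x \<otimes> mon V g v \<in> monid V g (below V h u)" using mon_bump[OF V gV kV] k(3) by simp
      qed
      moreover have "z \<otimes> mon V g u = z \<otimes> g j \<otimes> mon V g v"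
        using mon_bump[OF V gV jV] v(2) m_assoc[OF zc gj mc] by simp
      ultimately show "z \<in> L u" using zc by (simp add: L_def colon_def)
    qed
    moreover obtain b where "len_le R a (carrier R) b" using a(2) finite_length_iff_len_le by blast
    ultimately have "len_le R (L u) (carrier R) b" using len_le_sub[OF _ a(1) oneideal] by blast
    then show ?thesis using finite_length_iff_len_le by blast
  qed
  have main: "finite_length R (ideal_multi_pow R r I n) (ideal_multi_pow R r J n) \<and>
      quot_length R (ideal_multi_pow R r I n) (ideal_multi_pow R r J n) = (\<Sum>u\<in>mons V h n. f u)"
    if n: "\<forall>i\<ge>r. n i = 0" for n
    unfolding PI[OF n] PJ[OF n] f_def L_def
  proof (rule quot_length_monomial_filtration[OF V gV])
    fix u v assume uv: "u \<in> T" "lex_less v u" "v \<in> mons V h n"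
    obtain j where j: "v j < u j" "\<forall>i<j. v i = u i" using uv(2) by (auto simp: lex_less_def)
    \<comment> \<open>At the first difference \<open>v j < u j\<close>, so \<open>u j\<close> is
      nonzero and \<open>j\<close> lies beyond the generators of \<open>J\<close>.\<close>
    have "p \<le> j" using j(1) uv(1) by (auto simp: T_def not_le[symmetric])
    then show "v \<in> T" using j(2) uv(1) by (auto simp: T_def)
  next
    fix u assume "u \<in> mons V h n" "u \<notin> T"
    then show "finite_length R (colon R (monid V g (below V h u)) (mon V g u)) (carrier R)"
      using finL[of u] by (simp add: mons_def L_def)
  qed
  have z0: "{\<zero>} <+> monid V g S = monid V g S" for S
    using ideal_add_commute[OF zeroideal idB] ideal_add_absorb[OF idB zeroideal] ideal_zero_mem[OF idB] by simp
  have "\<exists>c. \<forall>c'\<ge>c. \<forall>u\<in>expo V. colon R ({\<zero>} <+> monid V g (below V h u)) (mon V g u) =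
      colon R ({\<zero>} <+> monid V g (below V h (cap c' u))) (mon V g (cap c' u))"
    by (rule leading_coefficients_cap[OF V gV, of "\<lambda>_. {\<zero>}"]) (use zeroideal gV in auto)
  then obtain c where c: "\<And>c' u. c' \<ge> c \<Longrightarrow> u \<in> expo V \<Longrightarrow> L u = L (cap c' u)"
    unfolding z0 L_def by blast
  \<comment> \<open>The cap is \<open>Suc c\<close> because a cap of 0 would send every vector into
    \<open>T\<close>; a positive cap preserves which exponents vanish.\<close>
  have fcap: "f u = f (cap (Suc c) u)" if "u \<in> expo V" for u
  proof -
    have "cap (Suc c) u \<in> T \<longleftrightarrow> u \<in> T" by (auto simp: T_def cap_def min_def split: if_splits)
    then show ?thesis using c[of "Suc c" u] that by (simp add: f_def)
  qed
  \<comment> \<open>The powers of ideals ignore \<open>n\<close> from \<open>r\<close> on, whereas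
    the count of monomials needs zeros there.\<close>
  let ?tr = "\<lambda>n i. if i < r then n i else 0"
  have tr: "ideal_multi_pow R r K (?tr n) = ideal_multi_pow R r K n" for K n by (intro multi_pow_cong) auto
  have gr: "(\<Sum>u\<in>mons V h (\<lambda>i. if i < r then t else 0). f u) \<le> C * (t + 1) ^ d" if t: "t \<ge> N0" for t
  proof -
    have "ideal (ideal_multi_pow R r I (\<lambda>_. t)) R" "ideal (ideal_multi_pow R r J (\<lambda>_. t)) R"
      using multi_pow_ideal[of r I] multi_pow_ideal[of r J] I J by auto
    then have "quot_length R (ideal_multi_pow R r I (\<lambda>_. t)) (ideal_multi_pow R r J (\<lambda>_. t)) \<le> C * (t + 1) ^ d"
      using quot_length_le[OF growth[OF t]] multi_pow_mono[of r I J] I J sub by blast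
    then show ?thesis using main[of "?tr (\<lambda>_. t)"] tr[of _ "\<lambda>_. t"] by simp
  qed
  have "\<exists>A e. mpoly_repr r d A \<and> numerical r A e \<and> (\<exists>N. \<forall>n. (\<forall>i<r. N \<le> n i) \<and> (\<forall>i\<ge>r. n i = 0) \<longrightarrow>
     of_nat (\<Sum>u\<in>mons V h n. f u) = mpoly_eval r A e (\<lambda>i. int (n i)))"
    by (rule sum_mons_eventually_numerical_polynomial[OF V hV]) (rule fcap gr, assumption)+
  then obtain A e where Ae: "mpoly_repr r d A \<and> numerical r A e \<and> (\<exists>N. \<forall>n. (\<forall>i<r. N \<le> n i) \<and> (\<forall>i\<ge>r. n i = 0) \<longrightarrow>
       of_nat (\<Sum>u\<in>mons V h n. f u) = mpoly_eval r A e (\<lambda>i. int (n i)))"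
    by (elim exE) (rule that)
  then have A: "mpoly_repr r d A" "numerical r A e" by simp_all
  from Ae obtain N where N: "\<forall>n. (\<forall>i<r. N \<le> n i) \<and> (\<forall>i\<ge>r. n i = 0) \<longrightarrow>
       of_nat (\<Sum>u\<in>mons V h n. f u) = mpoly_eval r A e (\<lambda>i. int (n i))" by (elim conjE exE)
  have "finite_length R (ideal_multi_pow R r I n) (ideal_multi_pow R r J n) \<and>
      of_nat (quot_length R (ideal_multi_pow R r I n) (ideal_multi_pow R r J n)) = mpoly_eval r A e (\<lambda>i. int (n i))"
    if n: "\<forall>i<r. N \<le> n i" for n
  proof -
    have "mpoly_eval r A e (\<lambda>i. int (?tr n i)) = mpoly_eval r A e (\<lambda>i. int (n i))"
      unfolding mpoly_eval_def by (intro sum.cong arg_cong2[where f="(*)"] prod.cong refl) auto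
    moreover have "\<forall>i\<ge>r. ?tr n i = 0" "\<forall>i<r. N \<le> ?tr n i" using n by auto
    ultimately show ?thesis using main[of "?tr n"] spec[OF N, of "?tr n"] unfolding tr by simp
  qed
  then show ?thesis using A by blast
qed

theorem theorem5p3:
  fixes R :: "('a, 'b) ring_scheme" and d r :: nat and I J :: "nat \<Rightarrow> 'a set"
  assumes "noetherian_ring R" and "local_ring R" and "has_krull_dim R d"
    and "\<And>i. i < r \<Longrightarrow> ideal (I i) R"
    and "\<And>i. i < r \<Longrightarrow> ideal (J i) R"
    and "\<And>i. i < r \<Longrightarrow> I i \<subseteq> J i"
    and "\<And>i. i < r \<Longrightarrow> finite_length R (I i) (J i)"
  shows "\<exists>A c. mpoly_repr r d A \<and> numerical r A c \<and>
           (\<exists>N. \<forall>n::nat \<Rightarrow> nat. (\<forall>i<r. N \<le> n i) \<longrightarrow>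
              finite_length R (ideal_multi_pow R r I n) (ideal_multi_pow R r J n) \<and>
              of_nat (quot_length R (ideal_multi_pow R r I n) (ideal_multi_pow R r J n))
                = mpoly_eval r A c (\<lambda>i. int (n i)))"
proof -
  have "cring R" using assms(2) by (simp add: local_ring_def)
  obtain m where m: "maximalideal m R" "\<And>M. maximalideal M R \<Longrightarrow> M = m"
    using assms(2) unfolding local_ring_def by blast
  interpret noetherian_ring R by fact
  interpret cring R by fact
  interpret noetherian_cring R by unfold_locales
  interpret noetherian_local_ring R m
    by (intro noetherian_local_ring.intro noetherian_local_ring_axioms.intro noetherian_cring_axioms m)
  show ?thesis
    by (rule hilbert_function_of_powers[OF _ assms(4-7)]) (use assms(3) in \<open>auto simp: has_krull_dim_def\<close>)
qed

end
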